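(* Up to conjugation by a Möbius transformation there are exactly $14$ critically fixed rational maps of degree $5$ from the Riemann sphere $\mathbb{P}^1_{\mathbb{C}}$ to itself, namely the following maps $f_1,\ldots,f_{14}$ (that is, each $f_i$ is critically fixed of degree $5$, they are pairwise non-conjugate, and every critically fixed rational map of degree $5$ is conjugate to one of them by a Möbius transformation): 1. $f_1(z)=z^5$; 2. $f_2(z)=\dfrac{z^2(10+10z+5z^2+z^3)}{1+5z}$; 3. $f_3(z)=\dfrac{z^3(10+5z+z^2)}{1+5z+10z^2}$; 4. $f_4(z)=-\dfrac{z^4(5-3z)}{3-5z}$; 5. $f_5(z)=\dfrac{z^3(5-3z^2)}{2}$; 6. $f_6(z)=\dfrac{z^3(220-165z+36z^2)}{121}$; 7. $f_7(z)=-\dfrac{z^4\big((5-\sqrt5)-2z\big)}{(7-3\sqrt5)-2(5-2\sqrt5)z}$; 8. $f_8(z)=-\dfrac{z^4\big(5(3-\sqrt{21})+6z\big)}{3(23-5\sqrt{21})-10(9-2\sqrt{21})z}$; 9. $f_9(z)=\dfrac{z^3\big(2(5+a)-(15+a)z+6z^2\big)}{(1-a)+2az}$, where $a=\sqrt{5(4\sqrt{61}-31)}$; 10. $f_{10}(z)=\dfrac{z^3\big(2(5+\mathrm{i}b)-(15+\mathrm{i}b)z+6z^2\big)}{(1-\mathrm{i}b)+2\mathrm{i}bz}$, where $b=\sqrt{5(4\sqrt{61}+31)}$; 11. $f_{11}(z)=-\dfrac{z^3(5-z^2)}{1-5z^2}$; 12. $f_{12}(z)=-\dfrac{z^3(20-5z-z^2)}{1+5z-20z^2}$;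 13. $f_{13}(z)=z^2(5-10z+10z^2-4z^3)$; 14. $f_{14}(z)=-\dfrac{z^3\big(u(\sigma)+v(\sigma)z+w(\sigma)z^2\big)}{\sigma\big(2\sigma(\sigma^2-\sigma+1)-(\sigma+1)(3\sigma^2-5\sigma+3)z\big)}$, where $u(\sigma)=(\sigma^2-3\sigma+1)(\sigma^2+5\sigma+1)$, $v(\sigma)=-2(\sigma+1)(\sigma^2-5\sigma+1)$, $w(\sigma)=\sigma^2-7\sigma+1$, $\sigma=\rho+\mathrm{i}\sqrt{\tfrac16-\tfrac43\rho-\tfrac13\rho^2}$ and $\rho$ is the unique real number satisfying $8\rho^3-52\rho^2+134\rho-15=0$.
   Context: A rational map $f\colon\mathbb{P}^1_{\mathbb{C}}\to\mathbb{P}^1_{\mathbb{C}}$ is critically fixed if every critical point of $f$ is a fixed point of $f$. Two rational maps $f,g$ are conjugate by a Möbius transformation if $g=\phi\circ f\circ\phi^{-1}$ for some $\phi\in\mathrm{PGL}_2(\mathbb{C})$. *)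

theory Defs
  imports Complex_Main "HOL-Computational_Algebra.Polynomial"
begin

text \<open>The Riemann sphere as the complex plane with one additional point:
  \<open>Aff z\<close> is the point \<open>(z : 1)\<close> of the projective line and \<open>Infty\<close> is \<open>(1 : 0)\<close>.\<close>

datatype sphere = Aff complex | Infty

text \<open>For coprime \<open>p, q\<close> with \<open>d = max (degree p) (degree q)\<close>, this is the map
  \<open>(x : y) \<mapsto> (P (x, y) : Q (x, y))\<close>, where \<open>P, Q\<close> are the homogenizations of \<open>p, q\<close>
  in degree \<open>d\<close>; thus \<open>Infty = (1 : 0)\<close> is sent to \<open>(coeff p d : coeff q d)\<close>.
  The value at a common zero of \<open>p\<close> and \<open>q\<close> has no meaning.\<close>

definition rat_map :: "complex poly \<Rightarrow> complex poly \<Rightarrow> sphere \<Rightarrow> sphere" where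
  "rat_map p q x =
     (case x of
        Aff z \<Rightarrow> if poly q z = 0 then Infty else Aff (poly p z / poly q z)
      | Infty \<Rightarrow>
          let d = max (degree p) (degree q)
          in if coeff q d = 0 then Infty else Aff (coeff p d / coeff q d))"

definition rational_map_of_degree :: "nat \<Rightarrow> (sphere \<Rightarrow> sphere) \<Rightarrow> bool" where
  "rational_map_of_degree d f \<longleftrightarrow>
     (\<exists>p q. coprime p q \<and> max (degree p) (degree q) = d \<and> f = rat_map p q)"

text \<open>The local coordinate around the point \<open>b\<close>: this is \<open>z\<close> if \<open>b\<close> is finite and \<open>1 / z\<close>
  if \<open>b = Infty\<close>. \<open>to_chart b\<close> also takes the value \<open>0\<close> at the one point outside the domain of the
  coordinate; as a rational map is continuous, this does not affect the local expression of
  the map near \<open>b\<close>.\<close>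

definition to_chart :: "sphere \<Rightarrow> sphere \<Rightarrow> complex" where
  "to_chart b x =
     (case b of
        Aff _ \<Rightarrow> (case x of Aff z \<Rightarrow> z | Infty \<Rightarrow> 0)
      | Infty \<Rightarrow> (case x of Aff z \<Rightarrow> 1 / z | Infty \<Rightarrow> 0))"

definition from_chart :: "sphere \<Rightarrow> complex \<Rightarrow> sphere" where
  "from_chart b w =
     (case b of
        Aff _ \<Rightarrow> Aff w
      | Infty \<Rightarrow> if w = 0 then Infty else Aff (1 / w))"

definition critical_point :: "(sphere \<Rightarrow> sphere) \<Rightarrow> sphere \<Rightarrow> bool" where
  "critical_point f x \<longleftrightarrow>
     ((to_chart (f x) \<circ> f \<circ> from_chart x) has_field_derivative 0) (at (to_chart x x))"

definition critically_fixed :: "(sphere \<Rightarrow> sphere) \<Rightarrow> bool" where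
  "critically_fixed f \<longleftrightarrow> (\<forall>x. critical_point f x \<longrightarrow> f x = x)"

definition moebius :: "(sphere \<Rightarrow> sphere) \<Rightarrow> bool" where
  "moebius \<phi> \<longleftrightarrow>
     (\<exists>a b c d. a * d - b * c \<noteq> 0 \<and> \<phi> = rat_map [:b, a:] [:d, c:])"

lemma moebius_bij: "bij \<phi>" if "moebius \<phi>"
proof -
  from that obtain a b c d where nz: "a * d - b * c \<noteq> 0"
    and \<phi>: "\<phi> = rat_map [:b, a:] [:d, c:]"
    unfolding moebius_def by blast
  define \<psi> where "\<psi> = rat_map [:- b, d:] [:a, - c:]"
  have inf: "rat_map [:s, r:] [:u, t:] Infty = (if t = 0 then Infty else Aff (r / t))"
    if "r * u - s * t \<noteq> 0" for r s t u
    using that by (cases "r = 0"; cases "t = 0") (auto simp: rat_map_def max_def)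
  have left: "rat_map [:- s, u:] [:r, - t:] (rat_map [:s, r:] [:u, t:] x) = x"
    if "r * u - s * t \<noteq> 0" for r s t u x
  proof -
    have det: "u * r - (- s) * (- t) \<noteq> 0"
      using that by (simp add: algebra_simps)
    show ?thesis
    proof (cases x)
      case Infty
      show ?thesis
      proof (cases "t = 0")
        case True
        with Infty show ?thesis using inf[OF that] inf[OF det] by simp
      next
        case False
        with Infty show ?thesis using inf[OF that] by (simp add: rat_map_def)
      qed
    next
      case (Aff z)
      show ?thesis
      proof (cases "u + z * t = 0")
        case True
        then have "t \<noteq> 0"
          using that by auto
        moreover have "u = - (z * t)"
          using True by (simp add: eq_neg_iff_add_eq_0)
        ultimately have "u / (- t) = z"
          by (simp add: field_simps)
        moreover have "rat_map [:s, r:] [:u, t:] x = Infty"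
          using Aff True by (simp add: rat_map_def)
        ultimately show ?thesis
          using Aff inf[OF det] \<open>t \<noteq> 0\<close> by simp
      next
        case False
        let ?v = "(s + z * r) / (u + z * t)"
        have den: "r + ?v * (- t) = (r * u - s * t) / (u + z * t)"
          using False by (simp add: field_simps)
        have num: "- s + ?v * u = z * (r * u - s * t) / (u + z * t)"
          using False by (simp add: field_simps)
        have nz: "r + ?v * (- t) \<noteq> 0"
          using den that False by simp
        have "(- s + ?v * u) / (r + ?v * (- t)) = z"
          unfolding den num using that False by simp
        moreover have "rat_map [:s, r:] [:u, t:] x = Aff ?v"
          using Aff False by (simp add: rat_map_def)
        ultimately show ?thesis
          using Aff nz by (simp add: rat_map_def)
      qed
    qed
  qed
  have "\<psi> (\<phi> x) = x" for x
    unfolding \<phi> \<psi>_def by (rule left[OF nz])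
  moreover have "\<phi> (\<psi> x) = x" for x
    using left[of d a "- b" "- c" x] nz unfolding \<phi> \<psi>_def by (simp add: algebra_simps)
  ultimately show ?thesis
    by (metis bijI')
qed

definition moebius_conjugate :: "(sphere \<Rightarrow> sphere) \<Rightarrow> (sphere \<Rightarrow> sphere) \<Rightarrow> bool" where
  "moebius_conjugate f g \<longleftrightarrow> (\<exists>\<phi>. moebius \<phi> \<and> g = \<phi> \<circ> f \<circ> inv \<phi>)"

abbreviation Z :: "complex poly" where
  "Z \<equiv> [:0, 1:]"

definition "f1 = rat_map (Z ^ 5) 1"

definition "f2 = rat_map (Z ^ 2 * (10 + 10 * Z + 5 * Z ^ 2 + Z ^ 3)) (1 + 5 * Z)"

definition "f3 = rat_map (Z ^ 3 * (10 + 5 * Z + Z ^ 2)) (1 + 5 * Z + 10 * Z ^ 2)"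

definition "f4 = rat_map (- (Z ^ 4 * (5 - 3 * Z))) (3 - 5 * Z)"

definition "f5 = rat_map (Z ^ 3 * (5 - 3 * Z ^ 2)) 2"

definition "f6 = rat_map (Z ^ 3 * (220 - 165 * Z + 36 * Z ^ 2)) 121"

definition "f7 =
  (let s = complex_of_real (sqrt 5)
   in rat_map (- (Z ^ 4 * ([:5 - s:] - 2 * Z)))
        ([:7 - 3 * s:] - [:2 * (5 - 2 * s):] * Z))"

definition "f8 =
  (let s = complex_of_real (sqrt 21)
   in rat_map (- (Z ^ 4 * ([:5 * (3 - s):] + 6 * Z)))
        ([:3 * (23 - 5 * s):] - [:10 * (9 - 2 * s):] * Z))"

definition "f9 =
  (let a = complex_of_real (sqrt (5 * (4 * sqrt 61 - 31)))
   in rat_map (Z ^ 3 * ([:2 * (5 + a):] - [:15 + a:] * Z + 6 * Z ^ 2))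
        ([:1 - a:] + [:2 * a:] * Z))"

definition "f10 =
  (let b = complex_of_real (sqrt (5 * (4 * sqrt 61 + 31)))
   in rat_map (Z ^ 3 * ([:2 * (5 + \<i> * b):] - [:15 + \<i> * b:] * Z + 6 * Z ^ 2))
        ([:1 - \<i> * b:] + [:2 * \<i> * b:] * Z))"

definition "f11 = rat_map (- (Z ^ 3 * (5 - Z ^ 2))) (1 - 5 * Z ^ 2)"

definition "f12 = rat_map (- (Z ^ 3 * (20 - 5 * Z - Z ^ 2))) (1 + 5 * Z - 20 * Z ^ 2)"

definition "f13 = rat_map (Z ^ 2 * (5 - 10 * Z + 10 * Z ^ 2 - 4 * Z ^ 3)) 1"

lemma rho_unique: "\<exists>!\<rho>::real. 8 * \<rho> ^ 3 - 52 * \<rho> ^ 2 + 134 * \<rho> - 15 = 0"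
proof -
  let ?g = "\<lambda>x::real. 8 * x ^ 3 - 52 * x ^ 2 + 134 * x - 15"
  have "\<exists>x\<ge>0. x \<le> 1 \<and> ?g x = 0"
    by (rule IVT) (auto intro!: continuous_intros)
  moreover have "x = y" if "?g x = 0" "?g y = 0" for x y
  proof (rule ccontr)
    assume "x \<noteq> y"
    have "?g x - ?g y = (x - y) * (8 * (x ^ 2 + x * y + y ^ 2) - 52 * (x + y) + 134)"
      by (simp add: algebra_simps power2_eq_square power3_eq_cube)
    then have "8 * (x ^ 2 + x * y + y ^ 2) - 52 * (x + y) + 134 = 0"
      using that \<open>x \<noteq> y\<close> by simp
    moreover have "8 * (x ^ 2 + x * y + y ^ 2) - 52 * (x + y) + 134
        = 2 * (x - y) ^ 2 + 6 * (x + y - 13 / 3) ^ 2 + 64 / 3"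
      by (simp add: field_simps power2_eq_square)
    moreover have "(x - y) ^ 2 \<ge> 0" "(x + y - 13 / 3) ^ 2 \<ge> 0"
      by simp_all
    ultimately show False
      by linarith
  qed
  ultimately show ?thesis
    by blast
qed

definition rho :: real where
  "rho = (THE \<rho>. 8 * \<rho> ^ 3 - 52 * \<rho> ^ 2 + 134 * \<rho> - 15 = 0)"

definition sigma :: complex where
  "sigma = complex_of_real rho + \<i> * complex_of_real (sqrt (1/6 - 4/3 * rho - 1/3 * rho ^ 2))"

definition "f14 =
  (let \<sigma> = sigma;
       u = (\<sigma> ^ 2 - 3 * \<sigma> + 1) * (\<sigma> ^ 2 + 5 * \<sigma> + 1);
       v = - 2 * (\<sigma> + 1) * (\<sigma> ^ 2 - 5 * \<sigma> + 1);
       w = \<sigma> ^ 2 - 7 * \<sigma> + 1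
   in rat_map (- (Z ^ 3 * ([:u:] + [:v:] * Z + [:w:] * Z ^ 2)))
        ([:\<sigma>:] * ([:2 * \<sigma> * (\<sigma> ^ 2 - \<sigma> + 1):]
                  - [:(\<sigma> + 1) * (3 * \<sigma> ^ 2 - 5 * \<sigma> + 3):] * Z)))"

definition quintic_maps :: "(sphere \<Rightarrow> sphere) list" where
  "quintic_maps = [f1, f2, f3, f4, f5, f6, f7, f8, f9, f10, f11, f12, f13, f14]"

end

theory Submission
  imports Defs "HOL-Computational_Algebra.Fundamental_Theorem_Algebra"
begin

text \<open>The critical points of \<open>p / q\<close> are the zeros of the Wronskian \<open>p' q - p q'\<close>. After moving a
  critical point of maximal multiplicity to infinity, the multiplicities of the others and the
  degree of \<open>q\<close> leave few possibilities, because all critical points are zeros of \<open>p - z q\<close> and at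
  most four of them are finite. With up to three finite critical points, two are moved to \<open>0\<close> and
  \<open>1\<close>. With four, \<open>p - z q\<close> has a single further zero, which is moved to \<open>0\<close>; the map is then
  determined by the monic quartic vanishing at the critical points. In each case the remaining
  equations are solved by hand.

  Conversely, the cardinalities of the fibres over the fixed points distinguish the maps except
  for the pairs \<open>f5, f6\<close>, \<open>f7, f8\<close> and \<open>f9, f10\<close>. For these pairs the fibres restrict a conjugation
  to a few explicit Moebius maps, which are excluded directly.\<close>

section \<open>Wronskians and critical points\<close>

text \<open>After the reduction let d be the degree of q. Infinity has multiplicity 4 - d, the
  Wronskian has degree 4 + d, none of its zeros has order above 4 - d, and it has at most four
  zeros. Hence d \<le> 2, and the multiplicities of the finite critical points are 4, 3+1, 2+2,
  2+1+1 or 1+1+1+1 for d = 0; 3+2, 3+1+1, 2+2+1 or 2+1+1+1 for d = 1; 2+2+2 or 2+2+1+1 for d = 2. Of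
  these eleven patterns, 2+1+1, 3+1+1 and 2+2+1 are realised by two classes each and the others by
  one, which gives fourteen. The three exceptional patterns are the pairs that fibre cardinalities
  cannot separate.\<close>

definition wronskian :: "'a::idom poly \<Rightarrow> 'a poly \<Rightarrow> 'a poly" where
  "wronskian p q = pderiv p * q - p * pderiv q"

lemma coprime_if_no_common_root:
  fixes p q :: "complex poly"
  assumes "p \<noteq> 0" "\<And>z. poly p z = 0 \<Longrightarrow> poly q z \<noteq> 0"
  shows "coprime p q"
proof (rule coprimeI)
  fix d assume d: "d dvd p" "d dvd q"
  with assms(1) have "d \<noteq> 0" by auto
  have "poly d z \<noteq> 0" for z
    using d assms(2)[of z] by (auto elim!: dvdE)
  then have "constant (poly d)"
    using fundamental_theorem_of_algebra[of d] by blast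
  then have "degree d = 0" by (simp add: constant_degree)
  with \<open>d \<noteq> 0\<close> show "is_unit d" by (simp add: is_unit_iff_degree)
qed

lemma critical_point_Aff:
  assumes "coprime p q"
  shows "critical_point (rat_map p q) (Aff z) \<longleftrightarrow> poly (wronskian p q) z = 0"
proof (cases "poly q z = 0")
  case False
  \<comment> \<open>The equality of functions holds at every point, poles included:
    \<open>to_chart\<close> sends \<open>Infty\<close> to 0, which is also the value of a division
    by zero. The chart 1/z below relies on the same agreement of default values.\<close>
  have "to_chart (rat_map p q (Aff z)) \<circ> rat_map p q \<circ> from_chart (Aff z)
      = (\<lambda>w. poly p w / poly q w)"
    using False by (auto simp: fun_eq_iff rat_map_def to_chart_def from_chart_def)
  moreover have D: "((\<lambda>w. poly p w / poly q w) has_field_derivative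
      poly (wronskian p q) z / (poly q z) ^ 2) (at z)"
    using False by (auto intro!: derivative_eq_intros simp: wronskian_def power2_eq_square)
  ultimately show ?thesis
    using False DERIV_unique[OF D, of 0] D
    by (auto simp: critical_point_def to_chart_def)
next
  case True
  with coprime_poly_0[OF assms, of z] have nz: "poly p z \<noteq> 0" by auto
  have "to_chart (rat_map p q (Aff z)) \<circ> rat_map p q \<circ> from_chart (Aff z)
      = (\<lambda>w. poly q w / poly p w)"
    using True by (auto simp: fun_eq_iff rat_map_def to_chart_def from_chart_def)
  moreover have D: "((\<lambda>w. poly q w / poly p w) has_field_derivative
      - poly (wronskian p q) z / (poly p z) ^ 2) (at z)"
    using nz by (auto intro!: derivative_eq_intros simp: wronskian_def power2_eq_square)
  ultimately show ?thesis
    using nz DERIV_unique[OF D, of 0] D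
    by (auto simp: critical_point_def to_chart_def)
qed

text \<open>The coordinate change \<open>z \<mapsto> 1 / z\<close> on forms of degree \<open>n\<close>.\<close>

definition flip :: "nat \<Rightarrow> 'a::comm_semiring_1 poly \<Rightarrow> 'a poly" where
  "flip n p = (\<Sum>i\<le>n. monom (coeff p (n - i)) i)"

lemma coeff_flip: "coeff (flip n p) i = (if i \<le> n then coeff p (n - i) else 0)"
proof -
  have "coeff (flip n p) i = (\<Sum>j\<le>n. if j = i then coeff p (n - j) else 0)"
    by (simp add: flip_def coeff_sum)
  then show ?thesis by simp
qed

lemma degree_flip: "degree (flip n p) \<le> n"
  by (rule degree_le) (simp add: coeff_flip)

lemma poly_flip_0: "poly (flip n p) 0 = coeff p n"
  by (simp add: poly_0_coeff_0 coeff_flip)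

lemma poly_altdef_le: "degree p \<le> n \<Longrightarrow> poly p x = (\<Sum>i\<le>n. coeff p i * x ^ i)"
  for p :: "'a::comm_semiring_1 poly"
  unfolding poly_altdef by (rule sum.mono_neutral_left) (auto simp: coeff_eq_0)

lemma poly_flip:
  fixes p :: "'a::field poly"
  assumes "degree p \<le> n" "w \<noteq> 0"
  shows "poly (flip n p) w = w ^ n * poly p (1 / w)"
proof -
  have "poly (flip n p) w = (\<Sum>i\<le>n. coeff p (n - i) * w ^ i)"
    by (simp add: flip_def poly_sum poly_monom)
  also have "\<dots> = (\<Sum>i\<le>n. coeff p i * w ^ (n - i))"
    by (rule sum.reindex_bij_witness[of _ "\<lambda>i. n - i" "\<lambda>i. n - i"]) auto
  also have "\<dots> = (\<Sum>i\<le>n. w ^ n * (coeff p i * (1 / w) ^ i))"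
    using assms by (intro sum.cong) (auto simp: power_diff field_simps)
  also have "\<dots> = w ^ n * poly p (1 / w)"
    using assms by (simp add: poly_altdef_le sum_distrib_left)
  finally show ?thesis .
qed

lemma poly_pderiv_flip:
  fixes p :: "complex poly"
  assumes "degree p \<le> n" "w \<noteq> 0" "2 \<le> n"
  shows "poly (pderiv (flip n p)) w
    = of_nat n * w ^ (n - 1) * poly p (1 / w) - w ^ (n - 2) * poly (pderiv p) (1 / w)"
proof (rule DERIV_unique)
  show "(poly (flip n p) has_field_derivative poly (pderiv (flip n p)) w) (at w)"
    by (rule poly_DERIV)
  have "((\<lambda>w. w ^ n * poly p (1 / w)) has_field_derivative
      of_nat n * w ^ (n - 1) * poly p (1 / w) - w ^ (n - 2) * poly (pderiv p) (1 / w)) (at w)"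
    using assms by (auto intro!: derivative_eq_intros simp: field_simps power_diff power2_eq_square)
  then show "(poly (flip n p) has_field_derivative
      of_nat n * w ^ (n - 1) * poly p (1 / w) - w ^ (n - 2) * poly (pderiv p) (1 / w)) (at w)"
    by (rule has_field_derivative_transform_within_open[of _ _ _ "- {0}"])
       (use assms in \<open>auto simp: poly_flip\<close>)
qed

text \<open>The terms with the factor n cancel between the two products. What remains says that the
  Wronskian of two forms of degree n is a form of degree 2n - 2; the sign comes from the derivative
  of 1/w.\<close>

lemma poly_wronskian_flip:
  fixes p q :: "complex poly"
  assumes "degree p \<le> n" "degree q \<le> n" "w \<noteq> 0" "2 \<le> n"
  shows "poly (wronskian (flip n p) (flip n q)) w
    = - (w ^ (2 * n - 2) * poly (wronskian p q) (1 / w))"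
proof -
  obtain m where n: "n = m + 2" using assms(4) by (metis le_add_diff_inverse2)
  have e: "w ^ (n - 1) = w ^ m * w" "w ^ n = w ^ m * w * w" "n - 2 = m"
    "w ^ (2 * n - 2) = w ^ m * w ^ m * w * w"
    by (simp_all add: n power_add mult_2 power2_eq_square)
  show ?thesis
    unfolding wronskian_def poly_diff poly_mult poly_flip[OF assms(1,3)] poly_flip[OF assms(2,3)]
      poly_pderiv_flip[OF assms(1,3,4)] poly_pderiv_flip[OF assms(2,3,4)] e
    by algebra
qed

lemma poly_wronskian_flip_0:
  assumes "0 < n"
  shows "poly (wronskian (flip n p) (flip n q)) 0
    = coeff p (n - 1) * coeff q n - coeff p n * coeff q (n - 1)"
  using assms by (simp add: wronskian_def poly_0_coeff_0 coeff_pderiv coeff_flip coeff_mult)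

lemma coeff_max_degree_nonzero:
  assumes "max (degree p) (degree q) = n" "p \<noteq> 0 \<or> q \<noteq> 0"
  shows "coeff p n \<noteq> 0 \<or> coeff q n \<noteq> 0"
proof -
  have "p \<noteq> 0 \<and> degree p = n \<or> q \<noteq> 0 \<and> degree q = n"
    using assms by (cases "p = 0"; cases "q = 0") (auto simp: max_def)
  then show ?thesis by auto
qed

lemma coprime_flip:
  fixes p q :: "complex poly"
  assumes "coprime p q" "max (degree p) (degree q) = n" "0 < n"
  shows "coprime (flip n p) (flip n q)"
proof -
  have dp: "degree p \<le> n" "degree q \<le> n" using assms by auto
  have top: "coeff p n \<noteq> 0 \<or> coeff q n \<noteq> 0"
    using coeff_max_degree_nonzero[OF assms(2)] coprime_poly_0[OF assms(1), of 0] by fastforce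
  have nr: "poly (flip n p) z = 0 \<Longrightarrow> poly (flip n q) z \<noteq> 0" for z
    using top coprime_poly_0[OF assms(1), of "1 / z"] dp
    by (cases "z = 0") (auto simp: poly_flip_0 poly_flip)
  show ?thesis
  proof (cases "flip n p = 0")
    case False
    then show ?thesis using nr coprime_if_no_common_root by blast
  next
    case True
    then have "coprime (flip n q) (flip n p)"
      using nr by (intro coprime_if_no_common_root) auto
    then show ?thesis by (simp add: coprime_commute)
  qed
qed

text \<open>Flipping numerator and denominator together inverts only the source coordinate and
  leaves the values alone, so the criterion at the finite point 0 applies to the flipped
  pair.\<close>

lemma critical_point_Infty:
  assumes "coprime p q" "max (degree p) (degree q) = n" "0 < n"
  shows "critical_point (rat_map p q) Infty \<longleftrightarrow>
    coeff p (n - 1) * coeff q n = coeff p n * coeff q (n - 1)"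
proof -
  have dp: "degree p \<le> n" "degree q \<le> n" using assms by auto
  have 1: "rat_map p q (from_chart Infty w) = rat_map (flip n p) (flip n q) (from_chart (Aff 0) w)" for w
    using assms dp by (auto simp: rat_map_def from_chart_def Let_def poly_flip_0 poly_flip)
  have 2: "rat_map p q Infty = rat_map (flip n p) (flip n q) (Aff 0)"
    using 1[of 0] by (simp add: from_chart_def)
  have "critical_point (rat_map p q) Infty \<longleftrightarrow> critical_point (rat_map (flip n p) (flip n q)) (Aff 0)"
    unfolding critical_point_def 2 comp_def 1 by (simp add: to_chart_def)
  also have "\<dots> \<longleftrightarrow> coeff p (n - 1) * coeff q n = coeff p n * coeff q (n - 1)"
    using critical_point_Aff[OF coprime_flip[OF assms]] poly_wronskian_flip_0[of n p q] assms(3) by simp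
  finally show ?thesis .
qed

text \<open>The condition \<open>degree q < n\<close> says that \<open>Infty\<close> is fixed, so that only finite critical
  points have to be considered.\<close>

definition cf_pair :: "nat \<Rightarrow> complex poly \<Rightarrow> complex poly \<Rightarrow> bool" where
  "cf_pair n p q \<longleftrightarrow> coprime p q \<and> degree p = n \<and> degree q < n \<and>
     (\<forall>z. poly (wronskian p q) z = 0 \<longrightarrow> poly p z = z * poly q z)"

lemma rat_map_Infty: "degree q < degree p \<Longrightarrow> rat_map p q Infty = Infty"
  by (simp add: rat_map_def coeff_eq_0)

lemma rat_map_Aff_eq_Infty: "rat_map p q (Aff z) = Infty \<longleftrightarrow> poly q z = 0"
  by (simp add: rat_map_def)

lemma rat_map_Aff_eq_Aff:
  assumes "coprime p q"
  shows "rat_map p q (Aff z) = Aff w \<longleftrightarrow> poly p z = w * poly q z"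
  using coprime_poly_0[OF assms, of z] by (auto simp: rat_map_def field_simps)

lemma cf_pairD:
  assumes "cf_pair n p q"
  shows "rational_map_of_degree n (rat_map p q)" "critically_fixed (rat_map p q)"
proof -
  show "rational_map_of_degree n (rat_map p q)"
    using assms unfolding rational_map_of_degree_def cf_pair_def by (intro exI[of _ p] exI[of _ q]) auto
  show "critically_fixed (rat_map p q)"
    unfolding critically_fixed_def
  proof (intro allI impI)
    fix x assume "critical_point (rat_map p q) x"
    then show "rat_map p q x = x"
      using assms by (cases x) (auto simp: cf_pair_def critical_point_Aff rat_map_Infty rat_map_Aff_eq_Aff)
  qed
qed

lemma cf_pair_nonzero:
  assumes "cf_pair n p q"
  shows "q \<noteq> 0"
proof
  assume "q = 0"
  then have "is_unit p" "degree p = n" "0 < n" using assms by (auto simp: cf_pair_def)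
  then show False by (metis degree_0 is_unit_iff_degree less_irrefl not_is_unit_0)
qed

section \<open>Moebius conjugation\<close>

text \<open>The point (x : y) in homogeneous coordinates, with \<open>hom\<close> below evaluating
  forms of degree n. In these coordinates composing with a Moebius map is matrix multiplication, and
  poles need no case distinction.\<close>

definition proj :: "complex \<Rightarrow> complex \<Rightarrow> sphere" where
  "proj x y = (if y = 0 then Infty else Aff (x / y))"

definition hom :: "nat \<Rightarrow> complex poly \<Rightarrow> complex \<Rightarrow> complex \<Rightarrow> complex" where
  "hom n p x y = (\<Sum>i\<le>n. coeff p i * x ^ i * y ^ (n - i))"

lemma proj_cases:
  obtains x y where "s = proj x y" "x \<noteq> 0 \<or> y \<noteq> 0"
proof (cases s)
  case (Aff z)
  then show ?thesis using that[of z 1] by (simp add: proj_def)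
next
  case Infty
  then show ?thesis using that[of 1 0] by (simp add: proj_def)
qed

lemma proj_scale: "c \<noteq> 0 \<Longrightarrow> proj (c * x) (c * y) = proj x y"
  by (simp add: proj_def)

lemma hom_y_nonzero:
  assumes "degree p \<le> n" "y \<noteq> 0"
  shows "hom n p x y = y ^ n * poly p (x / y)"
  using assms by (simp add: hom_def poly_altdef_le sum_distrib_left power_diff field_simps)

lemma hom_y_0: "hom n p x 0 = coeff p n * x ^ n"
proof -
  have "hom n p x 0 = (\<Sum>i\<le>n. if i = n then coeff p n * x ^ n else 0)"
    unfolding hom_def by (rule sum.cong) auto
  then show ?thesis by simp
qed

lemma hom_nonzero:
  assumes "coprime p q" "max (degree p) (degree q) = n" "x \<noteq> 0 \<or> y \<noteq> 0"
  shows "hom n p x y \<noteq> 0 \<or> hom n q x y \<noteq> 0"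
proof -
  have "degree p \<le> n" "degree q \<le> n" using assms(2) by auto
  moreover have "coeff p n \<noteq> 0 \<or> coeff q n \<noteq> 0"
    using coeff_max_degree_nonzero[OF assms(2)] coprime_poly_0[OF assms(1), of 0] by fastforce
  ultimately show ?thesis
    using assms(3) coprime_poly_0[OF assms(1), of "x / y"]
    by (cases "y = 0") (auto simp: hom_y_0 hom_y_nonzero)
qed

lemma rat_map_proj:
  assumes "max (degree p) (degree q) = n" "x \<noteq> 0 \<or> y \<noteq> 0"
  shows "rat_map p q (proj x y) = proj (hom n p x y) (hom n q x y)"
proof -
  have "degree p \<le> n" "degree q \<le> n" using assms(1) by auto
  then show ?thesis
    using assms by (cases "y = 0") (auto simp: proj_def rat_map_def Let_def hom_y_0 hom_y_nonzero)
qed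

lemma rat_map_linear_proj:
  assumes "a * d - b * c \<noteq> 0" "x \<noteq> 0 \<or> y \<noteq> 0"
  shows "rat_map [:b, a:] [:d, c:] (proj x y) = proj (a * x + b * y) (c * x + d * y)"
proof -
  have "max (degree [:b, a:]) (degree [:d, c:]) = 1"
    using assms(1) by (auto simp: max_def)
  from rat_map_proj[OF this assms(2)] show ?thesis
    by (simp add: hom_def algebra_simps)
qed

lemma linear_nonzero:
  fixes a b c d x y :: complex
  assumes "a * d - b * c \<noteq> 0" "x \<noteq> 0 \<or> y \<noteq> 0"
  shows "a * x + b * y \<noteq> 0 \<or> c * x + d * y \<noteq> 0"
proof (rule ccontr)
  assume "\<not> ?thesis"
  then have "(a * d - b * c) * x = 0" "(a * d - b * c) * y = 0"
    by simp_all algebra+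
  with assms show False by simp
qed

lemma moebius_comp:
  assumes "moebius \<phi>" "moebius \<psi>"
  shows "moebius (\<phi> \<circ> \<psi>)"
proof -
  from assms obtain a b c d a' b' c' d' where
    1: "a * d - b * c \<noteq> 0" "\<phi> = rat_map [:b, a:] [:d, c:]" and
    2: "a' * d' - b' * c' \<noteq> 0" "\<psi> = rat_map [:b', a':] [:d', c':]"
    unfolding moebius_def by blast
  let ?a = "a * a' + b * c'" and ?b = "a * b' + b * d'"
    and ?c = "c * a' + d * c'" and ?d = "c * b' + d * d'"
  have "?a * ?d - ?b * ?c = (a * d - b * c) * (a' * d' - b' * c')"
    by algebra
  with 1 2 have nz: "?a * ?d - ?b * ?c \<noteq> 0" by simp
  have "(\<phi> \<circ> \<psi>) s = rat_map [:?b, ?a:] [:?d, ?c:] s" for s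
  proof -
    obtain x y where s: "s = proj x y" "x \<noteq> 0 \<or> y \<noteq> 0" by (rule proj_cases)
    show ?thesis
      unfolding o_def 1 2 s rat_map_linear_proj[OF 2(1) s(2)] rat_map_linear_proj[OF nz s(2)]
        rat_map_linear_proj[OF 1(1) linear_nonzero[OF 2(1) s(2)]]
      by (simp add: algebra_simps)
  qed
  with nz show ?thesis unfolding moebius_def by blast
qed

lemma moebius_inv:
  assumes "moebius \<phi>"
  shows "moebius (inv \<phi>)"
proof -
  from assms obtain a b c d where
    1: "a * d - b * c \<noteq> 0" "\<phi> = rat_map [:b, a:] [:d, c:]"
    unfolding moebius_def by blast
  let ?\<psi> = "rat_map [:- b, d:] [:a, - c:]"
  have nz: "d * a - (- b) * (- c) \<noteq> 0" using 1 by (simp add: algebra_simps)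
  have "\<phi> (?\<psi> s) = s" for s
  proof -
    obtain x y where s: "s = proj x y" "x \<noteq> 0 \<or> y \<noteq> 0" by (rule proj_cases)
    have "\<phi> (?\<psi> s) = proj ((a * d - b * c) * x) ((a * d - b * c) * y)"
      unfolding o_def 1 s rat_map_linear_proj[OF nz s(2)]
        rat_map_linear_proj[OF 1(1) linear_nonzero[OF nz s(2)]]
      by (simp add: algebra_simps)
    with 1 s show ?thesis by (simp add: proj_scale)
  qed
  then have "?\<psi> = inv \<phi>"
    using moebius_bij[OF assms] by (metis bij_inv_eq_iff ext)
  with nz show ?thesis unfolding moebius_def by metis
qed

lemma moebius_conjugateI:
  assumes "moebius \<phi>" "\<And>s. \<phi> (f s) = g (\<phi> s)"
  shows "moebius_conjugate f g"
  unfolding moebius_conjugate_def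
proof (intro exI[of _ \<phi>] conjI ext)
  fix s
  have "\<phi> (inv \<phi> s) = s"
    using moebius_bij[OF assms(1)] by (simp add: bij_is_surj surj_f_inv_f)
  with assms(2)[of "inv \<phi> s"] show "g s = (\<phi> \<circ> f \<circ> inv \<phi>) s" by simp
qed (rule assms)

lemma moebius_conjugateE:
  assumes "moebius_conjugate f g"
  obtains \<phi> where "moebius \<phi>" "bij \<phi>" "\<And>s. \<phi> (f s) = g (\<phi> s)"
proof -
  from assms obtain \<phi> where \<phi>: "moebius \<phi>" "g = \<phi> \<circ> f \<circ> inv \<phi>"
    unfolding moebius_conjugate_def by blast
  moreover note b = moebius_bij[OF \<phi>(1)]
  moreover have "\<phi> (f s) = g (\<phi> s)" for s
    using \<phi>(2) b by (simp add: bij_is_inj)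
  ultimately show ?thesis using that by blast
qed

lemma moebius_conjugate_refl: "moebius_conjugate f f"
proof (rule moebius_conjugateI)
  show "moebius (rat_map [:0, 1:] [:1, 0:])"
    unfolding moebius_def by (intro exI[of _ 1] exI[of _ 0]) simp
  have "rat_map [:0, 1:] [:1, 0:] s = s" for s
    by (cases s) (simp_all add: rat_map_def)
  then show "rat_map [:0, 1:] [:1, 0:] (f s) = f (rat_map [:0, 1:] [:1, 0:] s)" for s by simp
qed

lemma moebius_conjugate_sym:
  assumes "moebius_conjugate f g"
  shows "moebius_conjugate g f"
proof -
  from assms obtain \<phi> where \<phi>: "moebius \<phi>" "bij \<phi>" "\<And>s. \<phi> (f s) = g (\<phi> s)"
    by (rule moebius_conjugateE) blast
  have "inv \<phi> (g s) = f (inv \<phi> s)" for s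
    by (metis \<phi>(2,3) bij_inv_eq_iff)
  with moebius_inv[OF \<phi>(1)] show ?thesis by (rule moebius_conjugateI)
qed

lemma moebius_conjugate_trans:
  assumes "moebius_conjugate f g" "moebius_conjugate g h"
  shows "moebius_conjugate f h"
proof -
  from assms(1) obtain \<phi> where \<phi>: "moebius \<phi>" "\<And>s. \<phi> (f s) = g (\<phi> s)"
    by (rule moebius_conjugateE) blast
  from assms(2) obtain \<psi> where \<psi>: "moebius \<psi>" "\<And>s. \<psi> (g s) = h (\<psi> s)"
    by (rule moebius_conjugateE) blast
  show ?thesis
    by (rule moebius_conjugateI[OF moebius_comp[OF \<psi>(1) \<phi>(1)]]) (simp add: \<phi> \<psi>)
qed

text \<open>Lifts to homogeneous coordinates that differ by a scalar induce the same map of the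
  sphere. The last two hypotheses say that the matrix intertwines the lifts up to
  \<open>\<mu>\<close>; for explicit coefficients this is a comparison of polynomials in x and
  y.\<close>

lemma moebius_conjugate_hom:
  assumes "coprime p q" "max (degree p) (degree q) = n" "max (degree P) (degree Q) = n"
    and "a * d - b * c \<noteq> 0" "\<mu> \<noteq> 0"
    and P: "\<And>x y. hom n P (a * x + b * y) (c * x + d * y) = \<mu> * (a * hom n p x y + b * hom n q x y)"
    and Q: "\<And>x y. hom n Q (a * x + b * y) (c * x + d * y) = \<mu> * (c * hom n p x y + d * hom n q x y)"
  shows "moebius_conjugate (rat_map p q) (rat_map P Q)"
proof (rule moebius_conjugateI)
  show "moebius (rat_map [:b, a:] [:d, c:])"
    using assms(4) unfolding moebius_def by blast
  fix s
  obtain x y where s: "s = proj x y" "x \<noteq> 0 \<or> y \<noteq> 0" by (rule proj_cases)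
  show "rat_map [:b, a:] [:d, c:] (rat_map p q s) = rat_map P Q (rat_map [:b, a:] [:d, c:] s)"
    unfolding s rat_map_proj[OF assms(2) s(2)] rat_map_linear_proj[OF assms(4) s(2)]
      rat_map_linear_proj[OF assms(4) hom_nonzero[OF assms(1,2) s(2)]]
      rat_map_proj[OF assms(3) linear_nonzero[OF assms(4) s(2)]] P Q
    using assms(5) by (simp add: proj_scale)
qed

lemma pderiv_pcompose_linear: "pderiv (pcompose p [:B, A:]) = smult A (pcompose (pderiv p) [:B, A:])"
  by (simp add: pderiv_pcompose pderiv_pCons)

text \<open>The conjugating map is z \<mapsto> (z - B) / A, and \<open>\<mu>\<close> rescales
  numerator and denominator together. The equation for \<open>P\<close> is multiplied by
  \<open>A\<close> so that it contains no quotients. Affine maps fix infinity, hence the degree of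
  \<open>q\<close> and, up to a scalar, the Wronskian are carried along.\<close>

lemma affine_conjugate:
  assumes "cf_pair n p q" "A \<noteq> 0" "\<mu> \<noteq> 0"
    and P: "smult A P = smult \<mu> (pcompose (p - smult B q) [:B, A:])"
    and Q: "Q = smult \<mu> (pcompose q [:B, A:])"
  shows "moebius_conjugate (rat_map p q) (rat_map P Q)" (is ?conj)
    and "cf_pair n P Q" (is ?cf)
    and "degree Q = degree q" (is ?deg)
    and "wronskian P Q = smult (\<mu> ^ 2) (pcompose (wronskian p q) [:B, A:])" (is ?wr)
proof -
  have P_poly: "poly P w = \<mu> * (poly p (B + w * A) - B * poly q (B + w * A)) / A" for w
    using arg_cong[OF P, of "\<lambda>p. poly p w"] assms(2)
    by (simp add: poly_pcompose field_simps)
  have Q_poly: "poly Q w = \<mu> * poly q (B + w * A)" for w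
    by (simp add: Q poly_pcompose)
  have cop: "coprime p q" and deg: "degree p = n" "degree q < n"
    and fix': "\<And>z. poly (wronskian p q) z = 0 \<Longrightarrow> poly p z = z * poly q z"
    using assms(1) by (auto simp: cf_pair_def)
  show dQ: ?deg using assms by (simp add: Q degree_pcompose)
  have dh: "degree (p - smult B q) = n"
    using deg degree_add_eq_left[of "- smult B q" p] by simp
  have "degree P = degree (smult A P)" using assms(2) by simp
  also have "\<dots> = n" unfolding P using assms(2,3) dh by (simp add: degree_pcompose)
  finally have dP: "degree P = n" .
  have P_deriv: "smult A (pderiv P)
      = smult \<mu> (smult A (pcompose (pderiv (p - smult B q)) [:B, A:]))"
    using arg_cong[OF P, of pderiv] by (simp only: pderiv_smult pderiv_pcompose_linear)
  have "smult A (pderiv P) = smult A (smult \<mu> (pcompose (pderiv (p - smult B q)) [:B, A:]))"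
    unfolding P_deriv by (simp add: mult.commute)
  with assms(2) have P': "pderiv P = smult \<mu> (pcompose (pderiv (p - smult B q)) [:B, A:])"
    by (metis smult_cancel)
  have "poly (wronskian P Q) w = poly (smult (\<mu> ^ 2) (pcompose (wronskian p q) [:B, A:])) w" for w
    unfolding wronskian_def Q poly_diff poly_mult P' pderiv_smult pderiv_pcompose_linear
      poly_smult poly_pcompose P_poly using assms(2)
    by (simp add: pderiv_diff pderiv_smult field_simps power2_eq_square)
  then show wr: ?wr by (metis poly_eq_poly_eq_iff ext)
  have "coprime P Q"
  proof (rule coprime_if_no_common_root)
    show "P \<noteq> 0" using dP deg by auto
    fix z assume "poly P z = 0"
    with assms(2,3) have *: "poly p (B + z * A) = B * poly q (B + z * A)"
      by (simp add: P_poly)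
    with coprime_poly_0[OF cop, of "B + z * A"] show "poly Q z \<noteq> 0"
      using assms(3) by (auto simp: Q_poly)
  qed
  moreover have "poly P z = z * poly Q z" if "poly (wronskian P Q) z = 0" for z
    using that fix'[of "B + z * A"] assms(2,3)
    by (simp add: wr poly_pcompose P_poly Q_poly field_simps)
  ultimately show ?cf
    using dP dQ deg by (simp add: cf_pair_def)
  let ?\<phi> = "rat_map [:- B / A, 1 / A:] [:1, 0:]"
  have "moebius ?\<phi>" using assms(2) unfolding moebius_def
    by (intro exI[of _ "1 / A"] exI[of _ "- B / A"] exI[of _ 0] exI[of _ 1]) simp
  moreover have \<phi>_Aff: "?\<phi> (Aff z) = Aff ((z - B) / A)" for z
    by (simp add: rat_map_def diff_divide_distrib)
  have \<phi>_Infty: "?\<phi> Infty = Infty" using assms(2) by (intro rat_map_Infty) simp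
  have inf: "rat_map p q Infty = Infty" "rat_map P Q Infty = Infty"
    using deg dP dQ by (auto intro: rat_map_Infty)
  have "?\<phi> (rat_map p q s) = rat_map P Q (?\<phi> s)" for s
  proof (cases s)
    case (Aff z)
    have "B + (z - B) / A * A = z" using assms(2) by simp
    then have Q_z: "poly Q ((z - B) / A) = \<mu> * poly q z"
      and P_z: "poly P ((z - B) / A) = \<mu> * (poly p z - B * poly q z) / A"
      by (simp_all only: P_poly Q_poly)
    show ?thesis
    proof (cases "poly q z = 0")
      case True
      then have "rat_map P Q (?\<phi> s) = Infty"
        unfolding Aff \<phi>_Aff rat_map_Aff_eq_Infty Q_z by simp
      moreover have "rat_map p q s = Infty" using True by (simp add: Aff rat_map_def)
      ultimately show ?thesis by (simp only: \<phi>_Infty)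
    next
      case False
      have "rat_map p q s = Aff (poly p z / poly q z)"
        using False by (simp add: Aff rat_map_def)
      moreover have "rat_map P Q (?\<phi> s) = Aff ((poly p z / poly q z - B) / A)"
        unfolding Aff \<phi>_Aff rat_map_Aff_eq_Aff[OF \<open>coprime P Q\<close>] P_z Q_z
        using False assms(2,3) by (simp add: field_simps)
      ultimately show ?thesis by (simp only: \<phi>_Aff)
    qed
  qed (simp only: inf \<phi>_Infty)
  ultimately show ?conj by (intro moebius_conjugateI)
qed

section \<open>Moving a critical point of maximal multiplicity to infinity\<close>

lemma wronskian_shift: "wronskian (p - smult c q) q = wronskian p q"
  by (simp add: wronskian_def pderiv_diff pderiv_smult algebra_simps)

text \<open>The multiplicity of a critical point is one less than its local degree: with h = p - c q
  the Wronskian is h' q - h q', whose first term vanishes at z to order one less than h does, and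
  whose second term vanishes at least to the order of h.\<close>

lemma order_wronskian:
  fixes p q :: "complex poly"
  assumes "poly p z = c * poly q z" "poly q z \<noteq> 0" "p - smult c q \<noteq> 0"
  shows "order z (p - smult c q) = Suc (order z (wronskian p q))"
proof -
  define h where "h = p - smult c q"
  have hz: "poly h z = 0" and h: "h \<noteq> 0" using assms by (auto simp: h_def)
  define k where "k = order z (pderiv h)"
  have oh: "order z h = Suc k" unfolding k_def by (rule order_pderiv[OF h hz])
  have ph: "pderiv h \<noteq> 0"
    using hz h by (auto dest!: pderiv_iszero)
  have dh: "[:-z, 1:] ^ Suc k dvd h" using oh h by (metis order_1)
  have "order z (pderiv h * q - h * pderiv q) = k"
  proof (rule order_unique_lemma)
    have "[:-z, 1:] ^ k dvd pderiv h" unfolding k_def by (rule order_1)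
    moreover have "[:-z, 1:] ^ k dvd h" using dh by (metis dvd_mult_right power_Suc)
    ultimately show "[:-z, 1:] ^ k dvd pderiv h * q - h * pderiv q" by simp
    show "\<not> [:-z, 1:] ^ Suc k dvd pderiv h * q - h * pderiv q"
    proof
      assume "[:-z, 1:] ^ Suc k dvd pderiv h * q - h * pderiv q"
      moreover have "[:-z, 1:] ^ Suc k dvd h * pderiv q" using dh by (rule dvd_mult2)
      ultimately have "[:-z, 1:] ^ Suc k dvd pderiv h * q"
        by (metis diff_add_cancel dvd_add)
      moreover have "pderiv h * q \<noteq> 0" using ph assms(2) by auto
      moreover from this have "order z (pderiv h * q) = k"
        using assms(2) by (simp add: order_mult k_def order_0I)
      ultimately show False by (metis order_divides Suc_n_not_le_n)
    qed
  qed
  then show ?thesis using oh wronskian_shift[of p c q] by (simp add: h_def wronskian_def)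
qed

text \<open>The evident degree bound for a Wronskian is 2n - 1, one more than the sharp bound, so
  reversing in that degree produces an extra factor z. Comparing constant coefficients then shows
  that the coefficient in degree 2n - 1 is zero.\<close>

lemma flip_wronskian:
  fixes p q :: "complex poly"
  assumes "degree p \<le> n" "degree q \<le> n" "2 \<le> n"
  shows "pCons 0 (wronskian (flip n p) (flip n q)) = - flip (2 * n - 1) (wronskian p q)"
    (is "?L = ?R")
proof -
  have dw: "degree (wronskian p q) \<le> 2 * n - 1"
    unfolding wronskian_def using assms degree_pderiv[of p] degree_pderiv[of q]
    by (intro degree_diff_le order_trans[OF degree_mult_le]) auto
  \<comment> \<open>One more factor z makes both sides vanish at 0, where the transformation rule
    for Wronskians does not apply.\<close>
  have "poly (pCons 0 ?L) w = poly (pCons 0 ?R) w" for w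
  proof (cases "w = 0")
    case False
    have "w ^ (2 * n - 1) = w * w ^ (2 * n - 2)"
      using assms(3) by (simp flip: power_Suc add: Suc_diff_Suc numeral_2_eq_2)
    with False show ?thesis
      using poly_wronskian_flip[OF assms(1,2) False assms(3)] poly_flip[OF dw False] by simp
  qed simp
  then have "pCons 0 ?L = pCons 0 ?R" by (metis poly_eq_poly_eq_iff ext)
  then show ?thesis by simp
qed

lemma wronskian_top:
  fixes p q :: "complex poly"
  assumes "degree p \<le> n" "degree q \<le> n" "2 \<le> n"
  shows "degree (wronskian p q) \<le> 2 * n - 2"
    and "coeff (wronskian p q) (2 * n - 2) = coeff p n * coeff q (n - 1) - coeff p (n - 1) * coeff q n"
proof -
  note F = flip_wronskian[OF assms]
  have dw: "degree (wronskian p q) \<le> 2 * n - 1"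
    unfolding wronskian_def using assms degree_pderiv[of p] degree_pderiv[of q]
    by (intro degree_diff_le order_trans[OF degree_mult_le]) auto
  have "coeff (wronskian p q) (2 * n - 1) = 0"
    using arg_cong[OF F, of "\<lambda>p. coeff p 0"] by (simp add: coeff_flip)
  have "degree (wronskian p q) \<noteq> 2 * n - 1"
  proof
    assume d: "degree (wronskian p q) = 2 * n - 1"
    with \<open>coeff (wronskian p q) (2 * n - 1) = 0\<close> have "wronskian p q = 0"
      by (metis leading_coeff_0_iff)
    with d assms(3) show False by simp
  qed
  with dw show "degree (wronskian p q) \<le> 2 * n - 2" by linarith
  have "coeff (wronskian p q) (2 * n - 2) = - poly (wronskian (flip n p) (flip n q)) 0"
    using arg_cong[OF F, of "\<lambda>p. coeff p 1"] assms(3)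
    by (simp add: coeff_flip poly_0_coeff_0 numeral_2_eq_2)
  then show "coeff (wronskian p q) (2 * n - 2)
      = coeff p n * coeff q (n - 1) - coeff p (n - 1) * coeff q n"
    using assms(3) by (simp add: poly_wronskian_flip_0)
qed

lemma coeff_pcompose_shift:
  fixes p :: "'a::idom poly"
  assumes "degree p \<le> n"
  shows "coeff (pcompose p [:c, 1:]) n = coeff p n"
proof (cases "degree p = n")
  case True
  then show ?thesis
    using lead_coeff_comp[of "[:c, 1:]" p] by (simp add: degree_pcompose)
next
  case False
  with assms show ?thesis by (simp add: coeff_eq_0 degree_pcompose)
qed

text \<open>The conjugating map is 1 / (z - c). Translating c to 0 and flipping exchanges the roles
  of numerator and denominator, so a zero of order e of p - c q at c lowers the degree of the new
  denominator to at most n - e. The hypothesis \<open>inf\<close> says that the old point at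
  infinity, which becomes 0, is fixed or not critical.\<close>

lemma move_to_Infty:
  assumes cop: "coprime p q" and deg: "max (degree p) (degree q) = n" and n: "2 \<le> n"
    and fix': "\<And>z. poly (wronskian p q) z = 0 \<Longrightarrow> poly p z = z * poly q z"
    and inf: "coeff q n = 0 \<or> coeff (wronskian p q) (2 * n - 2) \<noteq> 0"
    and c: "poly p c = c * poly q c" and e: "[:- c, 1:] ^ e dvd p - smult c q"
  shows "\<exists>P Q. moebius_conjugate (rat_map p q) (rat_map P Q) \<and> cf_pair n P Q \<and> degree Q \<le> n - e"
proof -
  define p' q' where "p' = pcompose (p - smult c q) [:c, 1:]" and "q' = pcompose q [:c, 1:]"
  define P Q where "P = flip n q'" and "Q = flip n p'"
  have dp: "degree p \<le> n" "degree q \<le> n" using deg by auto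
  have dp': "degree p' \<le> n" "degree q' \<le> n"
    using dp by (auto simp: p'_def q'_def degree_pcompose intro!: degree_diff_le)
  have p'_poly: "poly p' w = poly p (w + c) - c * poly q (w + c)"
    and q'_poly: "poly q' w = poly q (w + c)" for w
    by (simp_all add: p'_def q'_def poly_pcompose add.commute)
  have wr': "wronskian q' p' = - pcompose (wronskian p q) [:c, 1:]"
    unfolding wronskian_shift[of p c q, symmetric]
    unfolding p'_def q'_def wronskian_def pderiv_pcompose_linear
    by (simp only: pcompose_diff pcompose_mult smult_1_left minus_diff_eq
          mult.commute)
  have qc: "poly q c \<noteq> 0" using coprime_poly_0[OF cop, of c] c by auto
  have top: "coeff q' n = coeff q n" "coeff p' n = coeff p n - c * coeff q n"
    using dp by (simp_all add: p'_def q'_def coeff_pcompose_shift degree_diff_le)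
  have top_nz: "coeff p n \<noteq> 0 \<or> coeff q n \<noteq> 0"
    using coeff_max_degree_nonzero[OF deg] qc by fastforce
  have P_deg: "degree P = n"
    using degree_flip[of n q'] qc le_degree[of P n]
    by (simp add: P_def coeff_flip q'_poly flip: poly_0_coeff_0)
  have "coeff P n \<noteq> 0" using P_deg n by (metis degree_0 leading_coeff_0_iff not_numeral_le_zero)
  have p'0: "coeff p' i = 0" if "i < e" for i
  proof -
    obtain r where r: "p - smult c q = [:- c, 1:] ^ e * r" using e by (auto elim: dvdE)
    have "pcompose ([:- c, 1:] ^ e) [:c, 1:] = monom 1 e"
      by (simp flip: poly_eq_poly_eq_iff add: fun_eq_iff poly_pcompose poly_monom)
    then have "p' = monom 1 e * pcompose r [:c, 1:]"
      unfolding p'_def r by (simp add: pcompose_mult)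
    with that show ?thesis by (simp add: coeff_monom_mult)
  qed
  have "0 < e \<Longrightarrow> degree Q \<le> n - e"
    by (rule degree_le) (auto simp: Q_def coeff_flip p'0)
  then have Q_deg: "degree Q \<le> n - e"
    using degree_flip[of n p'] by (cases "e = 0") (auto simp: Q_def)
  \<comment> \<open>Since c is fixed, infinity is a fixed point of the new map; for e = 0 this is
    not contained in the bound just shown.\<close>
  have "coeff Q n = 0" using c by (simp add: Q_def coeff_flip p'_poly flip: poly_0_coeff_0)
  with degree_flip[of n p'] n have Q_lt: "degree Q < n"
    by (cases "degree Q = n") (auto simp: Q_def[symmetric] leading_coeff_0_iff dest: sym)
  have nz: "poly P z \<noteq> 0" if "poly Q z = 0" for z
  proof (cases "z = 0")
    case True
    with that top top_nz show ?thesis by (auto simp: P_def Q_def poly_flip_0)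
  next
    case False
    with that coprime_poly_0[OF cop, of "1 / z + c"] show ?thesis
      by (auto simp: P_def Q_def poly_flip dp' p'_poly q'_poly)
  qed
  have "coprime P Q"
    using P_deg n nz by (intro coprime_if_no_common_root) auto
  have "poly P z = z * poly Q z" if wz: "poly (wronskian P Q) z = 0" for z
  proof (cases "z = 0")
    case False
    have "poly (wronskian p q) (1 / z + c) = 0"
      using wz False poly_wronskian_flip[OF dp'(2,1) False n]
      by (simp add: P_def Q_def wr' poly_pcompose add.commute)
    from fix'[OF this] show ?thesis using False
      by (simp add: P_def Q_def poly_flip dp' p'_poly q'_poly algebra_simps)
  next
    case True
    have "coeff (wronskian q' p') (2 * n - 2) = - coeff (wronskian p q) (2 * n - 2)"
      unfolding wr' using wronskian_top(1)[OF dp n] by (simp add: coeff_pcompose_shift)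
    moreover have "coeff (wronskian q' p') (2 * n - 2) = 0"
      using wz True n wronskian_top(2)[OF dp'(2,1) n]
      by (simp add: P_def Q_def poly_wronskian_flip_0)
    ultimately have "coeff q n = 0" using inf by simp
    then show ?thesis using True by (simp add: P_def poly_flip_0 top)
  qed
  with \<open>coprime P Q\<close> P_deg Q_lt have "cf_pair n P Q" by (simp add: cf_pair_def)
  let ?\<phi> = "rat_map [:1, 0:] [:- c, 1:]"
  have "moebius ?\<phi>" unfolding moebius_def
    by (intro exI[of _ 0] exI[of _ 1] exI[of _ "- c"]) simp
  moreover have "?\<phi> (rat_map p q s) = rat_map P Q (?\<phi> s)" for s
  proof (cases s)
    case Infty
    have "rat_map p q Infty = (if coeff q n = 0 then Infty else Aff (coeff p n / coeff q n))"
      using deg by (simp add: rat_map_def)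
    moreover have "rat_map P Q (Aff 0) = (if coeff p n - c * coeff q n = 0 then Infty
        else Aff (coeff q n / (coeff p n - c * coeff q n)))"
      by (simp add: rat_map_def P_def Q_def poly_flip_0 top)
    ultimately show ?thesis
      using top_nz by (auto simp: Infty rat_map_def field_simps)
  next
    case (Aff z)
    show ?thesis
    proof (cases "z = c")
      case True
      have "rat_map p q s = Aff c" using c qc by (simp add: Aff True rat_map_def)
      then show ?thesis using rat_map_Infty[of Q P] Q_lt P_deg by (simp add: Aff True rat_map_def)
    next
      case False
      define w where "w = 1 / (z - c)"
      have w: "w \<noteq> 0" "1 / w + c = z" using False by (auto simp: w_def)
      have \<phi>: "?\<phi> s = Aff w" using False by (simp add: Aff rat_map_def w_def)
      have PQ: "poly P w = w ^ n * poly q z" "poly Q w = w ^ n * (poly p z - c * poly q z)"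
        using w by (simp_all add: P_def Q_def poly_flip dp' p'_poly q'_poly)
      show ?thesis unfolding \<phi> using w(1) coprime_poly_0[OF cop, of z]
        by (auto simp: Aff rat_map_def PQ divide_simps)
    qed
  qed
  ultimately have "moebius_conjugate (rat_map p q) (rat_map P Q)" by (rule moebius_conjugateI)
  with \<open>cf_pair n P Q\<close> Q_deg show ?thesis by blast
qed

text \<open>A point at infinity that is not fixed is not critical either, so the Wronskian has its
  full degree 2n - 2 > 0 and a zero c exists. This finite critical point is fixed and can be moved
  to infinity.\<close>

lemma exists_cf_pair:
  assumes "rational_map_of_degree n f" "critically_fixed f" "2 \<le> n"
  shows "\<exists>P Q. moebius_conjugate f (rat_map P Q) \<and> cf_pair n P Q"
proof -
  from assms(1) obtain p q where cop: "coprime p q" and deg: "max (degree p) (degree q) = n"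
    and f: "f = rat_map p q"
    unfolding rational_map_of_degree_def by blast
  have dp: "degree p \<le> n" "degree q \<le> n" using deg by auto
  have fix': "poly p z = z * poly q z" if "poly (wronskian p q) z = 0" for z
    using that assms(2) by (simp add: f critically_fixed_def critical_point_Aff cop rat_map_Aff_eq_Aff
        flip: rat_map_Aff_eq_Aff)
  show ?thesis
  proof (cases "coeff q n = 0")
    case True
    then have "degree q \<noteq> n"
      using assms(3) by (metis degree_0 leading_coeff_0_iff not_numeral_le_zero)
    with deg have "cf_pair n p q" using cop fix' by (auto simp: cf_pair_def max_def split: if_splits)
    then show ?thesis unfolding f using moebius_conjugate_refl by blast
  next
    case False
    then have "\<not> critical_point f Infty"
      using assms(2)[unfolded critically_fixed_def f, rule_format, of Infty] deg
      by (auto simp: f rat_map_def)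
    then have top: "coeff (wronskian p q) (2 * n - 2) \<noteq> 0"
      using critical_point_Infty[OF cop deg] assms(3) wronskian_top(2)[OF dp assms(3)] by (simp add: f)
    then have "degree (wronskian p q) \<noteq> 0"
      using assms(3) le_degree by fastforce
    then obtain c where c: "poly (wronskian p q) c = 0"
      using fundamental_theorem_of_algebra[of "wronskian p q"] by (auto simp: constant_degree)
    from move_to_Infty[OF cop deg assms(3) fix' _ fix'[OF c], of 0] top show ?thesis
      unfolding f by auto
  qed
qed

text \<open>The multiplicity of infinity is n - 1 - degree q, so the extremal choice is a pair whose
  denominator has the least possible degree. A finite critical point of larger multiplicity could be
  moved to infinity and would give a smaller degree.\<close>

lemma exists_reduced_cf_pair:
  assumes "rational_map_of_degree n f" "critically_fixed f" "2 \<le> n"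
  shows "\<exists>p q. moebius_conjugate f (rat_map p q) \<and> cf_pair n p q \<and>
    (\<forall>z. order z (wronskian p q) \<le> n - 1 - degree q)"
proof -
  let ?P = "\<lambda>k. \<exists>p q. moebius_conjugate f (rat_map p q) \<and> cf_pair n p q \<and> degree q = k"
  define k where "k = (LEAST k. ?P k)"
  from exists_cf_pair[OF assms] have "\<exists>k. ?P k" by blast
  then have k: "?P k" "\<And>l. ?P l \<Longrightarrow> k \<le> l"
    unfolding k_def by (rule LeastI_ex) (rule Least_le)
  from k(1) obtain p q where pq: "moebius_conjugate f (rat_map p q)" "cf_pair n p q" "degree q = k"
    by blast
  then have cop: "coprime p q" and deg: "degree p = n" "degree q < n"
    and fix': "\<And>z. poly (wronskian p q) z = 0 \<Longrightarrow> poly p z = z * poly q z"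
    by (auto simp: cf_pair_def)
  have "order z (wronskian p q) \<le> n - 1 - degree q" for z
  proof (cases "order z (wronskian p q) = 0")
    case False
    then have "poly (wronskian p q) z = 0" by (simp add: order_root)
    from fix'[OF this] have z: "poly p z = z * poly q z" .
    with coprime_poly_0[OF cop, of z] have qz: "poly q z \<noteq> 0" by auto
    let ?h = "p - smult z q"
    have dh: "degree ?h = n"
      using deg degree_add_eq_left[of "- smult z q" p] by simp
    then have "?h \<noteq> 0" using deg by auto
    have "\<exists>P Q. moebius_conjugate (rat_map p q) (rat_map P Q) \<and> cf_pair n P Q
        \<and> degree Q \<le> n - order z ?h"
      using deg by (intro move_to_Infty[OF cop _ assms(3) fix' _ z]) (auto simp: coeff_eq_0 order_1)
    then obtain P Q where PQ: "moebius_conjugate (rat_map p q) (rat_map P Q)" "cf_pair n P Q"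
      "degree Q \<le> n - order z ?h" by blast
    with k(2)[of "degree Q"] moebius_conjugate_trans[OF pq(1)] have "k \<le> n - order z ?h"
      by fastforce
    then show ?thesis
      using order_wronskian[OF z qz \<open>?h \<noteq> 0\<close>] pq(3) order_degree[OF \<open>?h \<noteq> 0\<close>, of z] dh deg
      by linarith
  qed simp
  with pq show ?thesis by blast
qed

section \<open>Fibres of fixed points\<close>

lemma card_roots_rsquarefree:
  fixes p :: "complex poly"
  assumes "rsquarefree p"
  shows "card {z. poly p z = 0} = degree p"
proof -
  have nz: "p \<noteq> 0" using assms by (auto simp: rsquarefree_def)
  have "proots p = mset_set {z. poly p z = 0}"
  proof (rule multiset_eqI)
    fix z
    show "count (proots p) z = count (mset_set {z. poly p z = 0}) z"
      using nz rsquarefree_root_order[OF assms _ nz, of z]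
      by (cases "poly p z = 0") (simp_all add: poly_roots_finite order_0I)
  qed
  then show ?thesis using size_proots_complex[of p] by simp
qed

text \<open>A multiple pole would be critical, hence a finite fixed point, which a pole is not. So
  the poles are simple, and infinity itself is the additional point of the fibre.\<close>

lemma card_fibre_Infty:
  assumes "cf_pair n p q"
  shows "card (rat_map p q -` {Infty}) = Suc (degree q)"
proof -
  have cop: "coprime p q" and deg: "degree p = n" "degree q < n"
    and fix': "\<And>z. poly (wronskian p q) z = 0 \<Longrightarrow> poly p z = z * poly q z"
    using assms by (auto simp: cf_pair_def)
  have "rsquarefree q"
    unfolding rsquarefree_roots
  proof (intro allI notI)
    fix z assume z: "poly q z = 0 \<and> poly (pderiv q) z = 0"
    then have "poly p z = z * poly q z" by (intro fix') (simp add: wronskian_def)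
    with z coprime_poly_0[OF cop, of z] show False by simp
  qed
  moreover have "rat_map p q -` {Infty} = insert Infty (Aff ` {z. poly q z = 0})"
  proof (rule set_eqI)
    fix s
    show "s \<in> rat_map p q -` {Infty} \<longleftrightarrow> s \<in> insert Infty (Aff ` {z. poly q z = 0})"
      using rat_map_Infty[of q p] deg by (cases s) (auto simp: rat_map_Aff_eq_Infty)
  qed
  ultimately show ?thesis
    by (simp add: rsquarefree_def card_image poly_roots_finite inj_on_def card_insert_if image_iff
        flip: card_roots_rsquarefree)
qed

text \<open>A multiple zero w of p - z q is critical and thus fixed, while its image is z; so w = z,
  and all other points of the fibre are simple. With e the local degree at z, the fibre has 1 + (n -
  e) points.\<close>

lemma card_fibre_Aff:
  assumes "cf_pair n p q" "poly p z = z * poly q z"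
  shows "card (rat_map p q -` {Aff z}) = n - order z (wronskian p q)"
proof -
  have cop: "coprime p q" and deg: "degree p = n" "degree q < n"
    and fix': "\<And>z. poly (wronskian p q) z = 0 \<Longrightarrow> poly p z = z * poly q z"
    using assms by (auto simp: cf_pair_def)
  have qz: "poly q z \<noteq> 0" using coprime_poly_0[OF cop, of z] assms(2) by auto
  define h where "h = p - smult z q"
  have dh: "degree h = n"
    using deg degree_add_eq_left[of "- smult z q" p] by (simp add: h_def)
  then have h0: "h \<noteq> 0" using deg by auto
  define e where "e = order z h"
  have e: "e = Suc (order z (wronskian p q))"
    unfolding e_def h_def by (rule order_wronskian) (use assms qz h0 in \<open>auto simp: h_def\<close>)
  obtain r where r: "h = [:-z, 1:] ^ e * r" "\<not> [:-z, 1:] dvd r"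
    using order_decomp[OF h0] unfolding e_def by blast
  have rz: "poly r z \<noteq> 0" using r(2) by (simp add: poly_eq_0_iff_dvd)
  have r0: "r \<noteq> 0" using rz by auto
  have dr: "n = e + degree r"
    using dh r0 by (simp add: r(1) degree_mult_eq degree_power_eq)
  have "rsquarefree r"
    unfolding rsquarefree_roots
  proof (intro allI notI)
    fix w assume w: "poly r w = 0 \<and> poly (pderiv r) w = 0"
    then have "poly h w = 0" "poly (pderiv h) w = 0"
      by (simp_all add: r(1) pderiv_mult)
    then have "poly (wronskian h q) w = 0" by (simp add: wronskian_def)
    then have "poly p w = w * poly q w"
      by (intro fix') (simp add: h_def wronskian_shift)
    with \<open>poly h w = 0\<close> coprime_poly_0[OF cop, of w] have "w = z"
      by (auto simp: h_def)
    with w rz show False by simp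
  qed
  moreover have "rat_map p q -` {Aff z} = Aff ` insert z {w. poly r w = 0}"
  proof (rule set_eqI)
    fix s
    have "poly p w = z * poly q w \<longleftrightarrow> poly h w = 0" for w by (simp add: h_def)
    also have "poly h w = 0 \<longleftrightarrow> w = z \<or> poly r w = 0" for w by (auto simp: r(1) e)
    finally show "s \<in> rat_map p q -` {Aff z} \<longleftrightarrow> s \<in> Aff ` insert z {w. poly r w = 0}"
      using rat_map_Infty[of q p] deg by (cases s) (auto simp: rat_map_Aff_eq_Aff cop)
  qed
  moreover have "card (Aff ` insert z {w. poly r w = 0}) = Suc (card {w. poly r w = 0})"
    using rz r0 by (subst card_image) (auto simp: poly_roots_finite inj_on_def)
  ultimately show ?thesis using dr by (simp add: card_roots_rsquarefree e)
qed

text \<open>By \<open>card_fibre_Infty\<close> and \<open>card_fibre_Aff\<close> the cardinality of the fibre over a fixed point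
  records its local degree. Unlike multiplicities, cardinalities are visibly preserved by
  conjugation with any bijection.\<close>

definition fixed_fibre :: "nat \<Rightarrow> (sphere \<Rightarrow> sphere) \<Rightarrow> sphere set" where
  "fixed_fibre j f = {x. f x = x \<and> card (f -` {x}) = j}"

lemma fixed_fibre_conjugate:
  assumes "bij \<phi>" "\<And>s. \<phi> (f s) = g (\<phi> s)"
  shows "\<phi> ` fixed_fibre j f = fixed_fibre j g"
proof -
  have inj: "\<phi> x = \<phi> y \<longleftrightarrow> x = y" for x y using assms(1) by (meson bij_is_inj injD)
  have surj: "\<exists>x. \<phi> x = y" for y using assms(1) by (metis bij_pointE)
  have "g -` {\<phi> x} = \<phi> ` (f -` {x})" for x
  proof (rule set_eqI)
    fix s
    obtain y where y: "\<phi> y = s" using surj by blast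
    show "s \<in> g -` {\<phi> x} \<longleftrightarrow> s \<in> \<phi> ` (f -` {x})"
      unfolding y[symmetric] by (auto simp: inj assms(2)[symmetric])
  qed
  then have card: "card (g -` {\<phi> x}) = card (f -` {x})" for x
    by (metis assms(1) bij_is_inj card_image inj_on_subset subset_UNIV)
  show ?thesis
  proof (rule set_eqI)
    fix s
    obtain y where y: "\<phi> y = s" using surj by blast
    show "s \<in> \<phi> ` fixed_fibre j f \<longleftrightarrow> s \<in> fixed_fibre j g"
      unfolding y[symmetric] by (auto simp: fixed_fibre_def inj card assms(2)[symmetric])
  qed
qed

lemma fixed_fibre_rat_map:
  assumes "cf_pair n p q" "0 < j" "j < n"
  shows "fixed_fibre j (rat_map p q)
    = (if Suc (degree q) = j then {Infty} else {}) \<union> Aff ` {z. order z (wronskian p q) = n - j}"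
proof (rule set_eqI)
  fix s
  have cop: "coprime p q" and deg: "degree p = n" "degree q < n"
    and fix': "\<And>z. poly (wronskian p q) z = 0 \<Longrightarrow> poly p z = z * poly q z"
    using assms by (auto simp: cf_pair_def)
  show "s \<in> fixed_fibre j (rat_map p q) \<longleftrightarrow> s \<in> (if Suc (degree q) = j then {Infty} else {})
      \<union> Aff ` {z. order z (wronskian p q) = n - j}"
  proof (cases s)
    case Infty
    then show ?thesis using rat_map_Infty[of q p] deg card_fibre_Infty[OF assms(1)]
      by (auto simp: fixed_fibre_def)
  next
    case (Aff z)
    \<comment> \<open>As j < n, this order is positive, so that z is critical and therefore
      fixed.\<close>
    have "order z (wronskian p q) = n - j \<Longrightarrow> poly p z = z * poly q z"
      by (intro fix') (use assms in \<open>auto simp: order_root\<close>)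
    then show ?thesis using card_fibre_Aff[OF assms(1), of z] assms(2,3)
      by (auto simp: fixed_fibre_def Aff rat_map_Aff_eq_Aff[OF cop])
  qed
qed

lemma order_linear_power: "order z ([:- a, 1:] ^ i) = (if z = a then i else 0)"
  for a :: "'a::idom"
  by (auto simp: order_power_n_n order_0I)

text \<open>Simple zeros do not count for m \<ge> 2, so the factor \<open>H\<close> collecting them
  only has to be squarefree; its roots, irrational for several of the maps, never have to be written
  down.\<close>

lemma order_eq_three_points:
  fixes H :: "complex poly"
  assumes W: "W = smult \<kappa> ([:- a, 1:] ^ i * [:- b, 1:] ^ j * [:- c, 1:] ^ k * H)"
    and "\<kappa> \<noteq> 0" "rsquarefree H" "a \<noteq> b" "a \<noteq> c" "b \<noteq> c"
    and "poly H a \<noteq> 0" "poly H b \<noteq> 0" "poly H c \<noteq> 0" "2 \<le> m"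
  shows "{z. order z W = m} = {z. z = a \<and> i = m \<or> z = b \<and> j = m \<or> z = c \<and> k = m}"
proof -
  have H0: "H \<noteq> 0" and "order z H \<le> 1" for z using assms(3) by (auto simp: rsquarefree_def le_Suc_eq)
  then have H1: "order z H \<noteq> m" for z using assms(10) by (metis One_nat_def Suc_1 not_less_eq_eq)
  have "order z W = (if z = a then i else 0) + (if z = b then j else 0)
      + (if z = c then k else 0) + order z H" for z
    using H0 assms(2) by (simp add: W order_smult order_mult order_linear_power)
  moreover have "order a H = 0" "order b H = 0" "order c H = 0"
    using assms by (auto intro: order_0I)
  ultimately show ?thesis using assms H1 by auto
qed

section \<open>The fourteen maps\<close>

lemma poly_eqI_pointwise: "(\<And>x. poly p x = poly q x) \<Longrightarrow> p = q"
  for p q :: "'a::{idom,ring_char_0} poly"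
  by (metis poly_eq_poly_eq_iff ext)

text \<open>For a critically fixed map of degree 5 the entries count the fixed points of
  multiplicities 4, 3 and 2. Fibres of 4 or 5 points are left out, since they would require the
  simple critical points and the non-critical fixed points.\<close>

definition profile :: "(sphere \<Rightarrow> sphere) \<Rightarrow> nat \<times> nat \<times> nat" where
  "profile f = (card (fixed_fibre 1 f), card (fixed_fibre 2 f), card (fixed_fibre 3 f))"

lemma profile_conjugate:
  assumes "moebius_conjugate f g"
  shows "profile f = profile g"
proof -
  from assms obtain \<phi> where \<phi>: "bij \<phi>" "\<And>s. \<phi> (f s) = g (\<phi> s)"
    by (rule moebius_conjugateE) blast
  have "card (fixed_fibre j f) = card (fixed_fibre j g)" for j
    using fixed_fibre_conjugate[of \<phi> f g j] \<phi>
    by (metis bij_is_inj card_image inj_on_subset subset_UNIV)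
  then show ?thesis by (simp add: profile_def)
qed

text \<open>The hypotheses are equations and non-vanishing conditions for explicit polynomials,
  which simplification and elimination can settle. A map with fewer than three multiple critical
  points takes exponent 0 at arbitrary further places where \<open>H\<close> does not
  vanish.\<close>

lemma cf_pair_profile:
  fixes p q H :: "complex poly"
  assumes "degree p = 5" "degree q = d" "d < 5"
    and cop: "\<And>z. poly p z = 0 \<Longrightarrow> poly q z = 0 \<Longrightarrow> False"
    and W: "\<And>z. poly (wronskian p q) z = \<kappa> * ((z - a) ^ i * (z - b) ^ j * (z - c) ^ k * poly H z)"
    and "\<kappa> \<noteq> 0" "distinct [a, b, c]"
    and H: "\<And>z. poly H z = 0 \<Longrightarrow> poly (pderiv H) z = 0 \<Longrightarrow> False"
    and "poly H a \<noteq> 0" "poly H b \<noteq> 0" "poly H c \<noteq> 0"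
    and fix': "i \<noteq> 0 \<Longrightarrow> poly p a = a * poly q a" "j \<noteq> 0 \<Longrightarrow> poly p b = b * poly q b"
      "k \<noteq> 0 \<Longrightarrow> poly p c = c * poly q c" "\<And>z. poly H z = 0 \<Longrightarrow> poly p z = z * poly q z"
  shows "cf_pair 5 p q \<and> (\<forall>m. 0 < m \<and> m < 4 \<longrightarrow> fixed_fibre m (rat_map p q)
    = (if Suc d = m then {Infty} else {}) \<union>
      ((if i = 5 - m then {Aff a} else {}) \<union> (if j = 5 - m then {Aff b} else {})
        \<union> (if k = 5 - m then {Aff c} else {})))"
proof -
  have "coprime p q"
    using assms(1,4) by (intro coprime_if_no_common_root) auto
  moreover have "poly p z = z * poly q z" if "poly (wronskian p q) z = 0" for z
    using that fix' \<open>\<kappa> \<noteq> 0\<close> by (auto simp: W)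
  ultimately have cf: "cf_pair 5 p q" using assms(1-3) by (simp add: cf_pair_def)
  have W': "wronskian p q = smult \<kappa> ([:- a, 1:] ^ i * [:- b, 1:] ^ j * [:- c, 1:] ^ k * H)"
    by (rule poly_eqI_pointwise) (simp add: W)
  have "rsquarefree H" using H unfolding rsquarefree_roots by blast
  note orders = order_eq_three_points[OF W' \<open>\<kappa> \<noteq> 0\<close> this]
  have "fixed_fibre m (rat_map p q) = (if Suc d = m then {Infty} else {}) \<union>
      ((if i = 5 - m then {Aff a} else {}) \<union> (if j = 5 - m then {Aff b} else {})
        \<union> (if k = 5 - m then {Aff c} else {}))" if "0 < m" "m < 4" for m
    using that fixed_fibre_rat_map[OF cf, of m] orders[of "5 - m"] assms(2,7-11) by auto
  with cf show ?thesis by blast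
qed

section \<open>Maps with rational coefficients\<close>

lemma f1_eq: "f1 = rat_map [:0, 0, 0, 0, 0, 1:] [:1:]"
  unfolding f1_def by (intro arg_cong2[where f = rat_map] poly_eqI_pointwise) (simp, algebra?)+

lemma f2_eq: "f2 = rat_map [:0, 0, 10, 10, 5, 1:] [:1, 5:]"
  unfolding f2_def by (intro arg_cong2[where f = rat_map] poly_eqI_pointwise) (simp, algebra?)+

lemma f3_eq: "f3 = rat_map [:0, 0, 0, 10, 5, 1:] [:1, 5, 10:]"
  unfolding f3_def by (intro arg_cong2[where f = rat_map] poly_eqI_pointwise) (simp, algebra?)+

lemma f4_eq: "f4 = rat_map [:0, 0, 0, 0, - 5, 3:] [:3, - 5:]"
  unfolding f4_def by (intro arg_cong2[where f = rat_map] poly_eqI_pointwise) (simp, algebra?)+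

lemma f5_eq: "f5 = rat_map [:0, 0, 0, 5, 0, - 3:] [:2:]"
  unfolding f5_def by (intro arg_cong2[where f = rat_map] poly_eqI_pointwise) (simp, algebra?)+

lemma f6_eq: "f6 = rat_map [:0, 0, 0, 220, - 165, 36:] [:121:]"
  unfolding f6_def by (intro arg_cong2[where f = rat_map] poly_eqI_pointwise) (simp, algebra?)+

lemma f11_eq: "f11 = rat_map [:0, 0, 0, - 5, 0, 1:] [:1, 0, - 5:]"
  unfolding f11_def by (intro arg_cong2[where f = rat_map] poly_eqI_pointwise) (simp, algebra?)+

lemma f12_eq: "f12 = rat_map [:0, 0, 0, - 20, 5, 1:] [:1, 5, - 20:]"
  unfolding f12_def by (intro arg_cong2[where f = rat_map] poly_eqI_pointwise) (simp, algebra?)+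

lemma f13_eq: "f13 = rat_map [:0, 0, 5, - 10, 10, - 4:] [:1:]"
  unfolding f13_def by (intro arg_cong2[where f = rat_map] poly_eqI_pointwise) (simp, algebra?)+

lemma f1_cf:
  "cf_pair 5 [:0, 0, 0, 0, 0, 1:] [:1:]"
  "profile f1 = (2, 0, 0)"
proof -
  have *: "cf_pair 5 [:0, 0, 0, 0, 0, 1:] [:1:] \<and>
    (\<forall>m. 0 < m \<and> m < 4 \<longrightarrow> fixed_fibre m (rat_map [:0, 0, 0, 0, 0, 1:] [:1:])
    = (if Suc 0 = m then {Infty} else {}) \<union>
      ((if 4 = 5 - m then {Aff 0} else {}) \<union> (if 0 = 5 - m then {Aff 1} else {})
        \<union> (if 0 = 5 - m then {Aff 2} else {})))"
    by (rule cf_pair_profile[where \<kappa> = "5" and H = "1"])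
       (simp_all add: wronskian_def pderiv_pCons, algebra+)
  show "cf_pair 5 [:0, 0, 0, 0, 0, 1:] [:1:]" using * by blast
  have "fixed_fibre 1 f1 = {Infty, Aff 0}"
    "fixed_fibre 2 f1 = {}"
    "fixed_fibre 3 f1 = {}"
    unfolding f1_eq using *[THEN conjunct2, rule_format] by (simp_all add: insert_commute)
  then show "profile f1 = (2, 0, 0)" by (simp add: profile_def)
qed

lemma f2_cf:
  "cf_pair 5 [:0, 0, 10, 10, 5, 1:] [:1, 5:]"
  "profile f2 = (1, 1, 0)"
proof -
  have *: "cf_pair 5 [:0, 0, 10, 10, 5, 1:] [:1, 5:] \<and>
    (\<forall>m. 0 < m \<and> m < 4 \<longrightarrow> fixed_fibre m (rat_map [:0, 0, 10, 10, 5, 1:] [:1, 5:])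
    = (if Suc 1 = m then {Infty} else {}) \<union>
      ((if 1 = 5 - m then {Aff 0} else {}) \<union> (if 4 = 5 - m then {Aff (- 1)} else {})
        \<union> (if 0 = 5 - m then {Aff 1} else {})))"
    by (rule cf_pair_profile[where \<kappa> = "20" and H = "1"])
       (simp_all add: wronskian_def pderiv_pCons, algebra+)
  show "cf_pair 5 [:0, 0, 10, 10, 5, 1:] [:1, 5:]" using * by blast
  have "fixed_fibre 1 f2 = {Aff (- 1)}"
    "fixed_fibre 2 f2 = {Infty}"
    "fixed_fibre 3 f2 = {}"
    unfolding f2_eq using *[THEN conjunct2, rule_format] by (simp_all add: insert_commute)
  then show "profile f2 = (1, 1, 0)" by (simp add: profile_def)
qed

lemma f3_cf:
  "cf_pair 5 [:0, 0, 0, 10, 5, 1:] [:1, 5, 10:]"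
  "profile f3 = (1, 0, 2)"
proof -
  have *: "cf_pair 5 [:0, 0, 0, 10, 5, 1:] [:1, 5, 10:] \<and>
    (\<forall>m. 0 < m \<and> m < 4 \<longrightarrow> fixed_fibre m (rat_map [:0, 0, 0, 10, 5, 1:] [:1, 5, 10:])
    = (if Suc 2 = m then {Infty} else {}) \<union>
      ((if 2 = 5 - m then {Aff 0} else {}) \<union> (if 4 = 5 - m then {Aff (- 1)} else {})
        \<union> (if 0 = 5 - m then {Aff 1} else {})))"
    by (rule cf_pair_profile[where \<kappa> = "30" and H = "1"])
       (simp_all add: wronskian_def pderiv_pCons, algebra+)
  show "cf_pair 5 [:0, 0, 0, 10, 5, 1:] [:1, 5, 10:]" using * by blast
  have "fixed_fibre 1 f3 = {Aff (- 1)}"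
    "fixed_fibre 2 f3 = {}"
    "fixed_fibre 3 f3 = {Infty, Aff 0}"
    unfolding f3_eq using *[THEN conjunct2, rule_format] by (simp_all add: insert_commute)
  then show "profile f3 = (1, 0, 2)" by (simp add: profile_def)
qed

lemma f4_cf:
  "cf_pair 5 [:0, 0, 0, 0, - 5, 3:] [:3, - 5:]"
  "profile f4 = (0, 2, 1)"
proof -
  have *: "cf_pair 5 [:0, 0, 0, 0, - 5, 3:] [:3, - 5:] \<and>
    (\<forall>m. 0 < m \<and> m < 4 \<longrightarrow> fixed_fibre m (rat_map [:0, 0, 0, 0, - 5, 3:] [:3, - 5:])
    = (if Suc 1 = m then {Infty} else {}) \<union>
      ((if 3 = 5 - m then {Aff 0} else {}) \<union> (if 2 = 5 - m then {Aff 1} else {})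
        \<union> (if 0 = 5 - m then {Aff 2} else {})))"
    by (rule cf_pair_profile[where \<kappa> = "- 60" and H = "1"])
       (simp_all add: wronskian_def pderiv_pCons, algebra+)
  show "cf_pair 5 [:0, 0, 0, 0, - 5, 3:] [:3, - 5:]" using * by blast
  have "fixed_fibre 1 f4 = {}"
    "fixed_fibre 2 f4 = {Infty, Aff 0}"
    "fixed_fibre 3 f4 = {Aff 1}"
    unfolding f4_eq using *[THEN conjunct2, rule_format] by (simp_all add: insert_commute)
  then show "profile f4 = (0, 2, 1)" by (simp add: profile_def)
qed

lemma f5_cf:
  "cf_pair 5 [:0, 0, 0, 5, 0, - 3:] [:2:]"
  "fixed_fibre 1 f5 = {Infty}"
  "fixed_fibre 3 f5 = {Aff 0}"
  "profile f5 = (1, 0, 1)"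
proof -
  have *: "cf_pair 5 [:0, 0, 0, 5, 0, - 3:] [:2:] \<and>
    (\<forall>m. 0 < m \<and> m < 4 \<longrightarrow> fixed_fibre m (rat_map [:0, 0, 0, 5, 0, - 3:] [:2:])
    = (if Suc 0 = m then {Infty} else {}) \<union>
      ((if 2 = 5 - m then {Aff 0} else {}) \<union> (if 0 = 5 - m then {Aff 2} else {})
        \<union> (if 0 = 5 - m then {Aff 3} else {})))"
    by (rule cf_pair_profile[where \<kappa> = "30" and H = "[:1, 0, - 1:]"])
       (simp_all add: wronskian_def pderiv_pCons, algebra+)
  show "cf_pair 5 [:0, 0, 0, 5, 0, - 3:] [:2:]" using * by blast
  have sets: "fixed_fibre 1 f5 = {Infty}"
    "fixed_fibre 2 f5 = {}"
    "fixed_fibre 3 f5 = {Aff 0}"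
    unfolding f5_eq using *[THEN conjunct2, rule_format] by (simp_all add: insert_commute)
  show "fixed_fibre 1 f5 = {Infty}" by (rule sets)
  show "fixed_fibre 3 f5 = {Aff 0}" by (rule sets)
  show "profile f5 = (1, 0, 1)" using sets by (simp add: profile_def)
qed

lemma f6_cf:
  "cf_pair 5 [:0, 0, 0, 220, - 165, 36:] [:121:]"
  "fixed_fibre 1 f6 = {Infty}"
  "fixed_fibre 3 f6 = {Aff 0}"
  "profile f6 = (1, 0, 1)"
proof -
  have *: "cf_pair 5 [:0, 0, 0, 220, - 165, 36:] [:121:] \<and>
    (\<forall>m. 0 < m \<and> m < 4 \<longrightarrow> fixed_fibre m (rat_map [:0, 0, 0, 220, - 165, 36:] [:121:])
    = (if Suc 0 = m then {Infty} else {}) \<union>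
      ((if 2 = 5 - m then {Aff 0} else {}) \<union> (if 0 = 5 - m then {Aff 1} else {})
        \<union> (if 0 = 5 - m then {Aff 2} else {})))"
    by (rule cf_pair_profile[where \<kappa> = "7260" and H = "[:11, - 11, 3:]"])
       (simp_all add: wronskian_def pderiv_pCons, algebra+)
  show "cf_pair 5 [:0, 0, 0, 220, - 165, 36:] [:121:]" using * by blast
  have sets: "fixed_fibre 1 f6 = {Infty}"
    "fixed_fibre 2 f6 = {}"
    "fixed_fibre 3 f6 = {Aff 0}"
    unfolding f6_eq using *[THEN conjunct2, rule_format] by (simp_all add: insert_commute)
  show "fixed_fibre 1 f6 = {Infty}" by (rule sets)
  show "fixed_fibre 3 f6 = {Aff 0}" by (rule sets)
  show "profile f6 = (1, 0, 1)" using sets by (simp add: profile_def)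
qed

lemma f11_cf:
  "cf_pair 5 [:0, 0, 0, - 5, 0, 1:] [:1, 0, - 5:]"
  "profile f11 = (0, 0, 4)"
proof -
  have *: "cf_pair 5 [:0, 0, 0, - 5, 0, 1:] [:1, 0, - 5:] \<and>
    (\<forall>m. 0 < m \<and> m < 4 \<longrightarrow> fixed_fibre m (rat_map [:0, 0, 0, - 5, 0, 1:] [:1, 0, - 5:])
    = (if Suc 2 = m then {Infty} else {}) \<union>
      ((if 2 = 5 - m then {Aff 0} else {}) \<union> (if 2 = 5 - m then {Aff 1} else {})
        \<union> (if 2 = 5 - m then {Aff (- 1)} else {})))"
    by (rule cf_pair_profile[where \<kappa> = "- 15" and H = "1"])
       (simp_all add: wronskian_def pderiv_pCons, algebra+)
  show "cf_pair 5 [:0, 0, 0, - 5, 0, 1:] [:1, 0, - 5:]" using * by blast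
  have "fixed_fibre 1 f11 = {}"
    "fixed_fibre 2 f11 = {}"
    "fixed_fibre 3 f11 = {Infty, Aff 0, Aff 1, Aff (- 1)}"
    unfolding f11_eq using *[THEN conjunct2, rule_format] by (simp_all add: insert_commute)
  then show "profile f11 = (0, 0, 4)" by (simp add: profile_def)
qed

lemma f12_cf:
  "cf_pair 5 [:0, 0, 0, - 20, 5, 1:] [:1, 5, - 20:]"
  "profile f12 = (0, 0, 3)"
proof -
  have *: "cf_pair 5 [:0, 0, 0, - 20, 5, 1:] [:1, 5, - 20:] \<and>
    (\<forall>m. 0 < m \<and> m < 4 \<longrightarrow> fixed_fibre m (rat_map [:0, 0, 0, - 20, 5, 1:] [:1, 5, - 20:])
    = (if Suc 2 = m then {Infty} else {}) \<union>
      ((if 2 = 5 - m then {Aff 0} else {}) \<union> (if 2 = 5 - m then {Aff 1} else {})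
        \<union> (if 0 = 5 - m then {Aff 2} else {})))"
    by (rule cf_pair_profile[where \<kappa> = "- 60" and H = "[:1, 5, 1:]"])
       (simp_all add: wronskian_def pderiv_pCons, algebra+)
  show "cf_pair 5 [:0, 0, 0, - 20, 5, 1:] [:1, 5, - 20:]" using * by blast
  have "fixed_fibre 1 f12 = {}"
    "fixed_fibre 2 f12 = {}"
    "fixed_fibre 3 f12 = {Infty, Aff 0, Aff 1}"
    unfolding f12_eq using *[THEN conjunct2, rule_format] by (simp_all add: insert_commute)
  then show "profile f12 = (0, 0, 3)" by (simp add: profile_def)
qed

lemma f13_cf:
  "cf_pair 5 [:0, 0, 5, - 10, 10, - 4:] [:1:]"
  "profile f13 = (1, 0, 0)"
proof -
  have *: "cf_pair 5 [:0, 0, 5, - 10, 10, - 4:] [:1:] \<and>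
    (\<forall>m. 0 < m \<and> m < 4 \<longrightarrow> fixed_fibre m (rat_map [:0, 0, 5, - 10, 10, - 4:] [:1:])
    = (if Suc 0 = m then {Infty} else {}) \<union>
      ((if 0 = 5 - m then {Aff 2} else {}) \<union> (if 0 = 5 - m then {Aff 3} else {})
        \<union> (if 0 = 5 - m then {Aff 4} else {})))"
    by (rule cf_pair_profile[where \<kappa> = "10" and H = "[:0, 1, - 3, 4, - 2:]"])
       (simp_all add: wronskian_def pderiv_pCons, algebra+)
  show "cf_pair 5 [:0, 0, 5, - 10, 10, - 4:] [:1:]" using * by blast
  have "fixed_fibre 1 f13 = {Infty}"
    "fixed_fibre 2 f13 = {}"
    "fixed_fibre 3 f13 = {}"
    unfolding f13_eq using *[THEN conjunct2, rule_format] by (simp_all add: insert_commute)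
  then show "profile f13 = (1, 0, 0)" by (simp add: profile_def)
qed

section \<open>Rational models of \<open>f7\<close>, \<open>f8\<close> and
  \<open>f14\<close>\<close>

lemma g7_cf:
  "cf_pair 5 [:0, 0, 0, 0, - 25, 25:] [:1, - 5:]"
  "fixed_fibre 2 (rat_map [:0, 0, 0, 0, - 25, 25:] [:1, - 5:]) = {Infty, Aff 0}"
  "profile (rat_map [:0, 0, 0, 0, - 25, 25:] [:1, - 5:]) = (0, 2, 0)"
proof -
  have *: "cf_pair 5 [:0, 0, 0, 0, - 25, 25:] [:1, - 5:] \<and>
    (\<forall>m. 0 < m \<and> m < 4 \<longrightarrow> fixed_fibre m (rat_map [:0, 0, 0, 0, - 25, 25:] [:1, - 5:])
    = (if Suc 1 = m then {Infty} else {}) \<union>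
      ((if 3 = 5 - m then {Aff 0} else {}) \<union> (if 0 = 5 - m then {Aff 1} else {})
        \<union> (if 0 = 5 - m then {Aff 2} else {})))"
    by (rule cf_pair_profile[where \<kappa> = "- 100" and H = "[:1, - 5, 5:]"])
       (simp_all add: wronskian_def pderiv_pCons, algebra+)
  show "cf_pair 5 [:0, 0, 0, 0, - 25, 25:] [:1, - 5:]" using * by blast
  have sets: "fixed_fibre 1 (rat_map [:0, 0, 0, 0, - 25, 25:] [:1, - 5:]) = {}"
    "fixed_fibre 2 (rat_map [:0, 0, 0, 0, - 25, 25:] [:1, - 5:]) = {Infty, Aff 0}"
    "fixed_fibre 3 (rat_map [:0, 0, 0, 0, - 25, 25:] [:1, - 5:]) = {}"
    using *[THEN conjunct2, rule_format] by (simp_all add: insert_commute)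
  show "fixed_fibre 2 (rat_map [:0, 0, 0, 0, - 25, 25:] [:1, - 5:]) = {Infty, Aff 0}" by (rule sets)
  show "profile (rat_map [:0, 0, 0, 0, - 25, 25:] [:1, - 5:]) = (0, 2, 0)" using sets by (simp add: profile_def)
qed

lemma g8_cf:
  "cf_pair 5 [:0, 0, 0, 0, 625, - 625:] [:9, 75:]"
  "fixed_fibre 2 (rat_map [:0, 0, 0, 0, 625, - 625:] [:9, 75:]) = {Infty, Aff 0}"
  "profile (rat_map [:0, 0, 0, 0, 625, - 625:] [:9, 75:]) = (0, 2, 0)"
proof -
  have *: "cf_pair 5 [:0, 0, 0, 0, 625, - 625:] [:9, 75:] \<and>
    (\<forall>m. 0 < m \<and> m < 4 \<longrightarrow> fixed_fibre m (rat_map [:0, 0, 0, 0, 625, - 625:] [:9, 75:])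
    = (if Suc 1 = m then {Infty} else {}) \<union>
      ((if 3 = 5 - m then {Aff 0} else {}) \<union> (if 0 = 5 - m then {Aff 1} else {})
        \<union> (if 0 = 5 - m then {Aff 2} else {})))"
    by (rule cf_pair_profile[where \<kappa> = "7500" and H = "[:3, 15, - 25:]"])
       (simp_all add: wronskian_def pderiv_pCons, algebra+)
  show "cf_pair 5 [:0, 0, 0, 0, 625, - 625:] [:9, 75:]" using * by blast
  have sets: "fixed_fibre 1 (rat_map [:0, 0, 0, 0, 625, - 625:] [:9, 75:]) = {}"
    "fixed_fibre 2 (rat_map [:0, 0, 0, 0, 625, - 625:] [:9, 75:]) = {Infty, Aff 0}"
    "fixed_fibre 3 (rat_map [:0, 0, 0, 0, 625, - 625:] [:9, 75:]) = {}"
    using *[THEN conjunct2, rule_format] by (simp_all add: insert_commute)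
  show "fixed_fibre 2 (rat_map [:0, 0, 0, 0, 625, - 625:] [:9, 75:]) = {Infty, Aff 0}" by (rule sets)
  show "profile (rat_map [:0, 0, 0, 0, 625, - 625:] [:9, 75:]) = (0, 2, 0)" using sets by (simp add: profile_def)
qed

text \<open>Here - 1 is the only fixed point that is not critical: p - z q = - z (z + 1) H, with
  \<open>H\<close> the cubic whose roots are the simple critical points.\<close>

lemma g14_cf:
  "cf_pair 5 [:0, 0, 0, - 20, - 10, - 2:] [:3, 15:]"
  "profile (rat_map [:0, 0, 0, - 20, - 10, - 2:] [:3, 15:]) = (0, 1, 1)"
proof -
  have *: "cf_pair 5 [:0, 0, 0, - 20, - 10, - 2:] [:3, 15:] \<and>
    (\<forall>m. 0 < m \<and> m < 4 \<longrightarrow> fixed_fibre m (rat_map [:0, 0, 0, - 20, - 10, - 2:] [:3, 15:])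
    = (if Suc 1 = m then {Infty} else {}) \<union>
      ((if 2 = 5 - m then {Aff 0} else {}) \<union> (if 0 = 5 - m then {Aff 1} else {})
        \<union> (if 0 = 5 - m then {Aff (- 1)} else {})))"
    by (rule cf_pair_profile[where \<kappa> = "- 60" and H = "[:3, 12, 8, 2:]"])
       (simp_all add: wronskian_def pderiv_pCons, algebra+)
  show "cf_pair 5 [:0, 0, 0, - 20, - 10, - 2:] [:3, 15:]" using * by blast
  have "fixed_fibre 1 (rat_map [:0, 0, 0, - 20, - 10, - 2:] [:3, 15:]) = {}"
    "fixed_fibre 2 (rat_map [:0, 0, 0, - 20, - 10, - 2:] [:3, 15:]) = {Infty}"
    "fixed_fibre 3 (rat_map [:0, 0, 0, - 20, - 10, - 2:] [:3, 15:]) = {Aff 0}"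
    using *[THEN conjunct2, rule_format] by (simp_all add: insert_commute)
  then show "profile (rat_map [:0, 0, 0, - 20, - 10, - 2:] [:3, 15:]) = (0, 1, 1)" by (simp add: profile_def)
qed

text \<open>The maps with critical points \<open>Infty\<close>, \<open>0\<close>, \<open>1\<close> of multiplicities \<open>3, 2, 2\<close> form this
  one-parameter family. The remaining critical point is \<open>t = (u - 1) (u + 5) / (8 u)\<close>; it is fixed
  exactly for the roots of the quartic in \<open>fu_cf\<close>.\<close>

definition fu :: "complex \<Rightarrow> sphere \<Rightarrow> sphere" where
  "fu u = rat_map [:0, 0, 0, 2 * (5 + u), - (15 + u), 6:] [:1 - u, 2 * u:]"

lemma fu_cf:
  assumes u: "u ^ 4 + 310 * u ^ 2 - 375 = 0"
  shows "cf_pair 5 [:0, 0, 0, 2 * (5 + u), - (15 + u), 6:] [:1 - u, 2 * u:]"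
    and "fixed_fibre 2 (fu u) = {Infty}"
    and "fixed_fibre 3 (fu u) = {Aff 0, Aff 1}"
    and "profile (fu u) = (0, 1, 2)"
proof -
  \<comment> \<open>The quartic takes the values - 375 at 0, - 64 at 1 and - 1, and 8000 at 5 and -
    5. These are the parameters for which t is undefined or coincides with 0 or 1.\<close>
  have ne: "u \<noteq> 0" "u \<noteq> 1" "u \<noteq> - 1" "u \<noteq> 5" "u \<noteq> - 5"
    using u by auto
  define t where "t = (u - 1) * (u + 5) / (8 * u)"
  have t: "8 * u * t = (u - 1) * (u + 5)" using ne by (simp add: t_def)
  have "t \<noteq> 0" using ne by (auto simp: t_def eq_neg_iff_add_eq_0)
  have "t \<noteq> 1"
  proof
    assume "t = 1"
    with t have "(u - 5) * (u + 1) = 0" by algebra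
    with ne show False by (simp add: eq_neg_iff_add_eq_0)
  qed
  \<comment> \<open>The cubic is (p - z q) / (z (z - 1)) at z = t. Inserting t, its product with
    (8u)^3 is - 2 (u - 1) (u + 1) times the quartic.\<close>
  have "(8 * u) ^ 3 * (6 * t ^ 3 - (9 + u) * t ^ 2 + (1 + u) * t + (1 - u)) = 0"
    using t u by algebra
  then have "6 * t ^ 3 - (9 + u) * t ^ 2 + (1 + u) * t + (1 - u) = 0" using ne by simp
  then have "t * (t - 1) * (6 * t ^ 3 - (9 + u) * t ^ 2 + (1 + u) * t + (1 - u)) = 0" by simp
  then have fix_t: "poly [:0, 0, 0, 2 * (5 + u), - (15 + u), 6:] t = t * poly [:1 - u, 2 * u:] t"
    by simp algebra
  have cop: "False" if "poly [:0, 0, 0, 2 * (5 + u), - (15 + u), 6:] z = 0"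
    "poly [:1 - u, 2 * u:] z = 0" for z
  proof -
    have "z \<noteq> 0" using that(2) ne by auto
    with that(1) have "2 * (5 + u) - (15 + u) * z + 6 * z ^ 2 = 0" by (simp, algebra)
    moreover from that(2) have "2 * u * z = u - 1" by simp algebra
    ultimately have "6 * (u + 1) ^ 3 = 0" by algebra
    with ne show False by (simp add: eq_neg_iff_add_eq_0)
  qed
  have *: "cf_pair 5 [:0, 0, 0, 2 * (5 + u), - (15 + u), 6:] [:1 - u, 2 * u:] \<and>
    (\<forall>m. 0 < m \<and> m < 4 \<longrightarrow>
      fixed_fibre m (rat_map [:0, 0, 0, 2 * (5 + u), - (15 + u), 6:] [:1 - u, 2 * u:])
    = (if Suc 1 = m then {Infty} else {}) \<union>
      ((if 2 = 5 - m then {Aff 0} else {}) \<union> (if 2 = 5 - m then {Aff 1} else {})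
        \<union> (if 1 = 5 - m then {Aff t} else {})))"
  proof (rule cf_pair_profile[where \<kappa> = "48 * u" and H = 1])
    fix z
    show "poly (wronskian [:0, 0, 0, 2 * (5 + u), - (15 + u), 6:] [:1 - u, 2 * u:]) z
      = 48 * u * ((z - 0) ^ 2 * (z - 1) ^ 2 * (z - t) ^ 1 * poly 1 z)"
      using t by (simp add: wronskian_def pderiv_pCons) algebra
  qed (use ne cop fix_t \<open>t \<noteq> 0\<close> \<open>t \<noteq> 1\<close> in auto)
  show "cf_pair 5 [:0, 0, 0, 2 * (5 + u), - (15 + u), 6:] [:1 - u, 2 * u:]" using * by blast
  have "fixed_fibre 1 (fu u) = {}" "fixed_fibre 2 (fu u) = {Infty}" "fixed_fibre 3 (fu u) = {Aff 0, Aff 1}"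
    unfolding fu_def using *[THEN conjunct2, rule_format] by (simp_all add: insert_commute)
  then show "fixed_fibre 2 (fu u) = {Infty}" "fixed_fibre 3 (fu u) = {Aff 0, Aff 1}"
    "profile (fu u) = (0, 1, 2)" by (simp_all add: profile_def)
qed

lemma rat_map_smult:
  assumes "\<mu> \<noteq> 0"
  shows "rat_map (smult \<mu> p) (smult \<mu> q) = rat_map p q"
  using assms by (auto simp: fun_eq_iff rat_map_def Let_def split: sphere.splits)

text \<open>The irrationalities of \<open>f7\<close>, \<open>f8\<close> and \<open>f14\<close> come from placing a critical point at \<open>1\<close>.
  Placing a zero or a non-critical fixed point at a rational position gives rational coefficients.\<close>

lemma f7_conj:
  defines "s \<equiv> complex_of_real (sqrt 5)"
  shows "f7 = rat_map [:0, 0, 0, 0, s - 5, 2:] [:7 - 3 * s, - 2 * (5 - 2 * s):]"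
    and "cf_pair 5 [:0, 0, 0, 0, s - 5, 2:] [:7 - 3 * s, - 2 * (5 - 2 * s):]"
    and "moebius_conjugate (rat_map [:0, 0, 0, 0, - 25, 25:] [:1, - 5:]) f7"
proof -
  have s: "s ^ 2 = 5" unfolding s_def by (simp flip: of_real_power)
  have "(5 + s) * (5 - s) = 25 - s ^ 2" "(7 - 3 * s) * (7 + 3 * s) = 49 - 9 * s ^ 2"
    by (simp_all add: power2_eq_square algebra_simps)
  then have ne: "(5 + s) / 10 \<noteq> 0" "7 - 3 * s \<noteq> 0" unfolding s by auto
  show f7: "f7 = rat_map [:0, 0, 0, 0, s - 5, 2:] [:7 - 3 * s, - 2 * (5 - 2 * s):]"
    unfolding f7_def Let_def s_def[symmetric]
    by (intro arg_cong2[where f = rat_map] poly_eqI_pointwise) (simp, algebra?)+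
  \<comment> \<open>A is a root of 1 - 5z + 5z^2, so scaling by it moves a simple critical point of
    the model to 1; \<open>\<mu>\<close> is the constant coefficient of the new denominator.\<close>
  define A \<mu> where "A = (5 + s) / 10" and "\<mu> = 7 - 3 * s"
  have A: "10 * A = 5 + s" and m: "\<mu> = 7 - 3 * s" by (simp_all add: A_def \<mu>_def)
  from ne have ne': "A \<noteq> 0" "\<mu> \<noteq> 0" by (simp_all add: A_def \<mu>_def)
  have P: "smult A [:0, 0, 0, 0, s - 5, 2:]
    = smult \<mu> (pcompose ([:0, 0, 0, 0, - 25, 25:] - smult 0 [:1, - 5:]) [:0, A:])"
    by (rule poly_eqI_pointwise) (use A s m in \<open>simp add: poly_pcompose del: mult_cancel_left mult_cancel_right, algebra\<close>)
  have Q: "[:7 - 3 * s, - 2 * (5 - 2 * s):] = smult \<mu> (pcompose [:1, - 5:] [:0, A:])"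
    by (rule poly_eqI_pointwise) (use A s m in \<open>simp add: poly_pcompose del: mult_cancel_left mult_cancel_right, algebra\<close>)
  from affine_conjugate(1,2)[OF g7_cf(1) ne' P Q] f7
  show "cf_pair 5 [:0, 0, 0, 0, s - 5, 2:] [:7 - 3 * s, - 2 * (5 - 2 * s):]"
    "moebius_conjugate (rat_map [:0, 0, 0, 0, - 25, 25:] [:1, - 5:]) f7" by simp_all
qed

lemma f8_conj:
  defines "s \<equiv> complex_of_real (sqrt 21)"
  shows "f8 = rat_map [:0, 0, 0, 0, - 5 * (3 - s), - 6:] [:3 * (23 - 5 * s), - 10 * (9 - 2 * s):]"
    and "cf_pair 5 [:0, 0, 0, 0, - 5 * (3 - s), - 6:] [:3 * (23 - 5 * s), - 10 * (9 - 2 * s):]"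
    and "moebius_conjugate (rat_map [:0, 0, 0, 0, 625, - 625:] [:9, 75:]) f8"
proof -
  have s: "s ^ 2 = 21" unfolding s_def by (simp flip: of_real_power)
  have "(3 + s) * (3 - s) = 9 - s ^ 2" "(23 - 5 * s) * (23 + 5 * s) = 529 - 25 * s ^ 2"
    by (simp_all add: power2_eq_square algebra_simps)
  then have ne: "(3 + s) / 10 \<noteq> 0" "23 - 5 * s \<noteq> 0" unfolding s by auto
  show f8: "f8 = rat_map [:0, 0, 0, 0, - 5 * (3 - s), - 6:] [:3 * (23 - 5 * s), - 10 * (9 - 2 * s):]"
    unfolding f8_def Let_def s_def[symmetric]
    by (intro arg_cong2[where f = rat_map] poly_eqI_pointwise) (simp, algebra?)+
  \<comment> \<open>Likewise a root of 3 + 15z - 25z^2; here the constant coefficients of the old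
    and new denominators are 9 and 9 \<open>\<mu>\<close>.\<close>
  define A \<mu> where "A = (3 + s) / 10" and "\<mu> = (23 - 5 * s) / 3"
  have A: "10 * A = 3 + s" and m: "3 * \<mu> = 23 - 5 * s" by (simp_all add: A_def \<mu>_def)
  from ne have ne': "A \<noteq> 0" "\<mu> \<noteq> 0" by (simp_all add: A_def \<mu>_def)
  have P: "smult A [:0, 0, 0, 0, - 5 * (3 - s), - 6:]
    = smult \<mu> (pcompose ([:0, 0, 0, 0, 625, - 625:] - smult 0 [:9, 75:]) [:0, A:])"
    by (rule poly_eqI_pointwise) (use A s m in \<open>simp add: poly_pcompose del: mult_cancel_left mult_cancel_right, algebra\<close>)
  have Q: "[:3 * (23 - 5 * s), - 10 * (9 - 2 * s):]
    = smult \<mu> (pcompose [:9, 75:] [:0, A:])"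
    by (rule poly_eqI_pointwise) (use A s m in \<open>simp add: poly_pcompose del: mult_cancel_left mult_cancel_right, algebra\<close>)
  from affine_conjugate(1,2)[OF g8_cf(1) ne' P Q] f8
  show "cf_pair 5 [:0, 0, 0, 0, - 5 * (3 - s), - 6:] [:3 * (23 - 5 * s), - 10 * (9 - 2 * s):]"
    "moebius_conjugate (rat_map [:0, 0, 0, 0, 625, - 625:] [:9, 75:]) f8" by simp_all
qed

lemma f9_eq: "f9 = fu (complex_of_real (sqrt (5 * (4 * sqrt 61 - 31))))"
  unfolding f9_def Let_def fu_def
  by (intro arg_cong2[where f = rat_map] poly_eqI_pointwise) (simp, algebra?)+

lemma f10_eq: "f10 = fu (\<i> * complex_of_real (sqrt (5 * (4 * sqrt 61 + 31))))"
  unfolding f10_def Let_def fu_def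
  by (intro arg_cong2[where f = rat_map] poly_eqI_pointwise) (simp, algebra?)+

lemma rho_root: "8 * rho ^ 3 - 52 * rho ^ 2 + 134 * rho - 15 = 0"
  unfolding rho_def by (rule theI'[OF rho_unique])

text \<open>The roots of this sextic are the six ratios of two distinct roots of 3 + 12z + 8z^2 +
  2z^3, whose roots are the simple critical points of the model in \<open>g14_cf\<close>. Exchanging
  the two roots inverts the ratio, hence the palindromic shape. All later computations with
  \<open>sigma\<close> rest on this equation.\<close>

lemma sigma_min_poly:
  "3 * (sigma\<^sup>2 + 1) ^ 3 - 39 * (sigma\<^sup>2 + 1)\<^sup>2 * sigma + 185 * (sigma\<^sup>2 + 1) * sigma\<^sup>2 - 125 * sigma ^ 3 = 0"
proof -
  \<comment> \<open>The radicand in \<open>sigma\<close> has to be nonnegative for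
    \<open>sqrt\<close> to be a square root of it. It turns negative near 0.1213, while
    \<open>rho\<close> is about 0.117; the bound 3/25 lies between.\<close>
  have rho: "0 < rho" "rho < 3 / 25"
  proof -
    show "0 < rho"
    proof (rule ccontr)
      assume "\<not> 0 < rho"
      then have "8 * rho ^ 3 \<le> 0" "0 \<le> 52 * rho ^ 2" "134 * rho \<le> 0" by (simp_all add: power_le_zero_eq)
      with rho_root show False by linarith
    qed
    show "rho < 3 / 25"
    proof (rule ccontr)
      assume "\<not> rho < 3 / 25"
      \<comment> \<open>Division of the cubic by \<open>rho - 3 / 25\<close>, with the quotient
        completed to a square; the remainder 5391/15625 is the value at 3/25.\<close>
      then have "0 < (rho - 3 / 25) * (8 * (rho - 319 / 100) ^ 2 + 46)
          + 583 / 1250 * (rho - 3 / 25) + 5391 / 15625"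
        by (intro add_nonneg_pos add_nonneg_nonneg) simp_all
      also have "\<dots> = 8 * rho ^ 3 - 52 * rho ^ 2 + 134 * rho - 15"
        by (simp add: power2_eq_square power3_eq_cube field_simps)
      finally show False using rho_root by simp
    qed
  qed
  have "rho ^ 2 \<le> (3 / 25) ^ 2" using rho by (intro power_mono) auto
  then have nonneg: "0 \<le> 1 / 6 - 4 / 3 * rho - 1 / 3 * rho ^ 2" 
    using rho by (simp add: power2_eq_square)
  define r where "r = complex_of_real rho"
  have r: "8 * r ^ 3 - 52 * r ^ 2 + 134 * r - 15 = 0"
    using arg_cong[OF rho_root, of complex_of_real] by (simp add: r_def)
  define y where "y = complex_of_real (sqrt (1 / 6 - 4 / 3 * rho - 1 / 3 * rho ^ 2))"
  have "y ^ 2 = complex_of_real (1 / 6 - 4 / 3 * rho - 1 / 3 * rho ^ 2)"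
    unfolding y_def of_real_power[symmetric] using nonneg by simp
  then have y: "y ^ 2 = 1 / 6 - 4 / 3 * r - 1 / 3 * r ^ 2" by (simp add: r_def)
  have "sigma = r + \<i> * y" by (simp add: sigma_def r_def y_def)
  moreover have "6 * y ^ 2 = 1 - 8 * r - 2 * r ^ 2" unfolding y by simp
  moreover have "\<i> ^ 2 = - 1" by simp
  ultimately have "6 * sigma ^ 2 = 12 * r * sigma - 1 + 8 * r - 4 * r ^ 2" by algebra
  with r show ?thesis by algebra
qed

lemma f14_conj:
  defines "s \<equiv> sigma"
  defines "P \<equiv> [:0, 0, 0, - ((s ^ 2 - 3 * s + 1) * (s ^ 2 + 5 * s + 1)),
    2 * (s + 1) * (s ^ 2 - 5 * s + 1), - (s ^ 2 - 7 * s + 1):]"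
    and "Q \<equiv> [:2 * s ^ 2 * (s ^ 2 - s + 1), - (s * (s + 1) * (3 * s ^ 2 - 5 * s + 3)):]"
  shows "f14 = rat_map P Q" and "cf_pair 5 P Q"
    and "moebius_conjugate (rat_map [:0, 0, 0, - 20, - 10, - 2:] [:3, 15:]) f14"
proof -
  define q where "q = s ^ 2 - s + 1"
  define N where "N = - ((s + 1) * (3 * s ^ 2 - 5 * s + 3))"
  have M: "3 * (s ^ 2 + 1) ^ 3 - 39 * (s ^ 2 + 1) ^ 2 * s + 185 * (s ^ 2 + 1) * s ^ 2 - 125 * s ^ 3 = 0"
    using sigma_min_poly unfolding s_def .
  have "s \<noteq> 0" using M by auto
  have "q \<noteq> 0"
  proof
    assume "q = 0"
    with M have "24 * s ^ 3 = 0" unfolding q_def by algebra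
    with \<open>s \<noteq> 0\<close> show False by simp
  qed
  have "s + 1 \<noteq> 0"
  proof
    assume "s + 1 = 0"
    with M have "(675 :: complex) = 0" by algebra
    then show False by simp
  qed
  have "3 * s ^ 2 - 5 * s + 3 \<noteq> 0"
  proof
    assume "3 * s ^ 2 - 5 * s + 3 = 0"
    with M have "800 * s ^ 3 = 0" by algebra
    with \<open>s \<noteq> 0\<close> show False by simp
  qed
  with \<open>s + 1 \<noteq> 0\<close> have "N \<noteq> 0" unfolding N_def by (simp del: minus_mult_left)
  \<comment> \<open>Scaling by l takes the critical points 1 and s of \<open>f14\<close> to the
    roots l and l s of the cubic in \<open>g14_cf\<close>. Eliminating higher powers of l from the
    two root conditions leaves a linear equation for l, and the relation 15 q u = 2 N^2 below turns
    its solution into this form.\<close>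
  define l where "l = N / (10 * s * q)"
  define \<mu> where "\<mu> = 2 / 3 * s ^ 2 * q"
  have l0: "l \<noteq> 0" and m0: "\<mu> \<noteq> 0"
    using \<open>N \<noteq> 0\<close> \<open>s \<noteq> 0\<close> \<open>q \<noteq> 0\<close> by (simp_all add: l_def \<mu>_def)
  have l: "l * (10 * s * q) = N" using \<open>s \<noteq> 0\<close> \<open>q \<noteq> 0\<close> by (simp add: l_def)
  have mu: "3 * \<mu> = 2 * s ^ 2 * q" by (simp add: \<mu>_def)
  define u v w where "u = (s ^ 2 - 3 * s + 1) * (s ^ 2 + 5 * s + 1)"
    and "v = - 2 * (s + 1) * (s ^ 2 - 5 * s + 1)" and "w = s ^ 2 - 7 * s + 1"
  \<comment> \<open>The three identities modulo the sextic give u : v : w = 20 : 10 l : 2 l^2, the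
    proportions in the rescaled model.\<close>
  have "15 * q * u = 2 * N ^ 2" using M unfolding q_def u_def N_def by algebra
  then have "q * (15 * (u - 20 * \<mu> * l ^ 2)) = 0" using l mu by algebra
  with \<open>q \<noteq> 0\<close> have u: "u = 20 * \<mu> * l ^ 2" by simp
  have "20 * s * q * v = u * N" using M unfolding q_def u_def v_def N_def by algebra
  then have "(s * q) * (20 * (v - 10 * \<mu> * l ^ 3)) = 0" using l u by algebra
  with \<open>s \<noteq> 0\<close> \<open>q \<noteq> 0\<close> have v: "v = 10 * \<mu> * l ^ 3" by simp
  have "50 * s * q * w = v * N" using M unfolding q_def w_def v_def N_def by algebra
  then have "(s * q) * (50 * (w - 2 * \<mu> * l ^ 4)) = 0" using l v by algebra
  with \<open>s \<noteq> 0\<close> \<open>q \<noteq> 0\<close> have w: "w = 2 * \<mu> * l ^ 4" by simp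
  have sN: "- (s * (s + 1) * (3 * s ^ 2 - 5 * s + 3)) = 15 * \<mu> * l"
    using l mu unfolding N_def by algebra
  have P': "P = [:0, 0, 0, - u, - v, - w:]" by (simp add: P_def u_def v_def w_def flip: mult_minus_left)
  have Q': "Q = [:3 * \<mu>, 15 * \<mu> * l:]" unfolding Q_def sN mu by (simp add: q_def)
  show f14: "f14 = rat_map P Q"
    unfolding f14_def Let_def s_def[symmetric] P_def Q_def
    by (intro arg_cong2[where f = rat_map] poly_eqI_pointwise) (simp, algebra?)+
  have P: "smult l P
    = smult \<mu> (pcompose ([:0, 0, 0, - 20, - 10, - 2:] - smult 0 [:3, 15:]) [:0, l:])"
    unfolding P' u v w by (rule poly_eqI_pointwise) (simp add: poly_pcompose, algebra)
  have Q: "Q = smult \<mu> (pcompose [:3, 15:] [:0, l:])"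
    unfolding Q' by (rule poly_eqI_pointwise) (simp add: poly_pcompose, algebra)
  from affine_conjugate(1,2)[OF g14_cf(1) l0 m0 P Q] f14
  show "cf_pair 5 P Q"
    "moebius_conjugate (rat_map [:0, 0, 0, - 20, - 10, - 2:] [:3, 15:]) f14" by simp_all
qed

section \<open>Non-conjugate pairs with equal fibre profile\<close>

lemma moebius_fixing_Infty:
  assumes "moebius \<phi>" "\<phi> Infty = Infty"
  obtains \<alpha> \<beta> where "\<alpha> \<noteq> 0" "\<And>z. \<phi> (Aff z) = Aff (\<alpha> * z + \<beta>)"
proof -
  from assms(1) obtain a b c d where 1: "a * d - b * c \<noteq> 0" and \<phi>: "\<phi> = rat_map [:b, a:] [:d, c:]"
    unfolding moebius_def by blast
  have "\<phi> Infty = proj a c" using rat_map_linear_proj[OF 1, of 1 0] by (simp add: \<phi> proj_def)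
  with assms(2) have "c = 0" by (simp add: proj_def split: if_splits)
  with 1 have "a / d \<noteq> 0" "\<phi> (Aff z) = Aff (a / d * z + b / d)" for z
    by (auto simp: \<phi> rat_map_def field_simps)
  then show ?thesis using that by blast
qed

lemma moebius_swapping_0_Infty:
  assumes "moebius \<phi>" "\<phi> Infty = Aff 0" "\<phi> (Aff 0) = Infty"
  obtains \<alpha> where "\<alpha> \<noteq> 0" "\<And>z. z \<noteq> 0 \<Longrightarrow> \<phi> (Aff z) = Aff (\<alpha> / z)"
proof -
  from assms(1) obtain a b c d where 1: "a * d - b * c \<noteq> 0" and \<phi>: "\<phi> = rat_map [:b, a:] [:d, c:]"
    unfolding moebius_def by blast
  have "\<phi> Infty = proj a c" using rat_map_linear_proj[OF 1, of 1 0] by (simp add: \<phi> proj_def)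
  with assms(2) have "a = 0" by (simp add: proj_def split: if_splits)
  moreover have "d = 0" using assms(3) by (simp add: \<phi> rat_map_def split: if_splits)
  ultimately have "b / c \<noteq> 0" "z \<noteq> 0 \<Longrightarrow> \<phi> (Aff z) = Aff (b / c / z)" for z
    using 1 by (auto simp: \<phi> rat_map_def)
  then show ?thesis using that by blast
qed

text \<open>Infinity and 0 are singled out by their fibres, so only z \<mapsto> \<alpha> z is
  possible. Such a scaling preserves oddness; \<open>f5\<close> is odd and fixes 1 and - 1, whereas
  \<open>f6\<close> has a term in z^4, which the difference of the two equations isolates.\<close>

lemma not_conjugate_f5_f6: "\<not> moebius_conjugate f5 f6"
proof
  assume "moebius_conjugate f5 f6"
  then obtain \<phi> where \<phi>: "moebius \<phi>" "bij \<phi>" "\<And>s. \<phi> (f5 s) = f6 (\<phi> s)"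
    by (rule moebius_conjugateE) blast
  note img = fixed_fibre_conjugate[of \<phi> f5 f6, OF \<phi>(2,3)]
  have "\<phi> Infty = Infty" using img[of 1] unfolding f5_cf f6_cf by simp
  then obtain \<alpha> \<beta> where ab: "\<alpha> \<noteq> 0" "\<And>z. \<phi> (Aff z) = Aff (\<alpha> * z + \<beta>)"
    by (rule moebius_fixing_Infty[OF \<phi>(1)]) blast
  have "\<beta> = 0" using img[of 3] by (simp add: f5_cf f6_cf ab)
  have "\<alpha> * (\<alpha> * (220 + \<alpha> * (\<alpha> * 36 - 165))) = 121"
    using \<phi>(3)[of "Aff 1"] \<open>\<beta> = 0\<close> ab(1) by (simp add: ab(2) f5_eq f6_eq rat_map_def)
  moreover have "\<alpha> * (\<alpha> * (\<alpha> * (220 + \<alpha> * (\<alpha> * 36 + 165)))) = \<alpha> * 121"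
    using \<phi>(3)[of "Aff (- 1)"] \<open>\<beta> = 0\<close> ab(1) by (simp add: ab(2) f5_eq f6_eq rat_map_def algebra_simps)
  moreover have "330 * \<alpha> ^ 4 = \<alpha> * (\<alpha> * (\<alpha> * (220 + \<alpha> * (\<alpha> * 36 + 165))))
      - \<alpha> * (\<alpha> * (\<alpha> * (220 + \<alpha> * (\<alpha> * 36 - 165))))" by algebra
  ultimately have "330 * \<alpha> ^ 4 = 0" by (simp only: diff_self)
  with ab show False by simp
qed

text \<open>For the rational models the fibres leave scalings and maps \<alpha> / z. Both preserve
  the quotient of the simple zero by the finite pole, which is 5 for one model and - 25/3 for the
  other.\<close>

lemma not_conjugate_f7_f8: "\<not> moebius_conjugate f7 f8"
proof
  let ?g7 = "rat_map [:0, 0, 0, 0, - 25, 25:] [:1, - 5:]"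
  let ?g8 = "rat_map [:0, 0, 0, 0, 625, - 625:] [:9, 75:]"
  assume "moebius_conjugate f7 f8"
  then have "moebius_conjugate ?g7 ?g8"
    by (rule moebius_conjugate_trans[OF moebius_conjugate_trans[OF f7_conj(3)]
        moebius_conjugate_sym[OF f8_conj(3)]])
  then obtain \<phi> where \<phi>: "moebius \<phi>" "bij \<phi>" "\<And>s. \<phi> (?g7 s) = ?g8 (\<phi> s)"
    by (rule moebius_conjugateE) blast
  have "\<phi> ` {Infty, Aff 0} = {Infty, Aff 0}"
    using fixed_fibre_conjugate[of \<phi> ?g7 ?g8 2, OF \<phi>(2,3)] by (simp add: g7_cf g8_cf)
  then consider "\<phi> Infty = Infty" "\<phi> (Aff 0) = Aff 0" | "\<phi> Infty = Aff 0" "\<phi> (Aff 0) = Infty"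
    by (auto simp: doubleton_eq_iff)
  moreover have 1: "?g7 (Aff 1) = Aff 0" "?g7 (Aff (1 / 5)) = Infty"
    by (simp_all add: rat_map_def)
  ultimately show False
  proof cases
    case 1
    from \<phi>(1) 1(1) obtain \<alpha> \<beta> where ab: "\<alpha> \<noteq> 0" "\<And>z. \<phi> (Aff z) = Aff (\<alpha> * z + \<beta>)"
      by (rule moebius_fixing_Infty) blast
    from 1 ab have b: "\<beta> = 0" by simp
    have "?g8 (Aff \<alpha>) = Aff 0" "?g8 (Aff (\<alpha> / 5)) = Infty"
      using \<phi>(3)[of "Aff 1"] \<phi>(3)[of "Aff (1 / 5)"] \<open>?g7 (Aff 1) = Aff 0\<close> \<open>?g7 (Aff (1 / 5)) = Infty\<close> 1
      by (simp_all only: ab b mult_1_right add_0_right times_divide_eq_right)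
    then have "\<alpha> = 1" "9 + 15 * \<alpha> = 0"
      using ab(1) by (auto simp: rat_map_def split: if_splits)
    then show False by simp
  next
    case 2
    from \<phi>(1) 2 obtain \<alpha> where ab: "\<alpha> \<noteq> 0" "\<And>z. z \<noteq> 0 \<Longrightarrow> \<phi> (Aff z) = Aff (\<alpha> / z)"
      by (rule moebius_swapping_0_Infty) blast
    have "\<phi> (Aff 1) = Aff \<alpha>" "\<phi> (Aff (1 / 5)) = Aff (5 * \<alpha>)" using ab(2)[of 1] ab(2)[of "1 / 5"] by simp_all
    then have "?g8 (Aff \<alpha>) = Infty" "?g8 (Aff (5 * \<alpha>)) = Aff 0"
      using \<phi>(3)[of "Aff 1"] \<phi>(3)[of "Aff (1 / 5)"] \<open>?g7 (Aff 1) = Aff 0\<close> \<open>?g7 (Aff (1 / 5)) = Infty\<close> 2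
      by (simp_all only:)
    then have "9 + 75 * \<alpha> = 0" "\<alpha> = 1 / 5"
      using ab(1) by (auto simp: rat_map_def field_simps split: if_splits)
    then show False by simp
  qed
qed

text \<open>The fibres leave only the identity and z \<mapsto> 1 - z. The finite pole 1/2 - 1/(2u)
  is then kept or reflected at 1/2, which gives v = u or v = - u.\<close>

lemma fu_conjugate_imp:
  assumes u: "u ^ 4 + 310 * u ^ 2 - 375 = 0" and v: "v ^ 4 + 310 * v ^ 2 - 375 = 0"
    and "moebius_conjugate (fu u) (fu v)"
  shows "v ^ 2 = u ^ 2"
proof -
  from assms(3) obtain \<phi> where \<phi>: "moebius \<phi>" "bij \<phi>" "\<And>s. \<phi> (fu u s) = fu v (\<phi> s)"
    by (rule moebius_conjugateE) blast
  note img = fixed_fibre_conjugate[of \<phi> "fu u" "fu v", OF \<phi>(2,3)]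
  have inf: "\<phi> Infty = Infty" using img[of 2] by (simp add: fu_cf u v)
  then obtain \<alpha> \<beta> where ab: "\<alpha> \<noteq> 0" "\<And>z. \<phi> (Aff z) = Aff (\<alpha> * z + \<beta>)"
    by (rule moebius_fixing_Infty[OF \<phi>(1)]) blast
  have "\<phi> ` {Aff 0, Aff 1} = {Aff 0, Aff 1}" using img[of 3] by (simp add: fu_cf u v)
  then have ab': "\<alpha> = 1 \<and> \<beta> = 0 \<or> \<alpha> = - 1 \<and> \<beta> = 1"
    by (auto simp: ab doubleton_eq_iff add_eq_0_iff2)
  have "u \<noteq> 0" "v \<noteq> 0" using u v by auto
  define z where "z = (u - 1) / (2 * u)"
  have z: "2 * u * z = u - 1" using \<open>u \<noteq> 0\<close> by (simp add: z_def)
  have "fu u (Aff z) = Infty" using \<open>u \<noteq> 0\<close> by (simp add: fu_def rat_map_def z_def)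
  then have "fu v (Aff (\<alpha> * z + \<beta>)) = Infty"
    using \<phi>(3)[of "Aff z"] inf by (simp add: ab)
  then have "1 - v + (\<alpha> * z + \<beta>) * (2 * v) = 0"
    unfolding fu_def rat_map_Aff_eq_Infty by simp
  with ab' z show ?thesis by (elim disjE conjE) (simp, algebra)+
qed

text \<open>As a quadratic in u^2 the equation reads (u^2 + 155)^2 = 400 * 61.\<close>

lemma fu_quartic:
  fixes x :: real
  assumes "x = 5 * (4 * sqrt 61 - 31) \<or> x = - 5 * (4 * sqrt 61 + 31)" "u ^ 2 = complex_of_real x"
  shows "u ^ 4 + 310 * u ^ 2 - 375 = 0"
proof -
  have "(x + 155) ^ 2 = (20 * sqrt 61) ^ 2"
    unfolding power2_eq_iff using assms(1) by auto
  then have "x ^ 2 + 310 * x - 375 = 0"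
    by (simp add: power_mult_distrib) (simp add: power2_eq_square algebra_simps)
  then have "complex_of_real (x ^ 2 + 310 * x - 375) = 0" by (simp only: of_real_0)
  moreover have "u ^ 4 = complex_of_real x ^ 2" unfolding assms(2)[symmetric] by simp
  ultimately show ?thesis using assms(2) by simp
qed

lemma fu_parameters:
  defines "a \<equiv> complex_of_real (sqrt (5 * (4 * sqrt 61 - 31)))"
    and "b \<equiv> \<i> * complex_of_real (sqrt (5 * (4 * sqrt 61 + 31)))"
  shows "a ^ 2 = complex_of_real (5 * (4 * sqrt 61 - 31))"
    and "b ^ 2 = complex_of_real (- 5 * (4 * sqrt 61 + 31))"
    and "a ^ 4 + 310 * a ^ 2 - 375 = 0" and "b ^ 4 + 310 * b ^ 2 - 375 = 0"
proof -
  \<comment> \<open>Since (31/4)^2 = 961/16 is below 61, the radicand is nonnegative, as needed for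
    squaring the real \<open>sqrt\<close>.\<close>
  have "31 / 4 \<le> sqrt (61 :: real)" by (rule real_le_rsqrt) (simp add: power2_eq_square)
  then show a: "a ^ 2 = complex_of_real (5 * (4 * sqrt 61 - 31))"
    unfolding a_def of_real_power[symmetric] by simp
  have "0 \<le> 5 * (4 * sqrt 61 + 31)" by simp
  then show b: "b ^ 2 = complex_of_real (- 5 * (4 * sqrt 61 + 31))"
    unfolding b_def power_mult_distrib of_real_power[symmetric] by simp
  show "a ^ 4 + 310 * a ^ 2 - 375 = 0" by (rule fu_quartic[OF _ a]) simp
  show "b ^ 4 + 310 * b ^ 2 - 375 = 0" by (rule fu_quartic[OF _ b]) simp
qed

lemma not_conjugate_f9_f10: "\<not> moebius_conjugate f9 f10"
proof
  assume "moebius_conjugate f9 f10"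
  then have "complex_of_real (- 5 * (4 * sqrt 61 + 31)) = complex_of_real (5 * (4 * sqrt 61 - 31))"
    using fu_conjugate_imp[OF fu_parameters(3,4)] unfolding f9_eq f10_eq fu_parameters(1,2) by simp
  then have "- 5 * (4 * sqrt 61 + 31) = 5 * (4 * sqrt 61 - 31)" by (simp only: of_real_eq_iff)
  then show False by simp
qed

section \<open>Normal forms\<close>

text \<open>Needed because the simplifier distributes a numeral over a sum instead of cancelling it.\<close>

lemma numeral_mult_eq_0D: "numeral w * x = 0 \<Longrightarrow> x = 0" for x :: complex
  by simp

text \<open>The leading terms of the two products combine to n - d times the product of the leading
  coefficients, with n and d the degrees of p and q. This is nonzero because d < n.\<close>

lemma degree_wronskian:
  fixes p q :: "complex poly"
  assumes "degree q < degree p" "q \<noteq> 0"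
  shows "degree (wronskian p q) = degree p + degree q - 1" "wronskian p q \<noteq> 0"
proof -
  let ?n = "degree p" and ?d = "degree q"
  have p0: "p \<noteq> 0" using assms by auto
  have "degree (pderiv p * q) \<le> ?n + ?d - 1"
    by (rule order_trans[OF degree_mult_le]) (use assms in \<open>auto simp: degree_pderiv\<close>)
  moreover have "degree (p * pderiv q) \<le> ?n + ?d - 1"
  proof (cases "?d = 0")
    case True
    then have "pderiv q = 0" by (simp add: pderiv_eq_0_iff)
    then show ?thesis by simp
  qed (rule order_trans[OF degree_mult_le], auto simp: degree_pderiv)
  ultimately have le: "degree (wronskian p q) \<le> ?n + ?d - 1"
    unfolding wronskian_def by (rule degree_diff_le)
  have 1: "coeff (pderiv p * q) (?n + ?d - 1) = of_nat ?n * lead_coeff p * lead_coeff q"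
    using coeff_mult_degree_sum[of "pderiv p" q] assms by (simp add: degree_pderiv coeff_pderiv)
  have 2: "coeff (p * pderiv q) (?n + ?d - 1) = of_nat ?d * lead_coeff p * lead_coeff q"
  proof (cases "?d = 0")
    case True
    then have "pderiv q = 0" by (simp add: pderiv_eq_0_iff)
    then show ?thesis using True by simp
  next
    case False
    then show ?thesis
      using coeff_mult_degree_sum[of p "pderiv q"] by (simp add: degree_pderiv coeff_pderiv)
  qed
  have "coeff (wronskian p q) (?n + ?d - 1)
      = (of_nat ?n - of_nat ?d) * lead_coeff p * lead_coeff q"
    unfolding wronskian_def coeff_diff 1 2 by (simp add: algebra_simps)
  also have "\<dots> \<noteq> 0" using assms p0 by simp
  finally have nz: "coeff (wronskian p q) (?n + ?d - 1) \<noteq> 0" .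
  then show "degree (wronskian p q) = ?n + ?d - 1" using le le_degree by (meson antisym)
  show "wronskian p q \<noteq> 0" using nz by auto
qed

lemma sum_order_eq_degree:
  fixes p :: "complex poly"
  assumes "p \<noteq> 0"
  shows "(\<Sum>z | poly p z = 0. order z p) = degree p"
proof -
  have "degree p = sum (count (proots p)) (set_mset (proots p))"
    unfolding size_proots_complex[symmetric] by (rule size_multiset_overloaded_eq)
  then show ?thesis using assms by simp
qed

text \<open>With \<open>p = F + z q\<close> the Wronskian becomes \<open>q (q + F') - F q'\<close>, so that \<open>q + F'\<close> vanishes at
  every critical point. Its degree \<open>n - 1\<close> bounds their number.\<close>

lemma cf_pair_card_roots:
  assumes "cf_pair n p q" "degree q + 2 \<le> n"
  defines "F \<equiv> p - [:0, 1:] * q"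
  shows "card {z. poly (wronskian p q) z = 0} < n"
    and "\<And>z. poly (wronskian p q) z = 0 \<Longrightarrow> poly F z = 0 \<and> poly (q + pderiv F) z = 0"
    and "degree F = n" and "degree (q + pderiv F) = n - 1"
    and "coeff (q + pderiv F) (n - 1) = of_nat n * coeff F n"
proof -
  have cop: "coprime p q" and deg: "degree p = n"
    and fix': "\<And>z. poly (wronskian p q) z = 0 \<Longrightarrow> poly p z = z * poly q z"
    using assms by (auto simp: cf_pair_def)
  show root: "poly F z = 0 \<and> poly (q + pderiv F) z = 0" if z: "poly (wronskian p q) z = 0" for z
  proof
    show F: "poly F z = 0" using fix'[OF z] by (simp add: F_def)
    have qz: "poly q z \<noteq> 0" using coprime_poly_0[OF cop, of z] fix'[OF z] by auto
    have "wronskian p q = q * (q + pderiv F) - F * pderiv q"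
      by (simp add: wronskian_def F_def pderiv_diff pderiv_mult pderiv_pCons algebra_simps)
    with z F qz show "poly (q + pderiv F) z = 0" by simp
  qed
  have "degree ([:0, 1:] * q) < n"
    using assms(2) degree_mult_le[of "[:0, 1:]" q] by simp
  then show dF: "degree F = n"
    using degree_add_eq_left[of "- ([:0, 1:] * q)" p] deg unfolding F_def by (simp only: degree_minus add_uminus_conv_diff)
  have "degree q < degree (pderiv F)" using assms(2) dF by (simp add: degree_pderiv)
  then show dq: "degree (q + pderiv F) = n - 1"
    by (simp add: degree_add_eq_right degree_pderiv dF)
  show "coeff (q + pderiv F) (n - 1) = of_nat n * coeff F n"
    using assms(2) by (simp add: coeff_eq_0 coeff_pderiv)
  have nz: "q + pderiv F \<noteq> 0"
    using dF assms(2) \<open>coeff (q + pderiv F) (n - 1) = _\<close>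
    by (metis coeff_0 leading_coeff_0_iff mult_eq_0_iff of_nat_eq_0_iff degree_0
        le_zero_eq add_is_0 zero_neq_numeral)
  have "card {z. poly (wronskian p q) z = 0} \<le> card {z. poly (q + pderiv F) z = 0}"
    using root nz by (intro card_mono poly_roots_finite) auto
  also have "\<dots> \<le> n - 1" using card_poly_roots_bound[OF nz] dq by simp
  finally show "card {z. poly (wronskian p q) z = 0} < n" using assms(2) by linarith
qed

lemma numeral_mult_cancelD: "numeral w * x = numeral w * y \<Longrightarrow> x = y" for x y :: complex
  by simp

text \<open>The remainder of F modulo C vanishes on R as well, and a nonzero polynomial of degree
  below \<open>card R\<close> cannot do so.\<close>

lemma poly_dvd_if_vanishes:
  fixes C F :: "complex poly"
  assumes "\<And>z. z \<in> R \<Longrightarrow> poly C z = 0 \<and> poly F z = 0" "degree C \<le> card R" "C \<noteq> 0" "finite R"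
  shows "C dvd F"
proof (rule ccontr)
  assume nd: "\<not> C dvd F"
  then have nz: "F mod C \<noteq> 0" by (simp add: dvd_eq_mod_eq_0)
  have "degree C \<noteq> 0" using nd \<open>C \<noteq> 0\<close> is_unit_iff_degree unit_imp_dvd by blast
  have "poly (F mod C) z = 0" if "z \<in> R" for z
    using assms(1)[OF that] div_mult_mod_eq[of F C] by (metis add_0_left mult_zero_right poly_add poly_mult)
  then have "card R \<le> card {z. poly (F mod C) z = 0}"
    using nz by (intro card_mono poly_roots_finite) auto
  also have "\<dots> \<le> degree (F mod C)" by (rule card_poly_roots_bound[OF nz])
  also have "\<dots> < degree C" using nz by (rule degree_mod_less'[OF \<open>C \<noteq> 0\<close>])
  finally show False using assms(2) by simp
qed

lemma degree_5_cases:
  fixes p :: "complex poly"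
  assumes "degree p = 5"
  obtains p0 p1 p2 p3 p4 p5 where "p = [:p0, p1, p2, p3, p4, p5:]" "p5 \<noteq> 0"
proof -
  have "p \<noteq> 0" using assms by auto
  then have "length (coeffs p) = 6" using assms by (simp add: length_coeffs_degree)
  then obtain p0 p1 p2 p3 p4 p5 where c: "coeffs p = [p0, p1, p2, p3, p4, p5]"
    by (auto simp: eval_nat_numeral length_Suc_conv)
  have "p = Poly (coeffs p)" by simp
  then have "p = [:p0, p1, p2, p3, p4, p5:]" by (simp add: c)
  moreover have "p5 \<noteq> 0" using last_coeffs_eq_coeff_degree[OF \<open>p \<noteq> 0\<close>] \<open>p \<noteq> 0\<close>
    by (simp add: c)
  ultimately show ?thesis by (rule that)
qed

lemma degree_1_cases:
  fixes q :: "complex poly"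
  assumes "degree q = 1"
  obtains q0 q1 where "q = [:q0, q1:]" "q1 \<noteq> 0"
proof -
  have "q \<noteq> 0" using assms by auto
  then have "length (coeffs q) = 2" using assms by (simp add: length_coeffs_degree)
  then obtain q0 q1 where c: "coeffs q = [q0, q1]"
    by (auto simp: eval_nat_numeral length_Suc_conv)
  have "q = Poly (coeffs q)" by simp
  then have "q = [:q0, q1:]" by (simp add: c)
  moreover have "q1 \<noteq> 0" using last_coeffs_eq_coeff_degree[OF \<open>q \<noteq> 0\<close>] \<open>q \<noteq> 0\<close>
    by (simp add: c)
  ultimately show ?thesis by (rule that)
qed

lemma degree_2_cases:
  fixes q :: "complex poly"
  assumes "degree q = 2"
  obtains q0 q1 q2 where "q = [:q0, q1, q2:]" "q2 \<noteq> 0"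
proof -
  have "q \<noteq> 0" using assms by auto
  then have "length (coeffs q) = 3" using assms by (simp add: length_coeffs_degree)
  then obtain q0 q1 q2 where c: "coeffs q = [q0, q1, q2]"
    by (auto simp: eval_nat_numeral length_Suc_conv)
  have "q = Poly (coeffs q)" by simp
  then have "q = [:q0, q1, q2:]" by (simp add: c)
  moreover have "q2 \<noteq> 0" using last_coeffs_eq_coeff_degree[OF \<open>q \<noteq> 0\<close>] \<open>q \<noteq> 0\<close>
    by (simp add: c)
  ultimately show ?thesis by (rule that)
qed

lemma coprime_one_poly: "coprime p [:1:]" for p :: "complex poly"
  by (simp flip: one_pCons)

text \<open>With infinity held in place, affine maps are the remaining freedom: two critical points
  go to 0 and 1, the third to a ratio of differences, and \<open>\<mu>\<close> makes the denominator
  monic. With k = 0 the same statement serves two critical points.\<close>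

lemma normalise_two_points:
  assumes cf: "cf_pair n p q" and "a \<noteq> b"
    and W: "wronskian p q = smult \<kappa> ([:- a, 1:] ^ i * [:- b, 1:] ^ j * [:- c, 1:] ^ k)" and "\<kappa> \<noteq> 0"
  obtains P Q \<kappa>' where "moebius_conjugate (rat_map p q) (rat_map P Q)" "cf_pair n P Q"
    "degree Q = degree q" "lead_coeff Q = 1" "\<kappa>' \<noteq> 0"
    "wronskian P Q = smult \<kappa>' ([:0, 1:] ^ i * [:- 1, 1:] ^ j * [:- ((c - a) / (b - a)), 1:] ^ k)"
proof -
  define A where "A = b - a"
  have A: "A \<noteq> 0" using \<open>a \<noteq> b\<close> by (simp add: A_def)
  define \<mu> where "\<mu> = 1 / lead_coeff (pcompose q [:a, A:])"
  have "q \<noteq> 0" using cf by (rule cf_pair_nonzero)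
  then have lc: "lead_coeff (pcompose q [:a, A:]) \<noteq> 0" using A by (simp add: pcompose_eq_0_iff)
  then have m: "\<mu> \<noteq> 0" by (simp add: \<mu>_def)
  define P Q where "P = smult (\<mu> / A) (pcompose (p - smult a q) [:a, A:])"
    and "Q = smult \<mu> (pcompose q [:a, A:])"
  have P: "smult A P = smult \<mu> (pcompose (p - smult a q) [:a, A:])"
    using A by (simp add: P_def)
  note aff = affine_conjugate[OF cf A m P Q_def]
  have lQ: "lead_coeff Q = 1" using lc unfolding Q_def lead_coeff_smult by (simp add: \<mu>_def)
  have e: "a + x * A - a = A * x" "a + x * A - b = A * (x - 1)" "a + x * A - c = A * (x - (c - a) / A)" for x
    using A by (simp_all add: A_def field_simps)
  have WPQ: "wronskian P Q = smult (\<mu> ^ 2 * \<kappa> * A ^ (i + j + k))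
      ([:0, 1:] ^ i * [:- 1, 1:] ^ j * [:- ((c - a) / (b - a)), 1:] ^ k)"
    unfolding A_def[symmetric]
    by (rule poly_eqI_pointwise)
       (simp add: aff(4) W poly_pcompose e power_mult_distrib power_add)
  show ?thesis
    by (rule that[OF aff(1,2,3) lQ _ WPQ]) (use A m \<open>\<kappa> \<noteq> 0\<close> in simp)
qed

lemma cf_pair_at_root:
  assumes "cf_pair n p q" "poly (wronskian p q) z = 0"
  shows "poly p z = z * poly q z" "poly q z \<noteq> 0"
proof -
  show "poly p z = z * poly q z" using assms by (simp add: cf_pair_def)
  moreover have "coprime p q" using assms by (simp add: cf_pair_def)
  ultimately show "poly q z \<noteq> 0" using coprime_poly_0[of p q z] by auto
qed

text \<open>A double zero of the Wronskian at z means that p - z q, with the number z kept fixed,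
  vanishes to third order there. The two equations are its first and second derivatives.\<close>

lemma cf_pair_at_double_root:
  assumes "cf_pair n p q" "[:- z, 1:] ^ 2 dvd wronskian p q"
  shows "poly (pderiv p) z = z * poly (pderiv q) z"
    and "poly (pderiv (pderiv p)) z = z * poly (pderiv (pderiv q)) z"
proof -
  obtain r where r: "wronskian p q = [:- z, 1:] ^ 2 * r" using assms(2) by (elim dvdE)
  have "poly (wronskian p q) z = 0" by (simp add: r)
  note root = cf_pair_at_root[OF assms(1) this]
  have "poly (pderiv p * q - p * pderiv q) z = 0" using r by (simp add: wronskian_def)
  with root show 1: "poly (pderiv p) z = z * poly (pderiv q) z" by simp
  define l where "l = [:- z, 1:]"
  have "poly l z = 0" by (simp add: l_def)
  then have "poly (pderiv (wronskian p q)) z = 0"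
    unfolding r l_def[symmetric] by (simp add: pderiv_mult power2_eq_square)
  then have "poly (pderiv (pderiv p)) z * poly q z - poly p z * poly (pderiv (pderiv q)) z = 0"
    by (simp add: wronskian_def pderiv_diff pderiv_mult mult.commute)
  with root show "poly (pderiv (pderiv p)) z = z * poly (pderiv (pderiv q)) z" by simp
qed

section \<open>Constant denominators\<close>

lemma classify_const_4:
  assumes cf: "cf_pair 5 p q" and "degree q = 0" and W: "wronskian p q = smult \<kappa> ([:- a, 1:] ^ 4)"
  shows "moebius_conjugate (rat_map p q) f1"
proof -
  define P Q where "P = pcompose (p - smult a q) [:a, 1:]" and "Q = pcompose q [:a, 1:]"
  have P: "smult 1 P = smult 1 (pcompose (p - smult a q) [:a, 1:])" and Q: "Q = smult 1 (pcompose q [:a, 1:])"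
    by (simp_all add: P_def Q_def)
  note aff = affine_conjugate[OF cf one_neq_zero one_neq_zero P Q]
  have WPQ: "wronskian P Q = smult \<kappa> ([:0, 1:] ^ 4)"
    by (rule poly_eqI_pointwise) (simp add: aff(4) W poly_pcompose)
  have "degree P = 5" using aff(2) by (simp add: cf_pair_def)
  then obtain p0 p1 p2 p3 p4 p5 where p: "P = [:p0, p1, p2, p3, p4, p5:]" "p5 \<noteq> 0"
    by (rule degree_5_cases)
  obtain q0 where q: "Q = [:q0:]" using aff(3) assms(2) by (metis degree_eq_zeroE)
  note root = cf_pair_at_root[OF aff(2), of 0, unfolded WPQ]
  have "p0 = 0" "q0 \<noteq> 0" using root by (simp_all add: p q)
  from WPQ have "p1 = 0 \<and> p2 = 0 \<and> p3 = 0 \<and> p4 = 0"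
    unfolding p q wronskian_def using \<open>q0 \<noteq> 0\<close> by (simp add: pderiv_pCons eval_nat_numeral)
  then have p': "P = [:0, 0, 0, 0, 0, p5:]" using \<open>p0 = 0\<close> p by simp
  \<comment> \<open>Scaling by A turns p5 z^5 / q0 into p5 A^4 z^5 / q0.\<close>
  obtain A where A: "A ^ 4 = q0 / p5"
    using nth_root_exists[of 4] by auto
  then have A4: "p5 * A ^ 4 = q0" and A0: "A \<noteq> 0" using p(2) \<open>q0 \<noteq> 0\<close> by (auto simp: field_simps)
  define \<mu> where "\<mu> = 1 / q0"
  have m: "\<mu> \<noteq> 0" "\<mu> * q0 = 1" using \<open>q0 \<noteq> 0\<close> by (simp_all add: \<mu>_def)
  have "smult A [:0, 0, 0, 0, 0, 1:] = smult \<mu> (pcompose (P - smult 0 Q) [:0, A:])"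
    unfolding p' using m(2) A4
    by (intro poly_eqI_pointwise) (simp add: poly_pcompose del: mult_cancel_left mult_cancel_right, algebra)
  moreover have "[:1:] = smult \<mu> (pcompose Q [:0, A:])"
    unfolding q using m by simp
  ultimately have "moebius_conjugate (rat_map P Q) f1"
    unfolding f1_eq by (rule affine_conjugate(1)[OF aff(2) A0 m(1)])
  with aff(1) show ?thesis by (rule moebius_conjugate_trans)
qed

text \<open>The map (1 - z) / z sends the critical points infinity, 0, 1 of multiplicities 4, 3, 1
  to - 1, infinity, 0.\<close>

lemma conjugate_quintic_31_f2: "moebius_conjugate (rat_map [:0, 0, 0, 0, 5, - 4:] [:1:]) f2"
  unfolding f2_eq
  by (rule moebius_conjugate_hom[OF coprime_one_poly, where n = 5 and a = "- 1" and b = 1 and c = 1 and d = 0 and \<mu> = 1])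
     (simp_all add: hom_def eval_nat_numeral algebra_simps)

text \<open>The map z / (1 - z) sends the critical points infinity, 0, 1 of multiplicities 4, 2, 2
  to - 1, 0, infinity.\<close>

lemma conjugate_quintic_22_f3: "moebius_conjugate (rat_map [:0, 0, 0, 10, - 15, 6:] [:1:]) f3"
  unfolding f3_eq
  by (rule moebius_conjugate_hom[OF coprime_one_poly, where n = 5 and a = 1 and b = 0 and c = "- 1" and d = 1 and \<mu> = 1])
     (simp_all add: hom_def eval_nat_numeral algebra_simps)

text \<open>For \<open>Q = [:1:]\<close> the Wronskian is P', so its factorisation determines P up
  to the constant term and the scalar \<open>\<kappa>\<close>; the fixed points 0 and 1 supply the
  remaining conditions.\<close>

lemma classify_const:
  assumes cf: "cf_pair 5 P Q" and Q: "Q = [:1:]" and "0 < i" "0 < j" "\<kappa> \<noteq> 0"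
    and W: "wronskian P Q = smult \<kappa> ([:0, 1:] ^ i * [:- 1, 1:] ^ j * [:- t, 1:] ^ k)"
  obtains p1 p2 p3 p4 p5 where "P = [:0, p1, p2, p3, p4, p5:]" "p1 + p2 + p3 + p4 + p5 = 1"
    "[:p1, 2 * p2, 3 * p3, 4 * p4, 5 * p5:] = smult \<kappa> ([:0, 1:] ^ i * [:- 1, 1:] ^ j * [:- t, 1:] ^ k)"
    "p5 \<noteq> 0"
proof -
  have "degree P = 5" using cf by (simp add: cf_pair_def)
  then obtain p0 p1 p2 p3 p4 p5 where p: "P = [:p0, p1, p2, p3, p4, p5:]" "p5 \<noteq> 0"
    by (rule degree_5_cases)
  note root = cf_pair_at_root[OF cf, unfolded W]
  have "p0 = 0" using root[of 0] assms(3) by (simp add: p)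
  moreover have "p0 + p1 + p2 + p3 + p4 + p5 = 1"
    using root[of 1] assms(4) by (simp add: p Q add.assoc)
  ultimately show ?thesis
    using that[of p1 p2 p3 p4 p5] W p by (simp add: Q wronskian_def pderiv_pCons)
qed

lemma classify_const_31:
  assumes "cf_pair 5 P [:1:]" "\<kappa> \<noteq> 0"
    and "wronskian P [:1:] = smult \<kappa> ([:0, 1:] ^ 3 * [:- 1, 1:] ^ 1 * [:- t, 1:] ^ 0)"
  shows "moebius_conjugate (rat_map P [:1:]) f2"
proof -
  obtain p1 p2 p3 p4 p5 where p: "P = [:0, p1, p2, p3, p4, p5:]" "p1 + p2 + p3 + p4 + p5 = 1"
    "[:p1, 2 * p2, 3 * p3, 4 * p4, 5 * p5:] = smult \<kappa> ([:0, 1:] ^ 3 * [:- 1, 1:] ^ 1 * [:- t, 1:] ^ 0)"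
    by (rule classify_const[OF assms(1) refl _ _ assms(2,3)]) auto
  from p(3) have e: "p1 = 0" "p2 = 0" "p3 = 0" "4 * p4 = - \<kappa>" "5 * p5 = \<kappa>"
    by (simp_all add: eval_nat_numeral)
  have "p5 = - 4" using p(2) e by algebra
  moreover from this have "p4 = 5" using p(2) e by simp
  ultimately have "P = [:0, 0, 0, 0, 5, - 4:]" using p(1) e by simp
  then show ?thesis using conjugate_quintic_31_f2 by simp
qed

lemma classify_const_22:
  assumes "cf_pair 5 P [:1:]" "\<kappa> \<noteq> 0"
    and "wronskian P [:1:] = smult \<kappa> ([:0, 1:] ^ 2 * [:- 1, 1:] ^ 2 * [:- t, 1:] ^ 0)"
  shows "moebius_conjugate (rat_map P [:1:]) f3"
proof -
  obtain p1 p2 p3 p4 p5 where p: "P = [:0, p1, p2, p3, p4, p5:]" "p1 + p2 + p3 + p4 + p5 = 1"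
    "[:p1, 2 * p2, 3 * p3, 4 * p4, 5 * p5:] = smult \<kappa> ([:0, 1:] ^ 2 * [:- 1, 1:] ^ 2 * [:- t, 1:] ^ 0)"
    by (rule classify_const[OF assms(1) refl _ _ assms(2,3)]) auto
  from p(3) have e: "p1 = 0" "p2 = 0" "3 * p3 = \<kappa>" "4 * p4 = - 2 * \<kappa>" "5 * p5 = \<kappa>"
    by (simp_all add: eval_nat_numeral)
  have "p5 = 6" using p(2) e by algebra
  moreover from this have "\<kappa> = 30" using e by simp
  moreover from this have "p3 = 10" "p4 = - 15" using e by simp_all
  ultimately have "P = [:0, 0, 0, 10, - 15, 6:]" using p(1) e by simp
  then show ?thesis using conjugate_quintic_22_f3 by simp
qed

lemma classify_const_211:
  assumes "cf_pair 5 P [:1:]" "\<kappa> \<noteq> 0" "t \<noteq> 0" "t \<noteq> 1"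
    and "wronskian P [:1:] = smult \<kappa> ([:0, 1:] ^ 2 * [:- 1, 1:] ^ 1 * [:- t, 1:] ^ 1)"
  shows "moebius_conjugate (rat_map P [:1:]) f5 \<or> moebius_conjugate (rat_map P [:1:]) f6"
proof -
  obtain p1 p2 a b c where p: "P = [:0, p1, p2, a, b, c:]" "p1 + p2 + a + b + c = 1"
    "[:p1, 2 * p2, 3 * a, 4 * b, 5 * c:] = smult \<kappa> ([:0, 1:] ^ 2 * [:- 1, 1:] ^ 1 * [:- t, 1:] ^ 1)" "c \<noteq> 0"
    by (rule classify_const[OF assms(1) refl _ _ assms(2,5)]) auto
  from p(3) have e: "p1 = 0" "p2 = 0" "3 * a = \<kappa> * t" "4 * b = - \<kappa> * (1 + t)" "5 * c = \<kappa>"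
    by (simp_all add: eval_nat_numeral algebra_simps)
  have "poly P t = t * poly [:1:] t"
    using cf_pair_at_root(1)[OF assms(1), of t] by (simp add: assms(5))
  then have "t * (t ^ 2 * (a + b * t + c * t ^ 2) - 1) = 0" unfolding p(1) e by simp algebra
  with \<open>t \<noteq> 0\<close> have t: "t ^ 2 * (a + b * t + c * t ^ 2) = 1" by simp
  \<comment> \<open>This is the fixed point condition at 1, the next equation the one at t. Their
    difference factors into the two cases leading to \<open>f5\<close> and
    \<open>f6\<close>.\<close>
  have c: "c * (5 * t - 3) = 12" using p(2) e by algebra
  have "c * (t ^ 3 * (5 - 3 * t)) = 12" using t e by algebra
  moreover have "c * ((t - 1) * (t + 1) * (3 * t ^ 2 - 5 * t + 3))
      = c * (5 * t - 3) - c * (t ^ 3 * (5 - 3 * t))" by algebra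
  ultimately have "c * ((t - 1) * (t + 1) * (3 * t ^ 2 - 5 * t + 3)) = 0"
    unfolding c by simp
  with \<open>c \<noteq> 0\<close> \<open>t \<noteq> 1\<close> consider "t + 1 = 0" | "3 * t ^ 2 - 5 * t + 3 = 0" by auto
  then show ?thesis
  proof cases
    case 1
    then have "t = - 1" by (simp add: eq_neg_iff_add_eq_0)
    have "c = c * (5 * t - 3) / (5 * t - 3)" using \<open>t = - 1\<close> by simp
    also have "\<dots> = 12 / (5 * t - 3)" by (simp only: c)
    also have "\<dots> = - 3 / 2" using \<open>t = - 1\<close> by simp
    finally have "c = - 3 / 2" .
    moreover from this e have "\<kappa> = - 15 / 2" by simp
    moreover have "a = \<kappa> * t / 3" using e(3) by (simp add: eq_divide_eq mult.commute)
    moreover have "b = 0" using e(4) \<open>t = - 1\<close> by simp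
    ultimately have "a = 5 / 2" "b = 0" "c = - 3 / 2" using \<open>t = - 1\<close> by simp_all
    then have "P = [:0, 0, 0, 5 / 2, 0, - 3 / 2:]" using p(1) e(1,2) by simp
    then have "[:0, 0, 0, 5, 0, - 3:] = smult 2 P" "[:2:] = smult 2 ([:1:] :: complex poly)" by simp_all
    then have "f5 = rat_map (smult 2 P) (smult 2 [:1:])" unfolding f5_eq by (simp only:)
    also have "\<dots> = rat_map P [:1:]" by (rule rat_map_smult) simp
    finally have "f5 = rat_map P [:1:]" .
    then show ?thesis using moebius_conjugate_refl by metis
  next
    case 2
    \<comment> \<open>The simple critical points of \<open>f6\<close> are the roots of 11 - 11z +
      3z^2, with sum and product 11/3. Scaling by A has to take them to 1 and t, which gives 11 A =
      3 (1 + t) and 11 A^2 = 3 t.\<close>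
    define A where "A = 3 / 11 * (1 + t)"
    have A: "11 * A = 3 * (1 + t)" by (simp add: A_def)
    have A2: "11 * A ^ 2 = 3 * t" unfolding A_def using 2 by (simp add: power2_eq_square field_simps) algebra
    have A0: "A \<noteq> 0" using A2 \<open>t \<noteq> 0\<close> by auto
    have "3 * (11 * (a * A ^ 2) - 20) = 0" using A2 e c 2 by algebra
    then have a: "11 * (a * A ^ 2) = 20" by simp
    have cc: "121 * (c * A ^ 4) = 36" using A2 c 2 by algebra
    have "12 * (b * A ^ 3 * 121 + 165) = 0" using A e(4,5) cc A2 c 2 by algebra
    then have "b * A ^ 3 * 121 + 165 = 0" by (rule numeral_mult_eq_0D)
    then have b: "121 * (b * A ^ 3) = - 165" by (simp add: eq_neg_iff_add_eq_0 mult.commute)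
    have "121 * (a * A ^ 3) = 11 * (11 * (a * A ^ 2)) * A" by algebra
    then have h3: "121 * (a * A ^ 3) = 220 * A" unfolding a by simp
    have "121 * (b * A ^ 4) = 121 * (b * A ^ 3) * A" by algebra
    then have h4: "121 * (b * A ^ 4) = - 165 * A" unfolding b by simp
    have "121 * (c * A ^ 5) = 121 * (c * A ^ 4) * A" by algebra
    then have h5: "121 * (c * A ^ 5) = 36 * A" unfolding cc by simp
    have "smult A [:0, 0, 0, 220, - 165, 36:] = smult 121 (pcompose (P - smult 0 [:1:]) [:0, A:])"
      unfolding p(1) e(1,2)
      by (rule poly_eqI_pointwise)
        (use h3 h4 h5 in \<open>simp add: poly_pcompose del: mult_cancel_left mult_cancel_right, algebra\<close>)
    from affine_conjugate(1)[OF assms(1) A0 _ this, of "[:121:]"]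
    have "moebius_conjugate (rat_map P [:1:]) f6" unfolding f6_eq by simp
    then show ?thesis ..
  qed
qed

section \<open>Linear denominators\<close>

text \<open>At the point 0 the difference P - 0 Q is P itself, so multiplicity at least two there
  makes P divisible by z^3. The inequalities for c are Q(0) \<noteq> 0 and Q(1) \<noteq> 0: critical
  points are fixed, hence not poles.\<close>

lemma classify_linear:
  assumes cf: "cf_pair 5 P Q" and "degree Q = 1" "lead_coeff Q = 1" "2 \<le> i" "0 < j"
    and W: "wronskian P Q = smult \<kappa> ([:0, 1:] ^ i * [:- 1, 1:] ^ j * [:- t, 1:] ^ k)"
  obtains p3 p4 p5 c where "P = [:0, 0, 0, p3, p4, p5:]" "Q = [:c, 1:]" "p3 + p4 + p5 = c + 1"
    "c \<noteq> 0" "c + 1 \<noteq> 0" "p5 \<noteq> 0"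
proof -
  have "degree P = 5" using cf by (simp add: cf_pair_def)
  then obtain p0 p1 p2 p3 p4 p5 where p: "P = [:p0, p1, p2, p3, p4, p5:]" "p5 \<noteq> 0"
    by (rule degree_5_cases)
  obtain c q1 where "Q = [:c, q1:]" "q1 \<noteq> 0" by (rule degree_1_cases[OF assms(2)])
  with assms(3) have q: "Q = [:c, 1:]" by (auto split: if_splits)
  note root = cf_pair_at_root[OF cf, unfolded W]
  have "[:- 0, 1:] ^ 2 dvd wronskian P Q"
    unfolding W using assms(4) by (intro dvd_smult dvd_mult2) (simp add: le_imp_power_dvd)
  note double = cf_pair_at_double_root[OF cf this]
  have "p0 = 0" "c \<noteq> 0" using root[of 0] assms(4) by (simp_all add: p q)
  moreover have "p1 = 0" "p2 = 0" using double by (simp_all add: p q pderiv_pCons)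
  moreover have "p0 + p1 + p2 + p3 + p4 + p5 = c + 1" "c + 1 \<noteq> 0"
    using root[of 1] assms(5) by (simp_all add: p q add.assoc)
  ultimately show ?thesis
    using that[of p3 p4 p5 c] p q by simp
qed

lemma classify_linear_32:
  assumes "cf_pair 5 P Q" "degree Q = 1" "lead_coeff Q = 1" "\<kappa> \<noteq> 0"
    and W: "wronskian P Q = smult \<kappa> ([:0, 1:] ^ 3 * [:- 1, 1:] ^ 2 * [:- t, 1:] ^ 0)"
  shows "moebius_conjugate (rat_map P Q) f4"
proof -
  obtain p3 a b c where p: "P = [:0, 0, 0, p3, a, b:]" and q: "Q = [:c, 1:]" and one: "p3 + a + b = c + 1"
    and c: "c \<noteq> 0" "c + 1 \<noteq> 0"
    by (rule classify_linear[OF assms(1-3) _ _ W]) auto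
  have p3: "p3 = 0" using W c unfolding p q wronskian_def
    by (simp add: pderiv_pCons eval_nat_numeral)
  have e: "4 * a * c = \<kappa>" "3 * a + 5 * b * c = - 2 * \<kappa>" "4 * b = \<kappa>"
    using W unfolding p q wronskian_def p3
    by (simp_all add: pderiv_pCons eval_nat_numeral algebra_simps)
  have "a \<noteq> 0" using e(1) assms(4) by auto
  have "4 * b = 4 * (a * c)" using e(1,3) by (simp add: mult.assoc)
  then have b: "b = a * c" by simp
  have "3 * a + 5 * b * c + 8 * (a * c) = 0" unfolding e(2) using e(1) by (simp add: mult.assoc)
  then have "a * ((5 * c + 3) * (c + 1)) = 0" using b by algebra
  with c \<open>a \<noteq> 0\<close> have c3: "5 * c = - 3" by (simp add: eq_neg_iff_add_eq_0)
  have "(c + 1) * (a - 1) = 0" using one b p3 by algebra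
  with c have "a = 1" by simp
  then have "[:0, 0, 0, 0, - 5, 3:] = smult (- 5) P" "[:3, - 5:] = smult (- 5) Q"
    using p q b p3 c3 by simp_all
  then have "f4 = rat_map (smult (- 5) P) (smult (- 5) Q)" unfolding f4_eq by (simp only:)
  also have "\<dots> = rat_map P Q" by (rule rat_map_smult) simp
  finally have "f4 = rat_map P Q" .
  then show ?thesis using moebius_conjugate_refl by metis
qed

lemma classify_linear_311:
  assumes cf: "cf_pair 5 P Q" and "degree Q = 1" "lead_coeff Q = 1" "\<kappa> \<noteq> 0" "t \<noteq> 0" "t \<noteq> 1"
    and W: "wronskian P Q = smult \<kappa> ([:0, 1:] ^ 3 * [:- 1, 1:] ^ 1 * [:- t, 1:] ^ 1)"
  shows "moebius_conjugate (rat_map P Q) f7 \<or> moebius_conjugate (rat_map P Q) f8"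
proof -
  obtain p3 a b c where p: "P = [:0, 0, 0, p3, a, b:]" and q: "Q = [:c, 1:]" and one: "p3 + a + b = c + 1"
    and c: "c \<noteq> 0" "c + 1 \<noteq> 0" and "b \<noteq> 0"
    by (rule classify_linear[OF assms(1-3) _ _ W]) auto
  have p3: "p3 = 0" using W c unfolding p q wronskian_def
    by (simp add: pderiv_pCons eval_nat_numeral)
  have e: "4 * a * c = \<kappa> * t" "3 * a + 5 * b * c = - \<kappa> * (1 + t)" "4 * b = \<kappa>"
    using W unfolding p q wronskian_def p3
    by (simp_all add: pderiv_pCons eval_nat_numeral algebra_simps)
  have "a \<noteq> 0" using e(1) assms by auto
  have bt: "b * t = a * c" using e by algebra
  have "poly P t = t * poly Q t"
    using cf_pair_at_root(1)[OF cf, of t] by (simp add: W)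
  then have "t * (t ^ 3 * (a + b * t) - (c + t)) = 0" unfolding p q p3 by simp algebra
  with \<open>t \<noteq> 0\<close> have t: "t ^ 3 * (a + b * t) = c + t" by simp
  have "a * (3 * t + 5 * c ^ 2 + 4 * c * (1 + t)) = 0" using e bt by algebra
  with \<open>a \<noteq> 0\<close> have E: "3 * t + 5 * c ^ 2 + 4 * c * (1 + t) = 0" by simp
  have at: "a * (t + c) = t * (c + 1)" using one p3 bt by algebra
  \<comment> \<open>With b t = a c, the fixed point conditions read a (t + c) = t (c + 1) at 1 and a
    t^3 (c + 1) = c + t at t. Multiplying the second by a yields (a t)^2 = 1.\<close>
  have "(c + 1) * (t * ((a * t - 1) * (a * t + 1))) = 0" using t at bt by algebra
  with c \<open>t \<noteq> 0\<close> have "a * t - 1 = 0 \<or> a * t + 1 = 0" by simp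
  then show ?thesis
  proof
    assume a: "a * t - 1 = 0"
    have "(t - 1) * (c * (1 + t) + t) = 0" using at a by algebra
    with \<open>t \<noteq> 1\<close> have c1: "c * (1 + t) + t = 0" by simp
    then have "1 + t \<noteq> 0" using \<open>t \<noteq> 0\<close> by auto
    have "t * ((1 + t) ^ 2 - 5 * t) = 0" using E c1 by algebra
    with \<open>t \<noteq> 0\<close> have t2: "(1 + t) ^ 2 - 5 * t = 0" by simp
    \<comment> \<open>The points 1 and t are to be A times the roots of 1 - 5z + 5z^2, whose sum is
      1; \<open>\<mu>\<close> normalises the constant coefficient of the denominator to 1.\<close>
    define A \<mu> where "A = 1 + t" and "\<mu> = 1 / c"
    have A0: "A \<noteq> 0" and m0: "\<mu> \<noteq> 0" and mc: "\<mu> * c = 1"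
      using \<open>1 + t \<noteq> 0\<close> c by (simp_all add: A_def \<mu>_def)
    have "A * (A + 5 * c) = 0" using c1 t2 unfolding A_def by algebra
    with A0 have A5: "A + 5 * c = 0" by simp
    then have mA: "\<mu> * A = - 5" using mc by algebra
    have aA: "a * A ^ 2 = 5" using a t2 unfolding A_def by algebra
    have bA: "b * A ^ 4 = 25 * c" using a aA bt t2 unfolding A_def by algebra
    have "\<mu> * (a * A ^ 4) = (\<mu> * A) * (a * A ^ 2) * A" by algebra
    then have h4: "\<mu> * (a * A ^ 4) = - 25 * A" by (simp add: mA aA)
    have "\<mu> * (b * A ^ 5) = (\<mu> * A) * (b * A ^ 4)" by algebra
    also have "\<dots> = - 25 * (5 * c)" by (simp add: mA bA)
    also have "\<dots> = 25 * A" using A5 by algebra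
    finally have h5: "\<mu> * (b * A ^ 5) = 25 * A" .
    have "smult A [:0, 0, 0, 0, - 25, 25:] = smult \<mu> (pcompose (P - smult 0 Q) [:0, A:])"
      unfolding p p3 by (rule poly_eqI_pointwise)
        (use h4 h5 in \<open>simp add: poly_pcompose del: mult_cancel_left mult_cancel_right, algebra\<close>)
    moreover have "[:1, - 5:] = smult \<mu> (pcompose Q [:0, A:])"
      unfolding q using mA mc by (simp add: pcompose_pCons)
    ultimately have "moebius_conjugate (rat_map P Q) (rat_map [:0, 0, 0, 0, - 25, 25:] [:1, - 5:])"
      by (rule affine_conjugate(1)[OF cf A0 m0])
    then show ?thesis using f7_conj(3) moebius_conjugate_trans by blast
  next
    assume a: "a * t + 1 = 0"
    have c1: "c * (1 + t ^ 2) + t * (1 + t) = 0" using at a by algebra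
    have "t * ((t - 1) ^ 2 * (t ^ 2 + 5 * t + 1)) = 0" using E c1 by algebra
    with \<open>t \<noteq> 0\<close> \<open>t \<noteq> 1\<close> have t2: "t ^ 2 + 5 * t + 1 = 0" by simp
    have "t * (5 * c - (1 + t)) = 0" using c1 t2 by algebra
    with \<open>t \<noteq> 0\<close> have c5: "5 * c - (1 + t) = 0" by simp
    \<comment> \<open>Here the roots of 3 + 15z - 25z^2 have sum 3/5, hence A = 5/3 (1 + t), and 1 +
      t = 5 c; the constant coefficient 9 of the model fixes \<open>\<mu>\<close>.\<close>
    define A \<mu> where "A = 25 / 3 * c" and "\<mu> = 9 / c"
    have A0: "A \<noteq> 0" and m0: "\<mu> \<noteq> 0" and mc: "\<mu> * c = 9" and A: "3 * A = 25 * c"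
      using c by (simp_all add: A_def \<mu>_def)
    have mA: "\<mu> * A = 75" using c by (simp add: A_def \<mu>_def)
    have "9 * (3 * A ^ 2 + 25 * t) = 0" using A c5 t2 by algebra
    then have A2: "3 * A ^ 2 + 25 * t = 0" by (rule numeral_mult_eq_0D)
    have aA: "3 * (a * A ^ 2) = 25" using a A2 by algebra
    have "9 * (b * A ^ 4) = (3 * A ^ 2) * (3 * A ^ 2) * b" by algebra
    also have "\<dots> = - 25 * (b * t) * (3 * A ^ 2)" using A2 by algebra
    also have "\<dots> = - 25 * (3 * (a * A ^ 2)) * c" unfolding bt by algebra
    finally have bA: "9 * (b * A ^ 4) = - 625 * c" unfolding aA by simp
    have "3 * (\<mu> * (a * A ^ 4)) = (\<mu> * A) * (3 * (a * A ^ 2)) * A" by algebra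
    also have "\<dots> = 3 * (625 * A)" unfolding aA mA by simp
    finally have h4: "\<mu> * (a * A ^ 4) = 625 * A" by simp
    have "9 * (\<mu> * (b * A ^ 5)) = (\<mu> * A) * (9 * (b * A ^ 4))" by algebra
    also have "\<dots> = - 625 * 3 * (25 * c)" unfolding bA mA by simp
    also have "\<dots> = 9 * (- 625 * A)" unfolding A[symmetric] by simp
    finally have h5: "\<mu> * (b * A ^ 5) = - 625 * A" by simp
    have "smult A [:0, 0, 0, 0, 625, - 625:] = smult \<mu> (pcompose (P - smult 0 Q) [:0, A:])"
      unfolding p p3 by (rule poly_eqI_pointwise)
        (use h4 h5 in \<open>simp add: poly_pcompose del: mult_cancel_left mult_cancel_right, algebra\<close>)
    moreover have "[:9, 75:] = smult \<mu> (pcompose Q [:0, A:])"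
      unfolding q using mA mc by (simp add: pcompose_pCons)
    ultimately have "moebius_conjugate (rat_map P Q) (rat_map [:0, 0, 0, 0, 625, - 625:] [:9, 75:])"
      by (rule affine_conjugate(1)[OF cf A0 m0])
    then show ?thesis using f8_conj(3) moebius_conjugate_trans by blast
  qed
qed

text \<open>The reflection z \<mapsto> 1 - z exchanges the two critical points of multiplicity
  two.\<close>

lemma fu_conjugate_minus:
  assumes "u ^ 4 + 310 * u ^ 2 - 375 = 0"
  shows "moebius_conjugate (fu u) (fu (- u))"
  unfolding fu_def
proof (rule affine_conjugate(1)[OF fu_cf(1)[OF assms], where A = "- 1" and B = 1 and \<mu> = 1])
  show "smult (- 1) [:0, 0, 0, 2 * (5 + - u), - (15 + - u), 6:] = smult 1 (pcompose
    ([:0, 0, 0, 2 * (5 + u), - (15 + u), 6:] - smult 1 [:1 - u, 2 * u:]) [:1, - 1:])"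
    by (rule poly_eqI_pointwise) (simp add: poly_pcompose, algebra)
  show "[:1 - - u, 2 * - u:] = smult 1 (pcompose [:1 - u, 2 * u:] [:1, - 1:])"
    by (rule poly_eqI_pointwise) (simp add: poly_pcompose, algebra)
qed simp_all

lemma fu_conjugate_f9_f10:
  assumes u: "u ^ 4 + 310 * u ^ 2 - 375 = 0"
  shows "moebius_conjugate (fu u) f9 \<or> moebius_conjugate (fu u) f10"
proof -
  define a where "a = complex_of_real (sqrt (5 * (4 * sqrt 61 - 31)))"
  define b where "b = \<i> * complex_of_real (sqrt (5 * (4 * sqrt 61 + 31)))"
  define w where "w = complex_of_real (sqrt 61)"
  have w: "w ^ 2 = 61" unfolding w_def by (simp flip: of_real_power)
  have a2: "a ^ 2 = 20 * w - 155" unfolding a_def fu_parameters by (simp add: w_def)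
  have b2: "b ^ 2 = - 20 * w - 155" unfolding b_def fu_parameters by (simp add: w_def)
  have "(u ^ 2 - a ^ 2) * (u ^ 2 - b ^ 2) = u ^ 4 + 310 * u ^ 2 + 24025 - 400 * w ^ 2"
    unfolding a2 b2 by algebra
  also have "\<dots> = 0" using u unfolding w by simp
  finally have "u ^ 2 = a ^ 2 \<or> u ^ 2 = b ^ 2" by simp
  then have "u = a \<or> u = - a \<or> u = b \<or> u = - b" unfolding power2_eq_iff by blast
  then have "u = a \<or> - u = a \<or> u = b \<or> - u = b" by auto
  moreover have "moebius_conjugate (fu u) (fu u)" "moebius_conjugate (fu u) (fu (- u))"
    using moebius_conjugate_refl fu_conjugate_minus[OF u] by auto
  ultimately show ?thesis unfolding f9_eq f10_eq a_def[symmetric] b_def[symmetric] by auto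
qed

lemma classify_linear_221:
  assumes cf: "cf_pair 5 P Q" and "degree Q = 1" "lead_coeff Q = 1" "\<kappa> \<noteq> 0" "t \<noteq> 0" "t \<noteq> 1"
    and W: "wronskian P Q = smult \<kappa> ([:0, 1:] ^ 2 * [:- 1, 1:] ^ 2 * [:- t, 1:] ^ 1)"
  shows "moebius_conjugate (rat_map P Q) f9 \<or> moebius_conjugate (rat_map P Q) f10"
proof -
  obtain a b c e where p: "P = [:0, 0, 0, a, b, c:]" and q: "Q = [:e, 1:]" and one: "a + b + c = e + 1"
    and e: "e \<noteq> 0" "e + 1 \<noteq> 0" and "c \<noteq> 0"
    by (rule classify_linear[OF assms(1-3) _ _ W]) auto
  have eqs: "3 * a * e = - \<kappa> * t" "2 * a + 4 * b * e = \<kappa> * (1 + 2 * t)"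
    "3 * b + 5 * c * e = - \<kappa> * (2 + t)" "4 * c = \<kappa>"
    using W unfolding p q wronskian_def
    by (simp_all add: pderiv_pCons eval_nat_numeral algebra_simps)
  \<comment> \<open>Elimination of a, b and \<open>\<kappa>\<close> from the four coefficient
    equations leaves one relation between t and e; the factor e + 1 is Q(1).\<close>
  have "c * ((e + 1) * (2 * t * (2 * e + 1) + e * (5 * e + 3))) = 0" using eqs by algebra
  with \<open>c \<noteq> 0\<close> e have T: "2 * t * (2 * e + 1) + e * (5 * e + 3) = 0" by simp
  have e2: "2 * e + 1 \<noteq> 0"
  proof
    assume h: "2 * e + 1 = 0"
    with T have "e = 0 \<or> 5 * e + 3 = 0" by simp
    with e h have "5 * e + 3 = 0" by simp
    then have "2 * (5 * e + 3) - 5 * (2 * e + 1) = 0" using h by simp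
    then show False by (simp add: algebra_simps)
  qed
  \<comment> \<open>The finite pole - e is to be the pole (u - 1) / (2u) of
    \<open>fu u\<close>.\<close>
  define u where "u = 1 / (2 * e + 1)"
  have u: "u * (2 * e + 1) = 1" and "u \<noteq> 0" using e2 by (simp_all add: u_def)
  have ue: "2 * u * e = 1 - u" using u by algebra
  have "u \<noteq> 1" using ue e by auto
  have ut: "8 * u * t = (u - 1) * (u + 5)" using T u by algebra
  have "u \<noteq> - 1"
  proof
    assume "u = - 1"
    with ut have "8 * t = 8" by (simp add: minus_equation_iff)
    with \<open>t \<noteq> 1\<close> show False by simp
  qed
  have "(e + 1) * (c * (4 * t + 5 * e) + 3 * e) = 0" using eqs one by algebra
  with e have "c * (4 * t + 5 * e) + 3 * e = 0" by simp
  then have "e * (c - 3 * (2 * e + 1)) = 0" using T by algebra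
  with e have c: "c = 3 * (2 * e + 1)" by simp
  have uc: "u * c = 3" using c u by algebra
  have "u * (3 * (2 * u * b + (15 + u))) = 0" using eqs(3,4) ut ue uc by algebra
  with \<open>u \<noteq> 0\<close> have ub: "2 * u * b = - (15 + u)"
    by (metis eq_neg_iff_add_eq_0 mult_eq_0_iff zero_neq_numeral)
  have "u * (2 * u * a - 2 * (5 + u)) = 0" using eqs(2,4) ut ue uc ub by algebra
  with \<open>u \<noteq> 0\<close> have ua: "2 * u * a = 2 * (5 + u)" by simp
  have "poly P t = t * poly Q t"
    using cf_pair_at_root(1)[OF cf, of t] by (simp add: W)
  then have t: "t ^ 3 * (a + b * t + c * t ^ 2) = t * (e + t)" unfolding p q by simp algebra
  have "t * (t - 1) * (6 * t ^ 3 - (9 + u) * t ^ 2 + (1 + u) * t + (1 - u)) = 0"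
    using t ua ub uc ue by algebra
  with assms(5,6) have "6 * t ^ 3 - (9 + u) * t ^ 2 + (1 + u) * t + (1 - u) = 0" by simp
  \<comment> \<open>Insertion of t into the same cubic as for \<open>fu_cf\<close>. The extra roots
    u = 1 and u = - 1 would give e = 0 and t = 1.\<close>
  then have "2 * ((u - 1) * (u + 1) * (u ^ 4 + 310 * u ^ 2 - 375)) = 0" using ut by algebra
  with \<open>u \<noteq> 1\<close> \<open>u \<noteq> - 1\<close> have quartic: "u ^ 4 + 310 * u ^ 2 - 375 = 0"
    by (simp add: eq_neg_iff_add_eq_0)
  have "[:0, 0, 0, 2 * (5 + u), - (15 + u), 6:] = smult (2 * u) P" "[:1 - u, 2 * u:] = smult (2 * u) Q"
    using p q ua ub uc ue by (simp_all add: mult.commute[of c u])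
  then have "fu u = rat_map (smult (2 * u) P) (smult (2 * u) Q)" unfolding fu_def by (simp only:)
  also have "\<dots> = rat_map P Q" by (rule rat_map_smult) (use \<open>u \<noteq> 0\<close> in simp)
  finally have "fu u = rat_map P Q" .
  then show ?thesis using fu_conjugate_f9_f10[OF quartic] by simp
qed

section \<open>Quadratic denominators\<close>

lemma classify_quadratic_222:
  assumes cf: "cf_pair 5 P Q" and "degree Q = 2" "\<kappa> \<noteq> 0" "t \<noteq> 0" "t \<noteq> 1"
    and W: "wronskian P Q = smult \<kappa> ([:0, 1:] ^ 2 * [:- 1, 1:] ^ 2 * [:- t, 1:] ^ 2)"
  shows "moebius_conjugate (rat_map P Q) f11"
proof -
  have "degree P = 5" using cf by (simp add: cf_pair_def)
  then obtain p0 p1 p2 a b c where p: "P = [:p0, p1, p2, a, b, c:]" "c \<noteq> 0"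
    by (rule degree_5_cases)
  obtain e g h where q: "Q = [:e, g, h:]" by (rule degree_2_cases[OF assms(2)])
  have dvd: "[:- z, 1:] ^ 2 dvd wronskian P Q" if "z \<in> {0, 1, t}" for z
    using that unfolding W by (auto intro!: dvd_smult)
  have root: "poly P z = z * poly Q z" if "z \<in> {0, 1, t}" for z
    using cf_pair_at_root(1)[OF cf, of z] that by (auto simp: W)
  note d1 = cf_pair_at_double_root(1)[OF cf dvd] and d2 = cf_pair_at_double_root(2)[OF cf dvd]
  have z: "p0 = 0" "p1 = 0" "p2 = 0"
    using root[of 0] d1[of 0] d2[of 0] by (simp_all add: p q pderiv_pCons)
  have one: "a + b + c = e + g + h" "3 * a + 4 * b + 5 * c = g + 2 * h" "6 * a + 12 * b + 20 * c = 2 * h"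
    using root[of 1] d1[of 1] d2[of 1] unfolding p q z by (simp_all add: pderiv_pCons algebra_simps)
  have "t * (t ^ 2 * (a + b * t + c * t ^ 2) - (e + g * t + h * t ^ 2)) = 0"
    using root[of t] unfolding p q z by simp algebra
  with assms(4) have t0: "t ^ 2 * (a + b * t + c * t ^ 2) = e + g * t + h * t ^ 2" by simp
  have "t * (t * (3 * a + 4 * b * t + 5 * c * t ^ 2) - (g + 2 * h * t)) = 0"
    using d1[of t] unfolding p q z by (simp add: pderiv_pCons) algebra
  with assms(4) have t1: "t * (3 * a + 4 * b * t + 5 * c * t ^ 2) = g + 2 * h * t" by simp
  have "t * (6 * a + 12 * b * t + 20 * c * t ^ 2 - 2 * h) = 0"
    using d2[of t] unfolding p q z by (simp add: pderiv_pCons) algebra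
  with assms(4) have t2: "6 * a + 12 * b * t + 20 * c * t ^ 2 = 2 * h" by simp
  \<comment> \<open>In suitable combinations of the conditions at 1 and at t the coefficients e, g,
    h of Q cancel and a factor t - 1 splits off. Three homogeneous linear equations for a, b, c
    remain.\<close>
  have "(t - 1) * (4 * (3 * b + 5 * c * (1 + t))) = 0" using one(3) t2 by algebra
  with assms(5) have b: "3 * b + 5 * c * (1 + t) = 0"
    by (metis mult_eq_0_iff right_minus_eq zero_neq_numeral)
  have "(t - 1) * (3 * a + 8 * b * (1 + t) + 15 * c * (1 + t + t ^ 2)) = 0" using one t1 t2 by algebra
  with assms(5) have a1: "3 * a + 8 * b * (1 + t) + 15 * c * (1 + t + t ^ 2) = 0" by simp
  have "(t - 1) * (a * (1 + t) + 3 * b * (1 + t + t ^ 2) + 6 * c * (1 + t) * (1 + t ^ 2)) = 0"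
    using one t0 t1 t2 by algebra
  with assms(5) have a2: "a * (1 + t) + 3 * b * (1 + t + t ^ 2) + 6 * c * (1 + t) * (1 + t ^ 2) = 0"
    by simp
  \<comment> \<open>Compatibility of these equations: one of 0, 1, t is the midpoint of the other
    two. In the cases below B is that midpoint and A the distance to the others, as the finite
    critical points of \<open>f11\<close> are - 1, 0, 1.\<close>
  have "c * (2 * ((t + 1) * (2 * t - 1) * (t - 2))) = 0" using b a1 a2 by algebra
  with p(2) consider "t + 1 = 0" | "2 * t - 1 = 0" | "t - 2 = 0" by auto
  moreover have "2 * (h - (3 * a + 6 * b + 10 * c)) = 0" using one by algebra
  then have h: "h = 3 * a + 6 * b + 10 * c"
    by (metis mult_eq_0_iff right_minus_eq zero_neq_numeral)
  have g: "g = - 3 * a - 8 * b - 15 * c" using one(2) h by algebra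
  have e: "e = a + 3 * b + 6 * c" using one(1) h g by algebra
  have "3 * b = - (5 * c * (1 + t))" using b by (simp only: eq_neg_iff_add_eq_0)
  then have b': "b = - (5 * c * (1 + t)) / 3" by (metis nonzero_mult_div_cancel_left zero_neq_numeral)
  have "3 * a = - (8 * b * (1 + t) + 15 * c * (1 + t + t ^ 2))"
    using a1 by (simp only: eq_neg_iff_add_eq_0 add.assoc)
  then have a': "a = - (8 * b * (1 + t) + 15 * c * (1 + t + t ^ 2)) / 3"
    by (metis nonzero_mult_div_cancel_left zero_neq_numeral)
  have key: ?thesis if "A \<noteq> 0" "\<mu> \<noteq> 0"
    "smult A [:0, 0, 0, - 5, 0, 1:] = smult \<mu> (pcompose (P - smult B Q) [:B, A:])"
    "[:1, 0, - 5:] = smult \<mu> (pcompose Q [:B, A:])" for A B \<mu>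
    unfolding f11_eq by (rule affine_conjugate(1)[OF cf that])
  ultimately show ?thesis
  proof cases
    case 1
    then have "t = - 1" by (simp add: eq_neg_iff_add_eq_0)
    with b' a' have "b = 0" "a = - 5 * c" by simp_all
    with b e g h have "Q = [:c, 0, - 5 * c:]" "P = [:0, 0, 0, - 5 * c, 0, c:]" using p q z by simp_all
    with p(2) show ?thesis by (intro key[of 1 "1 / c" 0]) simp_all
  next
    case 2
    then have "t = 1 / 2" by (simp add: field_simps)
    with b' have b: "b = - 5 / 2 * c" by simp
    with a' \<open>t = 1 / 2\<close> have "a = 5 / 4 * c" by (simp add: power2_eq_square field_simps)
    with b e g h have "Q = [:- c / 4, 5 / 4 * c, - 5 / 4 * c:]" "P = [:0, 0, 0, 5 / 4 * c, - 5 / 2 * c, c:]"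
      using p q z by simp_all
    with p(2) show ?thesis by (intro key[of "1 / 2" "16 / c" "1 / 2"]) (simp_all add: pcompose_pCons)
  next
    case 3
    then have "t = 2" by simp
    with b' have b: "b = - 5 * c" by simp
    with a' \<open>t = 2\<close> have "a = 5 * c" by (simp add: field_simps)
    with b e g h have "Q = [:- 4 * c, 10 * c, - 5 * c:]" "P = [:0, 0, 0, 5 * c, - 5 * c, c:]" 
      using p q z by simp_all
    with p(2) show ?thesis by (intro key[of 1 "1 / c" 1]) (simp_all add: pcompose_pCons)
  qed
qed

section \<open>Four finite critical points\<close>

text \<open>\<open>f12\<close> commutes with z \<mapsto> 1/z. The map (z + 1) / (z - 1) turns this
  symmetry into z \<mapsto> - z and sends the double critical point 1 to infinity, which yields an
  odd map.\<close>

lemma conjugate_f12_symmetric: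
  "moebius_conjugate f12 (rat_map [:0, 15, 0, - 30, 0, 7:] [:12, 0, - 20:])"
proof -
  have "coprime [:0, 0, 0, - 20, 5, 1:] ([:1, 5, - 20:] :: complex poly)"
    using f12_cf(1) by (simp add: cf_pair_def)
  then show ?thesis unfolding f12_eq
    by (rule moebius_conjugate_hom[where n = 5 and a = 1 and b = 1 and c = 1 and d = "- 1" and \<mu> = "- 8"])
       (simp_all add: hom_def eval_nat_numeral algebra_simps)
qed

text \<open>Here \<open>G\<close> is proportional to \<open>q + F'\<close> and to the product over the four finite critical points;
  the only other finite fixed point is moved to \<open>0\<close>, so that \<open>F\<close> is proportional to \<open>z G\<close> and
  \<open>q\<close> to \<open>4 G - z G'\<close>.\<close>

lemma four_roots_normal_form:
  assumes cf: "cf_pair 5 p q" and dq: "degree q \<le> 2"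
    and card: "card {z. poly (wronskian p q) z = 0} = 4"
    and triple: "degree q = 2 \<Longrightarrow> \<forall>z. \<not> [:- z, 1:] ^ 3 dvd wronskian p q"
  obtains \<beta> \<gamma> \<delta> where
    "moebius_conjugate (rat_map p q) (rat_map [:0, 5 * \<delta>, 4 * \<gamma>, 3 * \<beta>, 0, 1:] [:4 * \<delta>, 3 * \<gamma>, 2 * \<beta>:])"
    "cf_pair 5 [:0, 5 * \<delta>, 4 * \<gamma>, 3 * \<beta>, 0, 1:] [:4 * \<delta>, 3 * \<gamma>, 2 * \<beta>:]"
    "\<beta> \<noteq> 0 \<Longrightarrow> \<forall>z. \<not> [:- z, 1:] ^ 3 dvd
      wronskian [:0, 5 * \<delta>, 4 * \<gamma>, 3 * \<beta>, 0, 1:] [:4 * \<delta>, 3 * \<gamma>, 2 * \<beta>:]"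
proof -
  define F where "F = p - [:0, 1:] * q"
  define E where "E = q + pderiv F"
  have "degree q + 2 \<le> 5" using dq by simp
  note props = cf_pair_card_roots[OF cf this, folded F_def, folded E_def]
  have dE: "degree E = 4" and lE: "coeff E 4 = 5 * coeff F 5" using props(4,5) by simp_all
  have E0: "E \<noteq> 0" using dE by auto
  have "E dvd F"
    by (rule poly_dvd_if_vanishes[of "{z. poly (wronskian p q) z = 0}"])
       (use props(2) dE E0 card in \<open>auto intro: card_ge_0_finite\<close>)
  then obtain s where s: "F = E * s" by (elim dvdE)
  have F0: "F \<noteq> 0" using props(3) by auto
  have "degree s = 1" using props(3) dE F0 unfolding s by (simp add: degree_mult_eq)
  then obtain s0 s1 where s01: "s = [:s0, s1:]" "s1 \<noteq> 0" by (rule degree_1_cases)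
  have "coeff F 5 = coeff E 4 * s1"
    using coeff_mult_degree_sum[of E s] dE s01 by (simp add: s)
  with lE have "coeff E 4 * (5 * s1 - 1) = 0" by (simp add: algebra_simps)
  with dE E0 have s1: "s1 = 1 / 5"
    using leading_coeff_0_iff[of E] by (simp add: field_simps)
  \<comment> \<open>D is the root of the linear cofactor of E in F, the fixed point that is to be
    moved to 0.\<close>
  define D where "D = - 5 * s0"
  define l where "l = coeff E 4"
  have l: "l \<noteq> 0" using E0 dE leading_coeff_0_iff[of E] by (simp add: l_def)
  define G where "G = pcompose (smult (1 / l) E) [:D, 1:]"
  have "degree G = 4" using dE l by (simp add: G_def degree_pcompose)
  have lG: "coeff G 4 = 1"
    using coeff_pcompose_shift[of "smult (1 / l) E" 4 D] dE l by (simp add: G_def l_def)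
  define P Q where "P = smult (5 / l) (pcompose (p - smult D q) [:D, 1:])"
    and "Q = smult (5 / l) (pcompose q [:D, 1:])"
  have m: "5 / l \<noteq> 0" using l by simp
  have P1: "smult 1 P = smult (5 / l) (pcompose (p - smult D q) [:D, 1:])" by (simp add: P_def)
  note aff = affine_conjugate[OF cf one_neq_zero m P1 Q_def]
  have PQ: "P - [:0, 1:] * Q = [:0, 1:] * G"
  proof (rule poly_eqI_pointwise)
    fix x
    have "poly F (D + x) = poly E (D + x) * (x / 5)"
      by (simp add: s s01(1) s1 D_def field_simps)
    then show "poly (P - [:0, 1:] * Q) x = poly ([:0, 1:] * G) x"
      using l by (simp add: P_def Q_def G_def F_def poly_pcompose field_simps)
  qed
  have QG: "Q + pderiv (P - [:0, 1:] * Q) = smult 5 G"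
  proof -
    have "P - [:0, 1:] * Q = smult (5 / l) (pcompose F [:D, 1:])"
      by (rule poly_eqI_pointwise) (simp add: P_def Q_def F_def poly_pcompose algebra_simps)
    then have "Q + pderiv (P - [:0, 1:] * Q) = smult (5 / l) (pcompose E [:D, 1:])"
      by (simp add: pderiv_smult pderiv_pcompose_linear Q_def E_def pcompose_add smult_add_right)
    then show ?thesis by (simp add: G_def pcompose_smult)
  qed
  have "length (coeffs G) = 5" using \<open>degree G = 4\<close> by (subst length_coeffs_degree) auto
  then obtain \<delta> \<gamma> \<beta> \<alpha> \<epsilon> where "coeffs G = [\<delta>, \<gamma>, \<beta>, \<alpha>, \<epsilon>]"
    by (auto simp: eval_nat_numeral length_Suc_conv)
  moreover have "G = Poly (coeffs G)" by simp
  ultimately have "G = [:\<delta>, \<gamma>, \<beta>, \<alpha>, \<epsilon>:]" by simp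
  with lG have G: "G = [:\<delta>, \<gamma>, \<beta>, \<alpha>, 1:]" by (simp add: eval_nat_numeral)
  have Q: "Q = [:4 * \<delta>, 3 * \<gamma>, 2 * \<beta>, \<alpha>:]"
  proof -
    have "Q = smult 5 G - pderiv ([:0, 1:] * G)" using QG unfolding PQ by (metis add_diff_cancel_right')
    then show ?thesis by (simp add: G pderiv_pCons)
  qed
  \<comment> \<open>The coefficient of z^3 in 4 G - z G' is that of G itself, so the degree bound on
    the denominator removes the cubic term of G.\<close>
  have "\<alpha> = 0" using aff(3) dq by (auto simp: Q split: if_splits)
  have Q': "Q = [:4 * \<delta>, 3 * \<gamma>, 2 * \<beta>:]" using Q \<open>\<alpha> = 0\<close> by simp
  have P': "P = [:0, 5 * \<delta>, 4 * \<gamma>, 3 * \<beta>, 0, 1:]"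
  proof -
    have "P = [:0, 1:] * G + [:0, 1:] * Q" using PQ by (metis diff_add_cancel)
    then show ?thesis by (simp add: G Q' \<open>\<alpha> = 0\<close>)
  qed
  show ?thesis
  proof (rule that)
    show "moebius_conjugate (rat_map p q) (rat_map [:0, 5 * \<delta>, 4 * \<gamma>, 3 * \<beta>, 0, 1:] [:4 * \<delta>, 3 * \<gamma>, 2 * \<beta>:])"
      "cf_pair 5 [:0, 5 * \<delta>, 4 * \<gamma>, 3 * \<beta>, 0, 1:] [:4 * \<delta>, 3 * \<gamma>, 2 * \<beta>:]"
      using aff(1,2) unfolding P' Q' .
    assume "\<beta> \<noteq> 0"
    then have "degree q = 2" using aff(3) by (simp add: Q')
    note triple = triple[OF this]
    show "\<forall>z. \<not> [:- z, 1:] ^ 3 dvd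
      wronskian [:0, 5 * \<delta>, 4 * \<gamma>, 3 * \<beta>, 0, 1:] [:4 * \<delta>, 3 * \<gamma>, 2 * \<beta>:]"
    proof (intro allI notI)
      fix z
      assume "[:- z, 1:] ^ 3 dvd wronskian [:0, 5 * \<delta>, 4 * \<gamma>, 3 * \<beta>, 0, 1:] [:4 * \<delta>, 3 * \<gamma>, 2 * \<beta>:]"
      then obtain r where r: "wronskian P Q = [:- z, 1:] ^ 3 * r" unfolding P' Q' by (elim dvdE)
      have "wronskian p q = [:- (z + D), 1:] ^ 3 * smult ((l / 5) ^ 2) (pcompose r [:- D, 1:])"
      proof (rule poly_eqI_pointwise)
        fix x
        have "poly (wronskian P Q) (x - D) = (5 / l) ^ 2 * poly (wronskian p q) x"
          unfolding aff(4) by (simp add: poly_pcompose)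
        then have "poly (wronskian p q) x = (l / 5) ^ 2 * poly (wronskian P Q) (x - D)"
          using l by (simp add: field_simps)
        then show "poly (wronskian p q) x
          = poly ([:- (z + D), 1:] ^ 3 * smult ((l / 5) ^ 2) (pcompose r [:- D, 1:])) x"
          unfolding r by (simp add: poly_pcompose algebra_simps)
      qed
      with triple show False by (metis dvd_triv_left)
    qed
  qed
qed

text \<open>With G the quartic \<open>C\<close>, F = z G and Q + F' = 5 G, the Wronskian is G (5 Q -
  z Q') = \<open>C * S\<close>. Critical points are zeros of F, and 0 is not a root of
  \<open>S\<close>, so every root of \<open>S\<close> is also one of \<open>C\<close>. The degree 0,
  1 or 2 of \<open>S\<close> separates \<open>f13\<close>, \<open>f14\<close> and
  \<open>f12\<close>.\<close>

lemma classify_four_roots_normal: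
  assumes cf: "cf_pair 5 [:0, 5 * \<delta>, 4 * \<gamma>, 3 * \<beta>, 0, 1:] [:4 * \<delta>, 3 * \<gamma>, 2 * \<beta>:]"
    and triple: "\<beta> \<noteq> 0 \<Longrightarrow> \<forall>z. \<not> [:- z, 1:] ^ 3 dvd 
      wronskian [:0, 5 * \<delta>, 4 * \<gamma>, 3 * \<beta>, 0, 1:] [:4 * \<delta>, 3 * \<gamma>, 2 * \<beta>:]"
  shows "\<exists>g \<in> {f12, f13, f14}. moebius_conjugate
    (rat_map [:0, 5 * \<delta>, 4 * \<gamma>, 3 * \<beta>, 0, 1:] [:4 * \<delta>, 3 * \<gamma>, 2 * \<beta>:]) g"
proof -
  let ?P = "[:0, 5 * \<delta>, 4 * \<gamma>, 3 * \<beta>, 0, 1:]" and ?Q = "[:4 * \<delta>, 3 * \<gamma>, 2 * \<beta>:]"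
  define C S where "C = [:\<delta>, \<gamma>, \<beta>, 0, 1:]" and "S = [:20 * \<delta>, 12 * \<gamma>, 6 * \<beta>:]"
  have W: "wronskian ?P ?Q = C * S"
    by (simp add: C_def S_def wronskian_def pderiv_pCons algebra_simps)
  have cop: "coprime ?P ?Q" and fix': "\<And>z. poly (wronskian ?P ?Q) z = 0 \<Longrightarrow> poly ?P z = z * poly ?Q z"
    using cf by (auto simp: cf_pair_def)
  have d: "\<delta> \<noteq> 0" using coprime_poly_0[OF cop, of 0] by simp
  have CS: "poly C z = 0" if "poly S z = 0" for z
  proof -
    have "z \<noteq> 0" using that d by (auto simp: S_def)
    have "poly ?P z = z * poly ?Q z" using that by (intro fix') (simp add: W)
    then have "z * poly C z = 0" unfolding C_def by simp algebra
    with \<open>z \<noteq> 0\<close> show ?thesis by simp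
  qed
  have conj: "moebius_conjugate (rat_map ?P ?Q) (rat_map P Q)"
    if "A \<noteq> 0" "\<mu> \<noteq> 0"
      "\<And>w. A * poly P w = \<mu> * (poly ?P (B + w * A) - B * poly ?Q (B + w * A))"
      "\<And>w. poly Q w = \<mu> * poly ?Q (B + w * A)" for A B \<mu> P Q
    by (rule affine_conjugate(1)[OF cf that(1,2), where B = B])
       (rule poly_eqI_pointwise, simp only: poly_smult poly_pcompose poly_diff that, simp)+
  show ?thesis
  proof (cases "\<beta> = 0")
    case True
    show ?thesis
    proof (cases "\<gamma> = 0")
      case True
      \<comment> \<open>The critical points are the fourth roots of - \<delta>. Those of
        \<open>f13\<close> are the vertices of a square with centre 1/2 and opposite vertices 0 and
        1, so A/2 has to be such a root and the translation is by - A/2.\<close>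
      obtain A where A: "A ^ 4 = - 16 * \<delta>" using nth_root_exists[of 4] by auto
      with d have A0: "A \<noteq> 0" by auto
      define \<mu> where "\<mu> = 1 / (4 * \<delta>)"
      have mu: "\<mu> \<noteq> 0" "4 * \<mu> * \<delta> = 1" using d by (simp_all add: \<mu>_def)
      have "moebius_conjugate (rat_map ?P ?Q) f13"
        unfolding f13_eq
      proof (rule conj[OF A0 mu(1), where B = "- A / 2"])
        fix w
        have 1: "\<mu> * A ^ 5 = - 4 * A" using A mu(2) by algebra
        have "\<mu> * (poly ?P (- A / 2 + w * A) - - A / 2 * poly ?Q (- A / 2 + w * A))
          = (\<mu> * A ^ 5) * (w - 1 / 2) ^ 5 + (4 * \<mu> * \<delta>) * (5 / 4 * A * (w - 1 / 2) + A / 2)"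
          using \<open>\<beta> = 0\<close> True by (simp add: eval_nat_numeral field_simps)
        also have "\<dots> = A * poly [:0, 0, 5, - 10, 10, - 4:] w"
          unfolding 1 mu(2) by (simp add: eval_nat_numeral field_simps)
        finally show "A * poly [:0, 0, 5, - 10, 10, - 4:] w
          = \<mu> * (poly ?P (- A / 2 + w * A) - - A / 2 * poly ?Q (- A / 2 + w * A))" by (rule sym)
        show "poly [:1:] w = \<mu> * poly ?Q (- A / 2 + w * A)"
          using \<open>\<beta> = 0\<close> True mu(2) by (simp add: mult.assoc mult.left_commute)
      qed
      then show ?thesis by blast
    next
      case False
      \<comment> \<open>c is the root of \<open>S\<close>, the double critical point. The coordinate
        (z - c) / c puts it at 0 and the non-critical fixed point 0 at - 1.\<close>
      define c where "c = - 5 * \<delta> / (3 * \<gamma>)"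
      have c: "3 * \<gamma> * c = - 5 * \<delta>" using False by (simp add: c_def)
      have c0: "c \<noteq> 0" using False d by (simp add: c_def)
      have "poly S c = 0" using c \<open>\<beta> = 0\<close> unfolding S_def by simp algebra
      then have "poly C c = 0" by (rule CS)
      then have Cc: "c ^ 4 + \<gamma> * c + \<delta> = 0" unfolding C_def using \<open>\<beta> = 0\<close> by simp algebra
      have "c * (5 * c ^ 3 + 2 * \<gamma>) = 0" using Cc c by algebra
      with c0 have g: "2 * \<gamma> = - (5 * c ^ 3)" by (simp add: eq_neg_iff_add_eq_0 add.commute)
      have "5 * (2 * \<delta> - 3 * c ^ 4) = 0" using g c by algebra
      then have "2 * \<delta> - 3 * c ^ 4 = 0" by (rule numeral_mult_eq_0D)
      then have dl: "2 * \<delta> = 3 * c ^ 4" by simp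
      define \<mu> where "\<mu> = - 2 / c ^ 4"
      have mu: "\<mu> \<noteq> 0" "\<mu> * c ^ 4 = - 2" using c0 by (simp_all add: \<mu>_def)
      have mg: "2 * (\<mu> * (\<gamma> * c)) = 10" using g mu(2) by algebra
      have md: "2 * (\<mu> * \<delta>) = - 6" using dl mu(2) by algebra
      have "moebius_conjugate (rat_map ?P ?Q) (rat_map [:0, 0, 0, - 20, - 10, - 2:] [:3, 15:])"
      proof (rule conj[OF c0 mu(1), where B = c])
        fix w
        show "c * poly [:0, 0, 0, - 20, - 10, - 2:] w = \<mu> * (poly ?P (c + w * c) - c * poly ?Q (c + w * c))"
        proof -
          have "2 * (\<mu> * (poly ?P (c + w * c) - c * poly ?Q (c + w * c)))
            = c * (2 * (\<mu> * c ^ 4) * (1 + w) ^ 5 + 2 * (\<mu> * \<delta>) * (5 * (1 + w) - 4)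
              + 2 * (\<mu> * (\<gamma> * c)) * (4 * (1 + w) ^ 2 - 3 * (1 + w)))"
            using \<open>\<beta> = 0\<close> by (simp add: eval_nat_numeral algebra_simps)
          also have "\<dots> = 2 * (c * poly [:0, 0, 0, - 20, - 10, - 2:] w)"
            unfolding mu(2) md mg by simp algebra
          finally show ?thesis by (rule numeral_mult_cancelD[symmetric])
        qed
        have "2 * (\<mu> * poly ?Q (c + w * c)) = 4 * (2 * (\<mu> * \<delta>)) + 3 * (2 * (\<mu> * (\<gamma> * c))) * (1 + w)"
          using \<open>\<beta> = 0\<close> by (simp add: algebra_simps)
        also have "\<dots> = 2 * poly [:3, 15:] w" unfolding md mg by simp
        finally show "poly [:3, 15:] w = \<mu> * poly ?Q (c + w * c)"
          by (rule numeral_mult_cancelD[symmetric])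
      qed
      then show ?thesis using f14_conj(3) moebius_conjugate_trans by blast
    qed
  next
    case False
    have "\<not> constant (poly S)" using False by (simp add: constant_degree S_def)
    then obtain s where s: "poly S s = 0" using fundamental_theorem_of_algebra by blast
    \<comment> \<open>By the sum of the roots, t is the second root of \<open>S\<close>.\<close>
    define t where "t = - 2 * \<gamma> / \<beta> - s"
    have g: "2 * \<gamma> = - \<beta> * (s + t)" using False by (simp add: t_def)
    have "6 * \<beta> * s ^ 2 + 6 * (2 * \<gamma>) * s + 20 * \<delta> = 0" using s unfolding S_def by simp algebra
    then have "2 * (10 * \<delta> - 3 * \<beta> * s * t) = 0" unfolding g by algebra
    then have "10 * \<delta> - 3 * \<beta> * s * t = 0" by (rule numeral_mult_eq_0D)
    then have dl: "10 * \<delta> = 3 * \<beta> * s * t" by simp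
    have "12 * \<gamma> = - 6 * \<beta> * (s + t)" using g by algebra
    moreover have "20 * \<delta> = 6 * \<beta> * (s * t)" using dl by algebra
    ultimately have S: "S = smult (6 * \<beta>) ([:- s, 1:] * [:- t, 1:])"
      unfolding S_def by (simp only:) (simp add: algebra_simps)
    have st0: "s \<noteq> 0" "t \<noteq> 0" using dl d by auto
    have "s \<noteq> t"
    proof
      assume "s = t"
      have "[:- s, 1:] dvd C" using CS[OF s] by (simp add: poly_eq_0_iff_dvd)
      moreover have "[:- s, 1:] ^ 2 dvd S" unfolding S \<open>s = t\<close> power2_eq_square by (rule dvd_smult) simp
      ultimately have "[:- s, 1:] * [:- s, 1:] ^ 2 dvd C * S" by (rule mult_dvd_mono)
      moreover have "[:- s, 1:] * [:- s, 1:] ^ 2 = [:- s, 1:] ^ 3" by (simp add: eval_nat_numeral)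
      ultimately show False using triple[OF False] unfolding W by metis
    qed
    have "poly S t = 0" unfolding S poly_smult poly_mult by simp
    then have "poly C t = 0" by (rule CS)
    then have "10 * t ^ 4 + 10 * \<beta> * t ^ 2 + 5 * (2 * \<gamma>) * t + 10 * \<delta> = 0"
      unfolding C_def by simp algebra
    then have "t * (10 * t ^ 3 + \<beta> * (5 * t - 2 * s)) = 0" unfolding g dl by algebra
    with st0 have t: "10 * t ^ 3 + \<beta> * (5 * t - 2 * s) = 0" by simp
    have "10 * s ^ 4 + 10 * \<beta> * s ^ 2 + 5 * (2 * \<gamma>) * s + 10 * \<delta> = 0"
      using CS[OF s] unfolding C_def by simp algebra
    then have "s * (10 * s ^ 3 + \<beta> * (5 * s - 2 * t)) = 0" unfolding g dl by algebra
    with st0 have s': "10 * s ^ 3 + \<beta> * (5 * s - 2 * t) = 0" by simp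
    \<comment> \<open>Elimination of \<open>\<beta>\<close> from the conditions at s and t. The
      surviving cases say that among 0, s, t one point is the midpoint of the other two.\<close>
    have "10 * ((s - t) * ((s + t) * ((2 * s - t) * (s - 2 * t)))) = 0" using s' t by algebra
    with \<open>s \<noteq> t\<close> have cases: "s + t = 0 \<or> 2 * s - t = 0 \<or> s - 2 * t = 0" by simp
    \<comment> \<open>Here r is the midpoint of 0 and the other double critical point 2r. In the
      coordinate (z - r) / r the points r, 2r and 0 become 0, 1 and - 1; for \<open>f12\<close> the
      first two are double critical points and - 1 is the fixed point that is not critical.\<close>
    have end_point: "moebius_conjugate (rat_map ?P ?Q) f12"
      if r: "r \<noteq> 0" "\<beta> = - 10 * r ^ 2" "\<gamma> = 15 * r ^ 3" "\<delta> = - 6 * r ^ 4" for r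
    proof -
      define \<mu> where "\<mu> = 1 / r ^ 4"
      have mu: "\<mu> \<noteq> 0" "\<mu> * r ^ 4 = 1" using r(1) by (simp_all add: \<mu>_def)
      show ?thesis
        unfolding f12_eq
      proof (rule conj[OF r(1) mu(1), where B = r])
        fix w
        have "\<mu> * (poly ?P (r + w * r) - r * poly ?Q (r + w * r))
          = (\<mu> * r ^ 4) * (r * poly [:0, 0, 0, - 20, 5, 1:] w)"
          unfolding r(2-4) by simp algebra
        then show "r * poly [:0, 0, 0, - 20, 5, 1:] w = \<mu> * (poly ?P (r + w * r) - r * poly ?Q (r + w * r))"
          by (simp only: mu(2) mult_1_left)
        have "\<mu> * poly ?Q (r + w * r) = (\<mu> * r ^ 4) * poly [:1, 5, - 20:] w"
          unfolding r(2-4) by simp algebra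
        then show "poly [:1, 5, - 20:] w = \<mu> * poly ?Q (r + w * r)"
          by (simp only: mu(2) mult_1_left)
      qed
    qed
    from cases show ?thesis
    proof (elim disjE)
      assume "s + t = 0"
      then have ts: "t = - s" by (simp add: eq_neg_iff_add_eq_0 add.commute)
      have "s * (10 * s ^ 2 + 7 * \<beta>) = 0" using s' ts by algebra
      with st0 have b: "7 * \<beta> = - 10 * s ^ 2" by (simp add: eq_neg_iff_add_eq_0 add.commute)
      have "\<gamma> = 0" using g ts by simp
      have "70 * \<delta> = 3 * (7 * \<beta>) * s * t" using dl by algebra
      then have "10 * (7 * \<delta> - 3 * s ^ 4) = 0" unfolding b ts by algebra
      then have "7 * \<delta> - 3 * s ^ 4 = 0" by (rule numeral_mult_eq_0D)
      then have dd: "7 * \<delta> = 3 * s ^ 4" by simp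
      \<comment> \<open>The double critical points s and - s are scaled to 1 and - 1, as in the
        symmetric form of \<open>f12\<close>.\<close>
      define \<mu> where "\<mu> = 7 / s ^ 4"
      have mu: "\<mu> \<noteq> 0" "\<mu> * s ^ 4 = 7" using st0 by (simp_all add: \<mu>_def)
      have "7 * (\<mu> * (\<beta> * s ^ 2)) = 7 * (- 10)" using b mu(2) by algebra
      then have mb: "\<mu> * (\<beta> * s ^ 2) = - 10" by (rule numeral_mult_cancelD)
      have "7 * (\<mu> * \<delta>) = 7 * 3" using dd mu(2) by algebra
      then have md: "\<mu> * \<delta> = 3" by (rule numeral_mult_cancelD)
      have "moebius_conjugate (rat_map ?P ?Q) (rat_map [:0, 15, 0, - 30, 0, 7:] [:12, 0, - 20:])"
      proof (rule conj[OF st0(1) mu(1), where B = 0])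
        fix w
        have "\<mu> * (poly ?P (0 + w * s) - 0 * poly ?Q (0 + w * s))
          = s * ((\<mu> * s ^ 4) * w ^ 5 + 3 * (\<mu> * (\<beta> * s ^ 2)) * w ^ 3 + 5 * (\<mu> * \<delta>) * w)"
          using \<open>\<gamma> = 0\<close> by (simp add: eval_nat_numeral algebra_simps)
        also have "\<dots> = s * poly [:0, 15, 0, - 30, 0, 7:] w"
          unfolding mu(2) mb md by simp algebra
        finally show "s * poly [:0, 15, 0, - 30, 0, 7:] w
          = \<mu> * (poly ?P (0 + w * s) - 0 * poly ?Q (0 + w * s))" by (rule sym)
        have "\<mu> * poly ?Q (0 + w * s) = 4 * (\<mu> * \<delta>) + 2 * (\<mu> * (\<beta> * s ^ 2)) * w ^ 2"
          using \<open>\<gamma> = 0\<close> by (simp add: eval_nat_numeral algebra_simps)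
        also have "\<dots> = poly [:12, 0, - 20:] w" unfolding mb md by simp algebra
        finally show "poly [:12, 0, - 20:] w = \<mu> * poly ?Q (0 + w * s)" by (rule sym)
      qed
      then show ?thesis
        using moebius_conjugate_sym[OF conjugate_f12_symmetric] moebius_conjugate_trans by blast
    next
      assume "2 * s - t = 0"
      then have ts: "t = 2 * s" by simp
      have "s * (10 * s ^ 2 + \<beta>) = 0" using s' ts by algebra
      with st0 have b: "\<beta> = - 10 * s ^ 2" by (simp add: eq_neg_iff_add_eq_0 add.commute)
      have "2 * (\<gamma> - 15 * s ^ 3) = 0" using g unfolding ts b by algebra
      then have "\<gamma> - 15 * s ^ 3 = 0" by (rule numeral_mult_eq_0D)
      moreover have "10 * (\<delta> + 6 * s ^ 4) = 0" using dl unfolding ts b by algebra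
      then have "\<delta> + 6 * s ^ 4 = 0" by (rule numeral_mult_eq_0D)
      ultimately show ?thesis using end_point[OF st0(1) b] by (simp add: eq_neg_iff_add_eq_0)
    next
      assume "s - 2 * t = 0"
      then have ts: "s = 2 * t" by simp
      have "t * (10 * t ^ 2 + \<beta>) = 0" using t ts by algebra
      with st0 have b: "\<beta> = - 10 * t ^ 2" by (simp add: eq_neg_iff_add_eq_0 add.commute)
      have "2 * (\<gamma> - 15 * t ^ 3) = 0" using g unfolding ts b by algebra
      then have "\<gamma> - 15 * t ^ 3 = 0" by (rule numeral_mult_eq_0D)
      moreover have "10 * (\<delta> + 6 * t ^ 4) = 0" using dl unfolding ts b by algebra
      then have "\<delta> + 6 * t ^ 4 = 0" by (rule numeral_mult_eq_0D)
      ultimately show ?thesis using end_point[OF st0(2) b] by (simp add: eq_neg_iff_add_eq_0)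
    qed
  qed
qed

lemma classify_four_roots:
  assumes cf: "cf_pair 5 p q" and dq: "degree q \<le> 2"
    and card: "card {z. poly (wronskian p q) z = 0} = 4"
    and triple: "degree q = 2 \<Longrightarrow> \<forall>z. \<not> [:- z, 1:] ^ 3 dvd wronskian p q"
  shows "\<exists>g \<in> {f12, f13, f14}. moebius_conjugate (rat_map p q) g"
proof (rule four_roots_normal_form[OF assms])
  fix \<beta> \<gamma> \<delta>
  assume *: "moebius_conjugate (rat_map p q)
      (rat_map [:0, 5 * \<delta>, 4 * \<gamma>, 3 * \<beta>, 0, 1:] [:4 * \<delta>, 3 * \<gamma>, 2 * \<beta>:])"
    "cf_pair 5 [:0, 5 * \<delta>, 4 * \<gamma>, 3 * \<beta>, 0, 1:] [:4 * \<delta>, 3 * \<gamma>, 2 * \<beta>:]"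
    "\<beta> \<noteq> 0 \<Longrightarrow> \<forall>z. \<not> [:- z, 1:] ^ 3 dvd
      wronskian [:0, 5 * \<delta>, 4 * \<gamma>, 3 * \<beta>, 0, 1:] [:4 * \<delta>, 3 * \<gamma>, 2 * \<beta>:]"
  show ?thesis
    using classify_four_roots_normal[OF *(2,3)] moebius_conjugate_trans[OF *(1)] by blast
qed

section \<open>The classification\<close>

lemma classify_two_roots:
  assumes cf: "cf_pair 5 p q" and "\<kappa> \<noteq> 0" "a \<noteq> b"
    and W: "wronskian p q = smult \<kappa> ([:- a, 1:] ^ i * [:- b, 1:] ^ j)"
    and sum: "i + j = 4 + degree q" and le: "i \<le> 4 - degree q" "j \<le> i" "0 < j"
  shows "\<exists>g \<in> {f2, f3, f4}. moebius_conjugate (rat_map p q) g"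
proof -
  have "wronskian p q = smult \<kappa> ([:- a, 1:] ^ i * [:- b, 1:] ^ j * [:- a, 1:] ^ 0)" using W by simp
  then obtain P Q \<kappa>' where 1: "moebius_conjugate (rat_map p q) (rat_map P Q)" "cf_pair 5 P Q"
    "degree Q = degree q" "lead_coeff Q = 1" "\<kappa>' \<noteq> 0"
    "wronskian P Q = smult \<kappa>' ([:0, 1:] ^ i * [:- 1, 1:] ^ j * [:- ((a - a) / (b - a)), 1:] ^ 0)"
    by (rule normalise_two_points[OF cf \<open>a \<noteq> b\<close> _ \<open>\<kappa> \<noteq> 0\<close>]) blast
  have "degree q = 0 \<and> i = 3 \<and> j = 1 \<or> degree q = 0 \<and> i = 2 \<and> j = 2 \<or> degree q = 1 \<and> i = 3 \<and> j = 2"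
    using sum le by presburger
  then have "\<exists>g \<in> {f2, f3, f4}. moebius_conjugate (rat_map P Q) g"
  proof (elim disjE conjE)
    assume d: "degree q = 0" "i = 3" "j = 1"
    with 1 have Q: "Q = [:1:]" by (metis degree_eq_zeroE lead_coeff_pCons(2) pCons_0_0 coeff_pCons_0)
    from classify_const_31[OF 1(2)[unfolded Q] 1(5) 1(6)[unfolded Q d]] show ?thesis unfolding Q by blast
  next
    assume d: "degree q = 0" "i = 2" "j = 2"
    with 1 have Q: "Q = [:1:]" by (metis degree_eq_zeroE lead_coeff_pCons(2) pCons_0_0 coeff_pCons_0)
    from classify_const_22[OF 1(2)[unfolded Q] 1(5) 1(6)[unfolded Q d]] show ?thesis unfolding Q by blast
  next
    assume d: "degree q = 1" "i = 3" "j = 2"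
    from classify_linear_32[OF 1(2) 1(3)[unfolded d] 1(4,5) 1(6)[unfolded d]] show ?thesis by blast
  qed
  with moebius_conjugate_trans[OF 1(1)] show ?thesis by blast
qed

lemma classify_three_roots:
  assumes cf: "cf_pair 5 p q" and "\<kappa> \<noteq> 0" "a \<noteq> b" "a \<noteq> c" "b \<noteq> c"
    and W: "wronskian p q = smult \<kappa> ([:- a, 1:] ^ i * [:- b, 1:] ^ j * [:- c, 1:] ^ k)"
    and sum: "i + j + k = 4 + degree q" and le: "i \<le> 4 - degree q" "j \<le> i" "k \<le> j" "0 < k"
  shows "\<exists>g \<in> {f5, f6, f7, f8, f9, f10, f11}. moebius_conjugate (rat_map p q) g"
proof -
  define t where "t = (c - a) / (b - a)"
  have t: "t \<noteq> 0" "t \<noteq> 1" using assms(3-5) by (auto simp: t_def)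
  obtain P Q \<kappa>' where 1: "moebius_conjugate (rat_map p q) (rat_map P Q)" "cf_pair 5 P Q"
    "degree Q = degree q" "lead_coeff Q = 1" "\<kappa>' \<noteq> 0"
    "wronskian P Q = smult \<kappa>' ([:0, 1:] ^ i * [:- 1, 1:] ^ j * [:- t, 1:] ^ k)"
    unfolding t_def by (rule normalise_two_points[OF cf \<open>a \<noteq> b\<close> W \<open>\<kappa> \<noteq> 0\<close>]) blast
  have "degree q \<le> 2"
  proof (rule ccontr)
    assume "\<not> degree q \<le> 2"
    then have "i \<le> 1" using le(1) by simp
    with \<open>\<not> degree q \<le> 2\<close> sum le(2,3) show False by linarith
  qed
  then consider "degree q = 0" | "degree q = 1" | "degree q = 2" by linarith
  then have "degree q = 0 \<and> i = 2 \<and> j = 1 \<and> k = 1 \<or> degree q = 1 \<and> i = 3 \<and> j = 1 \<and> k = 1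
    \<or> degree q = 1 \<and> i = 2 \<and> j = 2 \<and> k = 1 \<or> degree q = 2 \<and> i = 2 \<and> j = 2 \<and> k = 2"
  proof cases
    case 1
    with sum le show ?thesis by (simp; arith)
  next
    case 2
    with sum le show ?thesis by (simp; arith)
  next
    case 3
    with sum le show ?thesis by simp
  qed
  then have "\<exists>g \<in> {f5, f6, f7, f8, f9, f10, f11}. moebius_conjugate (rat_map P Q) g"
  proof (elim disjE conjE)
    assume d: "degree q = 0" "i = 2" "j = 1" "k = 1"
    with 1 have Q: "Q = [:1:]" by (metis degree_eq_zeroE lead_coeff_pCons(2) pCons_0_0 coeff_pCons_0)
    from classify_const_211[OF 1(2)[unfolded Q] 1(5) t 1(6)[unfolded Q d]] show ?thesis unfolding Q by blast
  next
    assume d: "degree q = 1" "i = 3" "j = 1" "k = 1"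
    from classify_linear_311[OF 1(2) 1(3)[unfolded d] 1(4,5) t 1(6)[unfolded d]] show ?thesis by blast
  next
    assume d: "degree q = 1" "i = 2" "j = 2" "k = 1"
    from classify_linear_221[OF 1(2) 1(3)[unfolded d] 1(4,5) t 1(6)[unfolded d]] show ?thesis by blast
  next
    assume d: "degree q = 2" "i = 2" "j = 2" "k = 2"
    from classify_quadratic_222[OF 1(2) 1(3)[unfolded d] 1(5) t 1(6)[unfolded d]] show ?thesis by blast
  qed
  with moebius_conjugate_trans[OF 1(1)] show ?thesis by blast
qed

lemma sort_two:
  fixes f :: "'a \<Rightarrow> nat"
  assumes "card R = 2"
  obtains a b where "R = {a, b}" "a \<noteq> b" "f b \<le> f a"
proof -
  obtain a b where "R = {a, b}" "a \<noteq> b" using assms by (auto simp: card_2_iff)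
  then show ?thesis using that[of a b] that[of b a] by (cases "f b \<le> f a") auto
qed

lemma sort_three:
  fixes f :: "'a \<Rightarrow> nat"
  assumes "card R = 3"
  obtains a b c where "R = {a, b, c}" "a \<noteq> b" "a \<noteq> c" "b \<noteq> c" "f b \<le> f a" "f c \<le> f b"
proof -
  have "finite R" "R \<noteq> {}" using assms by (auto intro: card_ge_0_finite)
  then have "Max (f ` R) \<in> f ` R" by (intro Max_in) auto
  then obtain a where "a \<in> R" "Max (f ` R) = f a" by auto
  with \<open>finite R\<close> have a: "a \<in> R" "\<And>x. x \<in> R \<Longrightarrow> f x \<le> f a"
    by (metis Max_ge finite_imageI imageI)+
  have "card (R - {a}) = 2" using assms a(1) \<open>finite R\<close> by simp
  then obtain b c where bc: "R - {a} = {b, c}" "b \<noteq> c" "f c \<le> f b" by (rule sort_two)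
  then have "R = {a, b, c}" "a \<noteq> b" "a \<noteq> c" using a(1) by auto
  with that bc a(2) show ?thesis by blast
qed

lemma set_quintic_maps: "set quintic_maps = {f1, f2, f3, f4, f5, f6, f7, f8, f9, f10, f11, f12, f13, f14}"
  by (simp add: quintic_maps_def)

theorem critically_fixed_quintic_classification:
  assumes "rational_map_of_degree 5 f" "critically_fixed f"
  shows "\<exists>g \<in> set quintic_maps. moebius_conjugate f g"
proof -
  obtain p q where f: "moebius_conjugate f (rat_map p q)" and cf: "cf_pair 5 p q"
    and ord: "\<And>z. order z (wronskian p q) \<le> 4 - degree q"
    using exists_reduced_cf_pair[OF assms] by auto
  define W where "W = wronskian p q"
  define R where "R = {z. poly W z = 0}"
  define d where "d = degree q"
  have deg: "degree p = 5" "d < 5" using cf by (auto simp: cf_pair_def d_def)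
  have "q \<noteq> 0" using cf by (rule cf_pair_nonzero)
  then have dW: "degree W = 4 + d" and W0: "W \<noteq> 0"
    using degree_wronskian[of q p] deg by (simp_all add: W_def d_def)
  have sum: "(\<Sum>z\<in>R. order z W) = 4 + d"
    unfolding R_def dW[symmetric] by (rule sum_order_eq_degree[OF W0])
  have pos: "0 < order z W" if "z \<in> R" for z using that W0 by (auto simp: R_def order_root)
  have ord: "order z W \<le> 4 - d" for z using ord by (simp add: W_def d_def)
  have decomp: "W = smult (lead_coeff W) (\<Prod>z\<in>R. [:- z, 1:] ^ order z W)"
    unfolding R_def by (rule complex_poly_decompose[symmetric])
  have lc: "lead_coeff W \<noteq> 0" using W0 by simp
  \<comment> \<open>For d = 3 this requires at least seven zeros, against the bound of four; for d =
    4 the right-hand side is 0.\<close>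
  have "4 + d \<le> card R * (4 - d)"
    using sum_bounded_above[of R "\<lambda>z. order z W" "4 - d"] ord by (simp add: sum)
  moreover have "card R < 5" if "d \<le> 3"
    using cf_pair_card_roots(1)[OF cf] that by (simp add: R_def W_def d_def)
  ultimately have d2: "d \<le> 2" and card: "card R < 5" "card R \<noteq> 0"
    using deg(2) by (auto simp: less_Suc_eq numeral_eq_Suc)
  have "\<exists>g \<in> set quintic_maps. moebius_conjugate (rat_map p q) g"
  proof -
    consider "card R = 1" | "card R = 2" | "card R = 3" | "card R = 4"
      using card by linarith
    then show ?thesis
    proof cases
      case 1
      then obtain a where a: "R = {a}" by (auto simp: card_1_singleton_iff)
      then have "order a W = 4 + d" using sum by simp
      with ord[of a] have "d = 0" "order a W = 4" by simp_all
      with decomp have "wronskian p q = smult (lead_coeff W) ([:- a, 1:] ^ 4)" "degree q = 0"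
        by (simp_all add: a W_def d_def)
      from classify_const_4[OF cf this(2,1)] show ?thesis by (auto simp: set_quintic_maps)
    next
      case 2
      then obtain a b where ab: "R = {a, b}" "a \<noteq> b" "order b W \<le> order a W" by (rule sort_two)
      have "wronskian p q = smult (lead_coeff W) ([:- a, 1:] ^ order a W * [:- b, 1:] ^ order b W)"
        using decomp ab by (simp add: W_def)
      from classify_two_roots[OF cf lc ab(2) this] show ?thesis
        using sum ord[of a] pos[of b] ab by (auto simp: set_quintic_maps d_def)
    next
      case 3
      then obtain a b c where ab: "R = {a, b, c}" "a \<noteq> b" "a \<noteq> c" "b \<noteq> c"
        "order b W \<le> order a W" "order c W \<le> order b W" by (rule sort_three)
      have "wronskian p q = smult (lead_coeff W)
          ([:- a, 1:] ^ order a W * [:- b, 1:] ^ order b W * [:- c, 1:] ^ order c W)"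
        using decomp ab by (simp add: W_def mult.assoc)
      from classify_three_roots[OF cf lc ab(2,3,4) this] show ?thesis
        using sum ord[of a] pos[of c] ab by (auto simp: set_quintic_maps d_def)
    next
      case 4
      have "\<forall>z. \<not> [:- z, 1:] ^ 3 dvd wronskian p q" if "degree q = 2"
      proof
        fix z
        show "\<not> [:- z, 1:] ^ 3 dvd wronskian p q"
          using ord[of z] that W0 by (simp add: order_divides W_def d_def)
      qed
      with classify_four_roots[OF cf] d2 4 show ?thesis
        by (auto simp: set_quintic_maps d_def R_def W_def)
    qed
  qed
  with moebius_conjugate_trans[OF f] show ?thesis by blast
qed

lemma quintic_maps_critically_fixed:
  assumes "f \<in> set quintic_maps"
  shows "rational_map_of_degree 5 f \<and> critically_fixed f"
proof -
  have "\<exists>p q. cf_pair 5 p q \<and> f = rat_map p q"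
    using assms unfolding set_quintic_maps insert_iff empty_iff
    using f1_cf(1) f1_eq f2_cf(1) f2_eq f3_cf(1) f3_eq f4_cf(1) f4_eq f5_cf(1) f5_eq f6_cf(1) f6_eq
      f7_conj(1,2) f8_conj(1,2) fu_cf(1)[OF fu_parameters(3)] fu_cf(1)[OF fu_parameters(4)] f9_eq f10_eq fu_def
      f11_cf(1) f11_eq f12_cf(1) f12_eq f13_cf(1) f13_eq f14_conj(1,2)
    by (elim disjE; metis)
  then show ?thesis using cf_pairD by blast
qed

lemma profile_quintic_maps:
  "map profile quintic_maps = [(2, 0, 0), (1, 1, 0), (1, 0, 2), (0, 2, 1), (1, 0, 1), (1, 0, 1),
    (0, 2, 0), (0, 2, 0), (0, 1, 2), (0, 1, 2), (0, 0, 4), (0, 0, 3), (1, 0, 0), (0, 1, 1)]"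
  unfolding quintic_maps_def
  by (simp only: list.map f1_cf f2_cf f3_cf f4_cf f5_cf f6_cf f11_cf f12_cf f13_cf
      profile_conjugate[OF f7_conj(3), symmetric] g7_cf profile_conjugate[OF f8_conj(3), symmetric] g8_cf
      profile_conjugate[OF f14_conj(3), symmetric] g14_cf
      f9_eq f10_eq fu_cf(4)[OF fu_parameters(3)] fu_cf(4)[OF fu_parameters(4)])

lemma quintic_maps_not_conjugate:
  assumes "i < 14" "j < 14" "i \<noteq> j"
  shows "\<not> moebius_conjugate (quintic_maps ! i) (quintic_maps ! j)"
proof
  assume c: "moebius_conjugate (quintic_maps ! i) (quintic_maps ! j)"
  let ?L = "[(2, 0, 0), (1, 1, 0), (1, 0, 2), (0, 2, 1), (1, 0, 1), (1, 0, 1),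
    (0, 2, 0), (0, 2, 0), (0, 1, 2), (0, 1, 2), (0, 0, 4), (0, 0, 3), (1, 0, 0), (0, 1, 1)] :: (nat \<times> nat \<times> nat) list"
  have len: "length quintic_maps = 14" by (simp add: quintic_maps_def)
  have "map profile quintic_maps ! i = map profile quintic_maps ! j"
    using profile_conjugate[OF c] assms len by simp
  then have "?L ! i = ?L ! j" unfolding profile_quintic_maps .
  moreover have "\<forall>i \<in> set [0..<14]. \<forall>j \<in> set [0..<14]. i \<noteq> j \<longrightarrow> ?L ! i = ?L ! j \<longrightarrow>
      (i, j) \<in> set [(4, 5), (5, 4), (6, 7), (7, 6), (8, 9), (9, 8)]"
    by code_simp
  ultimately have "(i, j) \<in> {(4, 5), (5, 4), (6, 7), (7, 6), (8, 9), (9, 8)}"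
    using assms by simp
  moreover have "quintic_maps ! 4 = f5" "quintic_maps ! 5 = f6" "quintic_maps ! 6 = f7"
    "quintic_maps ! 7 = f8" "quintic_maps ! 8 = f9" "quintic_maps ! 9 = f10"
    by (simp_all add: quintic_maps_def)
  ultimately show False
    using c not_conjugate_f5_f6 not_conjugate_f7_f8 not_conjugate_f9_f10 moebius_conjugate_sym by auto
qed

theorem theoremB:
  shows "(\<forall>i<14. rational_map_of_degree 5 (quintic_maps ! i) \<and> critically_fixed (quintic_maps ! i)) \<and>
    (\<forall>i<14. \<forall>j<14. i \<noteq> j \<longrightarrow> \<not> moebius_conjugate (quintic_maps ! i) (quintic_maps ! j)) \<and>
    (\<forall>f. rational_map_of_degree 5 f \<and> critically_fixed f \<longrightarrow>
      (\<exists>i<14. moebius_conjugate f (quintic_maps ! i)))"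
proof -
  have len: "length quintic_maps = 14" by (simp add: quintic_maps_def)
  then have "quintic_maps ! i \<in> set quintic_maps" if "i < 14" for i using that by simp
  moreover have "\<exists>i<14. moebius_conjugate f (quintic_maps ! i)"
    if "rational_map_of_degree 5 f" "critically_fixed f" for f
    using critically_fixed_quintic_classification[OF that] by (metis in_set_conv_nth len)
  ultimately show ?thesis
    using quintic_maps_critically_fixed quintic_maps_not_conjugate by blast
qed

end
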